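(* Let $\lambda\ge 1$, $0<\theta\ll 1<M$ and $1<N_2\le N_1$. Let $\phi_{N_1},\phi_{N_2}\in L^2(\mathbb{R}\times\mathbb{T}_\lambda)$ be functions whose Fourier transforms are supported in $\{|\xi|\sim N_1\}$ and $\{|\xi|\sim N_2\}$ respectively. Define, for $z=(x,y)\in\mathbb{R}\times\mathbb{T}_\lambda$ and writing $\xi_j=(\mu_j,\eta_j)\in\mathbb{R}\times\mathbb{Z}_{1/\lambda}$, $j=1,2$, $$F(t,z)=\int_{(\mathbb{R}\times\mathbb{Z}_{1/\lambda})^2}e^{-it(|\xi_1|^2+|\xi_2|^2)-iz\cdot(\xi_1+\xi_2)}\,1_{|\mu_1-\mu_2|\gtrsim M}\,1_{|\cos\angle(\xi_1,\xi_2)|\le\theta}\,\widehat{\phi_{N_1}}(\xi_1)\,\widehat{\phi_{N_2}}(\xi_2)\,(d\xi_1)_\lambda(d\xi_2)_\lambda .$$ Then $$\|F\|_{L^2([0,1]\times\mathbb{R}\times\mathbb{T}_\lambda)}\lesssim\Big(\frac1{\lambda M}+\theta\Big)^{1/2}\|\phi_{N_1}\|_{L^2(\mathbb{R}\times\mathbb{T}_\lambda)}\|\phi_{N_2}\|_{L^2(\mathbb{R}\times\mathbb{T}_\lambda)},$$ with implied constant independent of $\lambda,M,\theta,N_1,N_2,\phi_{N_1},\phi_{N_2}$.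
   Context: For $\lambda\ge1$: $\mathbb{T}_\lambda=\lambda\mathbb{T}=\mathbb{R}/2\pi\lambda\mathbb{Z}$, $\mathbb{Z}_{1/\lambda}=\frac1\lambda\mathbb{Z}$, and $$\int_{\mathbb{R}\times\mathbb{Z}_{1/\lambda}}f(\xi)\,(d\xi)_\lambda:=\frac1\lambda\sum_{\eta\in\mathbb{Z}_{1/\lambda}}\int_{\mathbb{R}}f(\mu,\eta)\,d\mu .$$ The Fourier transform is $\widehat f(\xi)=\frac1{2\pi}\int_{\mathbb{R}\times\mathbb{T}_\lambda}f(z)e^{-iz\cdot\xi}dz$ for $\xi=(\mu,\eta)\in\mathbb{R}\times\mathbb{Z}_{1/\lambda}$; Plancherel holds with the measure $(d\xi)_\lambda$ on the frequency side. $\angle(\xi_1,\xi_2)$ is the angle between $\xi_1,\xi_2$ as vectors of $\mathbb{R}^2$. $|\xi|\sim N$ means $c_1N\le|\xi|\le c_2N$, and $|\mu_1-\mu_2|\gtrsim M$ means $|\mu_1-\mu_2|\ge c_3M$, for fixed absolute constants $c_1,c_2,c_3>0$; $\theta\ll1$ means $\theta\le c_4$ for a sufficiently small absolute constant $c_4>0$. The implied constant may depend on the $c_i$. *)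

theory Defs
  imports "HOL-Analysis.Analysis"
begin

definition in_L2 :: "'a measure \<Rightarrow> ('a \<Rightarrow> complex) \<Rightarrow> bool" where
  "in_L2 M f \<longleftrightarrow> f \<in> borel_measurable M \<and> integrable M (\<lambda>x. (cmod (f x))\<^sup>2)"

definition L2_norm :: "'a measure \<Rightarrow> ('a \<Rightarrow> complex) \<Rightarrow> real" where
  "L2_norm M f = sqrt (LINT x|M. (cmod (f x))\<^sup>2)"

text \<open>The cylinder \<open>\<real> \<times> \<real>/2\<pi>l\<int>\<close> is represented by the fundamental domain \<open>\<real> \<times> [0, 2\<pi>l)\<close>;
  functions on it are functions on the plane that are \<open>2\<pi>l\<close>-periodic in the second variable.\<close>

definition cyl :: "real \<Rightarrow> (real \<times> real) measure" where
  "cyl l = lborel \<Otimes>\<^sub>M restrict_space lborel {0..<2 * pi * l}"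

definition L2_cyl :: "real \<Rightarrow> (real \<times> real \<Rightarrow> complex) \<Rightarrow> bool" where
  "L2_cyl l f \<longleftrightarrow> (\<forall>x y. f (x, y + 2 * pi * l) = f (x, y)) \<and> in_L2 (cyl l) f"

text \<open>The frequency space \<open>\<real> \<times> (1/l)\<int>\<close> as a subset of the plane, with the measure
  \<open>(d\<xi>)\<^sub>l\<close>: Lebesgue measure times \<open>1/l\<close> times counting measure.\<close>

definition freq :: "real \<Rightarrow> (real \<times> real) measure" where
  "freq l = lborel \<Otimes>\<^sub>M
     scale_measure (ennreal (1 / l)) (count_space (range (\<lambda>k::int. of_int k / l)))"

definition fourier :: "real \<Rightarrow> (real \<times> real \<Rightarrow> complex) \<Rightarrow> real \<times> real \<Rightarrow> complex" where
  "fourier l f \<xi> =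
     of_real (1 / (2 * pi)) * (LINT z|cyl l. f z * exp (- \<i> * of_real (z \<bullet> \<xi>)))"

text \<open>An \<open>L\<^sup>2\<close> function need not be integrable on the cylinder, so its Fourier transform is
  the usual Plancherel extension: \<open>g\<close> (determined up to null sets) is the \<open>L\<^sup>2\<close> limit of the
  transforms of the truncations of \<open>f\<close> to \<open>\<bar>x\<bar> \<le> R\<close>. The nonnegative integral excludes
  convergence by a default value of the Bochner integral.\<close>

definition has_fourier_L2 ::
  "real \<Rightarrow> (real \<times> real \<Rightarrow> complex) \<Rightarrow> (real \<times> real \<Rightarrow> complex) \<Rightarrow> bool" where
  "has_fourier_L2 l f g \<longleftrightarrow> in_L2 (freq l) g \<and>
     ((\<lambda>R::real. \<integral>\<^sup>+ \<xi>. ennreal ((cmod (g \<xi> -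
          fourier l (\<lambda>z. if \<bar>fst z\<bar> \<le> R then f z else 0) \<xi>))\<^sup>2) \<partial>freq l) \<longlongrightarrow> 0) at_top"

text \<open>For a zero vector this is \<open>\<pi>/2\<close> by the convention \<open>x / 0 = 0\<close>.\<close>

definition vec_angle :: "real \<times> real \<Rightarrow> real \<times> real \<Rightarrow> real" where
  "vec_angle u v = arccos (u \<bullet> v / (norm u * norm v))"

text \<open>The function \<open>F\<close> built from frequency profiles \<open>g1\<close>, \<open>g2\<close>; \<open>K\<close> is the lower bound imposed
  on \<open>\<bar>\<mu>\<^sub>1 - \<mu>\<^sub>2\<bar>\<close>.\<close>

definition bilin ::
  "real \<Rightarrow> real \<Rightarrow> real \<Rightarrow> (real \<times> real \<Rightarrow> complex) \<Rightarrow> (real \<times> real \<Rightarrow> complex) \<Rightarrow>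
     real \<Rightarrow> real \<times> real \<Rightarrow> complex" where
  "bilin l K \<theta> g1 g2 t z =
     (LINT (\<xi>1, \<xi>2)|(freq l \<Otimes>\<^sub>M freq l).
        exp (- \<i> * of_real (t * ((norm \<xi>1)\<^sup>2 + (norm \<xi>2)\<^sup>2)) - \<i> * of_real (z \<bullet> (\<xi>1 + \<xi>2)))
        * of_bool (\<bar>fst \<xi>1 - fst \<xi>2\<bar> \<ge> K)
        * of_bool (\<bar>cos (vec_angle \<xi>1 \<xi>2)\<bar> \<le> \<theta>)
        * g1 \<xi>1 * g2 \<xi>2)"

end

(* Split xi_1 into sectors of width theta. Near-orthogonality then confines xi_2 to the
   boundedly overlapping orthogonal sectors, so by the triangle inequality and Cauchy-Schwarz in
   the sector index it suffices to bound the contribution of a single sector.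

   For one sector a TT* argument in space-time, with Gaussian weights in t and x and exact
   orthogonality in y, reduces the claim to the measure of the pairs with prescribed sum and
   prescribed |xi_1|^2 + |xi_2|^2. These pairs lie on a circle, on which xi_1 is confined to an arc
   of angle O(theta) because by Thales the circle passes nearly through the origin and so
   crosses the sector transversally. The density on the lines eta = k/l is 1/|mu_1 - mu_2|, and summing it
   over the lines that meet the arc gives O(theta) plus one boundary term O(1/(l M)). *)

theory Submission
  imports Defs "HOL-Probability.Characteristic_Functions"
begin

subsection \<open>Gaussian weights\<close>

text \<open>For a prescribed sum, prescribing |xi_1|^2 + |xi_2|^2 amounts to prescribing the inner
  product of xi_1 and xi_2; this is how near-orthogonality becomes a condition on a circle.
  Gaussians serve because weight and transform are both positive: the weight majorizes a multiple of
  the indicator of the region of integration, and the kernel is explicit and nonnegative, as a Schur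
  test wants it. The width \<open>A\<close> of the Gaussian in x drops out of the bound, so letting
  it grow exhausts the cylinder. The threshold on \<theta> must be absolute while the annuli carry
  arbitrary constants c1, c2. \<open>1/10\<close> works because for \<theta> large compared with c1
  / c2 the bound on the arc is trivial. There are about 1/\<theta> sectors, so their number must not
  enter: the masses of the sector pieces are the Cauchy-Schwarz weights. Of Plancherel only one
  inequality is proved, up to a factor, by the same Schur test with position and frequency
  exchanged. The \<open>144\<close> in the final constant is the square of that factor 12.\<close>

definition gauss :: "real \<Rightarrow> real \<Rightarrow> real" where
  "gauss a x = exp (- ((x / a)\<^sup>2 / 2))"

lemma gauss_measurable [measurable]: "gauss a \<in> borel_measurable borel"
  unfolding gauss_def by measurable

lemma gauss_pos: "0 < gauss a x" by (simp add: gauss_def)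

lemma gauss_1_eq: "gauss 1 x = sqrt (2 * pi) * std_normal_density x"
  by (simp add: gauss_def std_normal_density_def)

text \<open>Each Gaussian weight of width \<open>a\<close> costs a factor 2 against the indicator of
  [-a, a], since exp (-1/2) is at least 1 - 1/2.\<close>

lemma gauss_ge: 
  assumes "0 < a" "\<bar>x\<bar> \<le> a" shows "1 / 2 \<le> gauss a x"
proof -
  have "\<bar>x / a\<bar> \<le> 1" using assms by simp
  then have "(x / a)\<^sup>2 \<le> 1" by (simp add: abs_square_le_1)
  then have "1 + - (1/2) \<le> gauss a x" unfolding gauss_def
    by (intro order_trans[OF _ exp_ge_add_one_self]) auto
  then show ?thesis by simp
qed

lemma has_bochner_integral_gauss:
  assumes "0 < a"
  shows "has_bochner_integral lborel (gauss a) (a * sqrt (2 * pi))"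
proof -
  have "has_bochner_integral lborel (\<lambda>x. sqrt (2 * pi) * std_normal_density x) (sqrt (2 * pi) * 1)"
    by (intro has_bochner_integral_mult_right)
      (simp add: has_bochner_integral_iff integrable_normal_density integral_normal_density)
  then have "has_bochner_integral lborel (gauss 1) (sqrt (2 * pi))"
    by (simp add: gauss_1_eq[abs_def])
  from lborel_has_bochner_integral_real_affine_iff[of "1/a" "gauss 1" _ 0, THEN iffD1, OF _ this] assms
  have "has_bochner_integral lborel (\<lambda>x. gauss 1 (x / a)) (sqrt (2 * pi) /\<^sub>R (1 / a))" by simp
  then show ?thesis using assms by (simp add: gauss_def[abs_def] mult.commute)
qed

lemma integrable_gauss: "0 < a \<Longrightarrow> integrable lborel (gauss a)"
  using has_bochner_integral_gauss has_bochner_integral_iff by blast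

lemma nn_integral_gauss:
  "0 < a \<Longrightarrow> (\<integral>\<^sup>+x. ennreal (gauss a x) \<partial>lborel) = ennreal (a * sqrt (2 * pi))"
  using has_bochner_integral_gauss[of a]
  by (subst nn_integral_eq_integral) (auto simp: has_bochner_integral_iff gauss_pos less_imp_le)

lemma nn_integral_gauss_shift:
  "(\<integral>\<^sup>+w. ennreal (gauss 1 (T - w)) \<partial>lborel) = ennreal (sqrt (2 * pi))"
proof -
  have "(\<integral>\<^sup>+w. ennreal (gauss 1 w) \<partial>lborel) = ennreal \<bar>- 1\<bar> * (\<integral>\<^sup>+w. ennreal (gauss 1 (T + (- 1) * w)) \<partial>lborel)"
    by (rule nn_integral_real_affine) auto
  then show ?thesis using nn_integral_gauss[of 1] by simp
qed

lemma gauss_minus: "gauss a (- x) = gauss a x"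
  by (simp add: gauss_def)

text \<open>The mass carries the factor 1/A that cancels the factor A in the transform of a Gaussian
  of width A.\<close>

lemma nn_integral_gauss_dilated:
  assumes A: "0 < A"
  shows "(\<integral>\<^sup>+s. ennreal (gauss 1 (A * (s - \<mu>))) \<partial>lborel) = ennreal (1 / A * sqrt (2 * pi))"
proof -
  have "(\<integral>\<^sup>+s. ennreal (gauss 1 (A * (s - \<mu>))) \<partial>lborel) =
    ennreal \<bar>1 / A\<bar> * (\<integral>\<^sup>+s. ennreal (gauss 1 (A * ((\<mu> + 1 / A * s) - \<mu>))) \<partial>lborel)"
    by (rule nn_integral_real_affine) (use A in auto)
  also have "(\<integral>\<^sup>+s. ennreal (gauss 1 (A * ((\<mu> + 1 / A * s) - \<mu>))) \<partial>lborel) = ennreal (1 * sqrt (2 * pi))"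
    using A nn_integral_gauss[of 1] by simp
  finally show ?thesis using A by (simp add: ennreal_mult[symmetric])
qed

text \<open>After scaling by \<open>a\<close> this is the characteristic function of the standard
  normal law. The transform is positive, so taking absolute values in the Schur test loses nothing
  in the Gaussian factors.\<close>

lemma gauss_fourier:
  assumes "0 < a"
  shows "(\<integral>x. of_real (gauss a x) * exp (\<i> * of_real (x * c)) \<partial>lborel)
    = complex_of_real (a * sqrt (2 * pi) * gauss 1 (a * c))"
proof -
  have "(\<integral>x. of_real (gauss a x) * exp (\<i> * of_real (x * c)) \<partial>lborel)
    = a *\<^sub>R (\<integral>x. of_real (gauss a (a * x)) * exp (\<i> * of_real (a * x * c)) \<partial>lborel)"
    using assms lborel_integral_real_affine[of a "\<lambda>x. of_real (gauss a x) * exp (\<i> * of_real (x * c))" 0] by simp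
  also have "(\<lambda>x. of_real (gauss a (a * x)) * exp (\<i> * of_real (a * x * c))) = 
     (\<lambda>x. complex_of_real (sqrt (2 * pi)) * (std_normal_density x *\<^sub>R iexp (a * c * x)))"
    using assms by (auto simp: fun_eq_iff gauss_def std_normal_density_def scaleR_conv_of_real ac_simps)
  also have "(\<integral>x. complex_of_real (sqrt (2 * pi)) * (std_normal_density x *\<^sub>R iexp (a * c * x)) \<partial>lborel) = 
     sqrt (2 * pi) * char std_normal_distribution (a * c)"
    unfolding char_def by (subst integral_density) (auto simp flip: integral_mult_right_zero)
  also have "char std_normal_distribution (a * c) = of_real (gauss 1 (a * c))"
    unfolding char_std_normal_distribution by (simp add: gauss_def)
  finally show ?thesis by (simp add: scaleR_conv_of_real)
qed

subsection \<open>A Schur test\<close>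

lemma cnj_measurable [measurable]: "cnj \<in> borel_measurable borel"
  by (intro borel_measurable_continuous_onI continuous_intros)

text \<open>For nonintegrable \<open>f\<close> the left side is 0 by the default value of the
  Bochner integral.\<close>

lemma norm_integral_le_nn_integral:
  fixes f :: "'a \<Rightarrow> 'b::{banach, second_countable_topology}"
  shows "ennreal (norm (integral\<^sup>L M f)) \<le> (\<integral>\<^sup>+x. ennreal (norm (f x)) \<partial>M)"
  by (cases "integrable M f") (auto simp: integral_norm_bound_ennreal not_integrable_integral_eq)

text \<open>Writing out both factors of the squared modulus and exchanging integrals gives a form in
  \<open>h\<close> whose kernel is the weighted correlation of e(., x) and e(., x'). The
  arithmetic-geometric inequality and the symmetry of \<open>\<kappa>\<close> bound the form by row
  integrals. The rows run over the support of \<open>h\<close> only; through this restriction the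
  geometry of the frequencies enters. Space-time plays the role of \<open>Z\<close> in the main
  bound, frequency in the Plancherel bound.\<close>

lemma TTstar_bound:
  fixes e :: "'z \<Rightarrow> 'a \<Rightarrow> complex" and h :: "'a \<Rightarrow> complex" and W :: "'z \<Rightarrow> real" 
    and \<kappa> :: "'a \<Rightarrow> 'a \<Rightarrow> ennreal" and B :: ennreal
  assumes "sigma_finite_measure N" "sigma_finite_measure Z"
    and [measurable]: "(\<lambda>(z, x). e z x) \<in> borel_measurable (Z \<Otimes>\<^sub>M N)"
    and e1: "\<And>z x. cmod (e z x) = 1"
    and W: "integrable Z W" "\<And>z. 0 \<le> W z"
    and h: "integrable N h"
    and [measurable]: "(\<lambda>(x, x'). \<kappa> x x') \<in> borel_measurable (N \<Otimes>\<^sub>M N)"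
    and ker: "\<And>x x'. x \<in> space N \<Longrightarrow> x' \<in> space N \<Longrightarrow> 
       ennreal (cmod (\<integral>z. of_real (W z) * e z x * cnj (e z x') \<partial>Z)) \<le> \<kappa> x x'"
    and sym: "\<And>x x'. x \<in> space N \<Longrightarrow> x' \<in> space N \<Longrightarrow> \<kappa> x x' = \<kappa> x' x"
    and B: "\<And>x. x \<in> space N \<Longrightarrow> h x \<noteq> 0 \<Longrightarrow> (\<integral>\<^sup>+x'. \<kappa> x x' * of_bool (h x' \<noteq> 0) \<partial>N) \<le> B"
  shows "(\<integral>\<^sup>+z. ennreal (W z * (cmod (\<integral>x. e z x * h x \<partial>N))\<^sup>2) \<partial>Z) \<le> B * (\<integral>\<^sup>+x. ennreal ((cmod (h x))\<^sup>2) \<partial>N)"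
proof -
  interpret N: sigma_finite_measure N by fact
  interpret Z: sigma_finite_measure Z by fact
  interpret ZN: pair_sigma_finite Z N ..
  interpret NN: pair_sigma_finite N N ..
  note [measurable] = borel_measurable_integrable[OF W(1)] borel_measurable_integrable[OF h]
  define G where "G z = (\<integral>x. e z x * h x \<partial>N)" for z
  define k where "k x x' = (\<integral>z. of_real (W z) * e z x * cnj (e z x') \<partial>Z)" for x x'
  have Gm [measurable]: "G \<in> borel_measurable Z" unfolding G_def by measurable
  have em: "e z \<in> borel_measurable N" if "z \<in> space Z" for z
    using that by measurable
  have em': "(\<lambda>z. e z x) \<in> borel_measurable Z" if "x \<in> space N" for x
    using that by measurable
  \<comment> \<open>The L1 norm of \<open>h\<close> bounds the inner integral uniformly in z.
    Together with the integrability of the weight this makes every exchange of integrals absolutely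
    convergent.\<close>
  define H where "H = (\<integral>x. cmod (h x) \<partial>N)"
  have H0: "0 \<le> H" by (simp add: H_def)
  have GH: "cmod (G z) \<le> H" if "z \<in> space Z" for z
  proof -
    have "cmod (G z) \<le> (\<integral>x. cmod (e z x * h x) \<partial>N)" unfolding G_def by (rule integral_norm_bound)
    then show ?thesis by (simp add: norm_mult e1 H_def)
  qed
  have ints: "integrable (Z \<Otimes>\<^sub>M N) (\<lambda>(z, x). of_real (W z) * E z x * h x)"
    if [measurable]: "(\<lambda>(z,x). E z x) \<in> borel_measurable (Z \<Otimes>\<^sub>M N)" 
      and E: "\<And>z x. z \<in> space Z \<Longrightarrow> cmod (E z x) \<le> c" and c: "0 \<le> c" for E c
  proof (rule Bochner_Integration.integrable_bound)
    show "integrable (Z \<Otimes>\<^sub>M N) (\<lambda>(z, x). (c * W z) * cmod (h x))"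
    proof (rule integrableI_bounded)
      have "(\<integral>\<^sup>+y. ennreal (norm (case y of (z, x) \<Rightarrow> (c * W z) * cmod (h x))) \<partial>(Z \<Otimes>\<^sub>M N)) = 
        (\<integral>\<^sup>+y. (case y of (z, x) \<Rightarrow> ennreal (c * W z) * ennreal (cmod (h x))) \<partial>(Z \<Otimes>\<^sub>M N))"
        using W(2) c by (intro nn_integral_cong) (auto simp: abs_mult ennreal_mult)
      also have "\<dots> = (\<integral>\<^sup>+z. ennreal (c * W z) * (\<integral>\<^sup>+x. ennreal (cmod (h x)) \<partial>N) \<partial>Z)"
        by (subst N.nn_integral_fst[symmetric]) (auto simp: nn_integral_cmult)
      also have "\<dots> = (\<integral>\<^sup>+z. ennreal (c * W z) \<partial>Z) * (\<integral>\<^sup>+x. ennreal (cmod (h x)) \<partial>N)"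
        by (subst nn_integral_multc) auto
      also have "\<dots> < \<infinity>" using h W c
        by (auto simp: integrable_iff_bounded ennreal_mult_less_top nn_integral_cmult ennreal_mult)
      finally show "(\<integral>\<^sup>+y. ennreal (norm (case y of (z, x) \<Rightarrow> (c * W z) * cmod (h x))) \<partial>(Z \<Otimes>\<^sub>M N)) < \<infinity>" .
    qed auto
    show "AE y in Z \<Otimes>\<^sub>M N. norm (case y of (z, x) \<Rightarrow> of_real (W z) * E z x * h x)
       \<le> norm (case y of (z, x) \<Rightarrow> (c * W z) * cmod (h x))"
    proof (rule AE_I2)
      fix y assume "y \<in> space (Z \<Otimes>\<^sub>M N)"
      then show "norm (case y of (z, x) \<Rightarrow> of_real (W z) * E z x * h x)
        \<le> norm (case y of (z, x) \<Rightarrow> (c * W z) * cmod (h x))"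
        using E W(2) c by (auto simp: space_pair_measure norm_mult abs_mult intro!: mult_right_mono)
          (metis mult.commute mult_left_mono)
    qed
  qed auto
  have step2: "(\<integral>z. of_real (W z) * e z x * cnj (G z) \<partial>Z) = (\<integral>x'. k x x' * cnj (h x') \<partial>N)" if x: "x \<in> space N" for x
  proof -
    have [measurable]: "(\<lambda>z. e z x) \<in> borel_measurable Z" using em'[OF x] .
    have I: "integrable (Z \<Otimes>\<^sub>M N) (\<lambda>(z, x'). of_real (W z) * (e z x * cnj (e z x')) * cnj (h x'))"
    proof -
      have "integrable (Z \<Otimes>\<^sub>M N) (\<lambda>(z, x'). of_real (W z) * (cnj (e z x) * (e z x')) * (h x'))"
      proof (rule ints[where c=1])
        have "(\<lambda>y. cnj (e (fst y) x) * (case y of (z, x') \<Rightarrow> e z x')) \<in> borel_measurable (Z \<Otimes>\<^sub>M N)"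
          using measurable_compose[OF measurable_fst em'[OF x], of N] by measurable
        then show "(\<lambda>(z, x'). cnj (e z x) * e z x') \<in> borel_measurable (Z \<Otimes>\<^sub>M N)" by (simp add: case_prod_unfold)
      qed (auto simp: norm_mult e1)
      then have "integrable (Z \<Otimes>\<^sub>M N) (\<lambda>y. cnj (case y of (z, x') \<Rightarrow> of_real (W z) * (cnj (e z x) * (e z x')) * (h x')))"
        by (rule integrable_cnj)
      then show ?thesis by (simp add: case_prod_unfold)
    qed
    have "(\<integral>z. of_real (W z) * e z x * cnj (G z) \<partial>Z) = 
      (\<integral>z. \<integral>x'. of_real (W z) * (e z x * cnj (e z x')) * cnj (h x') \<partial>N \<partial>Z)"
    proof (intro Bochner_Integration.integral_cong refl)
      fix z
      have "cnj (G z) = (\<integral>x'. cnj (e z x') * cnj (h x') \<partial>N)"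
        unfolding G_def by (subst Bochner_Integration.integral_cnj[symmetric]) simp
      then have "of_real (W z) * e z x * cnj (G z) = (\<integral>x'. (of_real (W z) * e z x) * (cnj (e z x') * cnj (h x')) \<partial>N)"
        by simp
      then show "of_real (W z) * e z x * cnj (G z) = (\<integral>x'. of_real (W z) * (e z x * cnj (e z x')) * cnj (h x') \<partial>N)"
        by (simp add: mult.assoc)
    qed
    also have "\<dots> = (\<integral>x'. \<integral>z. of_real (W z) * (e z x * cnj (e z x')) * cnj (h x') \<partial>Z \<partial>N)"
      using ZN.Fubini_integral[OF I] by simp
    also have "\<dots> = (\<integral>x'. k x x' * cnj (h x') \<partial>N)"
      by (simp add: k_def mult.assoc[symmetric])
    finally show ?thesis .
  qed
  have I1: "integrable (Z \<Otimes>\<^sub>M N) (\<lambda>(z, x). of_real (W z) * (e z x * cnj (G z)) * h x)"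
    using GH H0 by (intro ints[where c=H]) (auto simp: norm_mult e1)
  have WG: "integrable Z (\<lambda>z. W z * (cmod (G z))\<^sup>2)"
  proof (rule Bochner_Integration.integrable_bound)
    show "integrable Z (\<lambda>z. W z * H\<^sup>2)" using W by auto
    show "AE z in Z. norm (W z * (cmod (G z))\<^sup>2) \<le> norm (W z * H\<^sup>2)"
      using GH W(2) by (auto simp: abs_mult intro!: AE_I2 mult_left_mono power_mono)
  qed auto
  have "complex_of_real (\<integral>z. W z * (cmod (G z))\<^sup>2 \<partial>Z) = (\<integral>z. of_real (W z * (cmod (G z))\<^sup>2) \<partial>Z)"
    by (rule integral_complex_of_real[symmetric])
  also have "\<dots> = (\<integral>z. \<integral>x. of_real (W z) * (e z x * cnj (G z)) * h x \<partial>N \<partial>Z)"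
  proof (intro Bochner_Integration.integral_cong refl)
    fix z
    have "complex_of_real (W z * (cmod (G z))\<^sup>2) = of_real (W z) * cnj (G z) * G z"
      by (simp add: complex_norm_square[symmetric] mult.assoc mult.commute[of "cnj (G z)"])
    also have "\<dots> = (\<integral>x. (of_real (W z) * cnj (G z)) * (e z x * h x) \<partial>N)"
      by (subst (2) G_def) simp
    finally show "complex_of_real (W z * (cmod (G z))\<^sup>2) = (\<integral>x. of_real (W z) * (e z x * cnj (G z)) * h x \<partial>N)"
      by (simp add: ac_simps)
  qed
  also have "\<dots> = (\<integral>x. \<integral>z. of_real (W z) * (e z x * cnj (G z)) * h x \<partial>Z \<partial>N)"
    using ZN.Fubini_integral[OF I1] by simp
  also have "\<dots> = (\<integral>x. h x * (\<integral>x'. k x x' * cnj (h x') \<partial>N) \<partial>N)"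
    by (intro Bochner_Integration.integral_cong refl)
      (simp add: step2[symmetric] mult.assoc[symmetric] mult.commute[of "h _"])
  finally have eq: "complex_of_real (\<integral>z. W z * (cmod (G z))\<^sup>2 \<partial>Z) = (\<integral>x. h x * (\<integral>x'. k x x' * cnj (h x') \<partial>N) \<partial>N)" .
  \<comment> \<open>\<open>b\<close> carries the support through the symmetrization: each half keeps
    the indicators of both points, so the row integral left after pulling out the square still runs
    over the support of \<open>h\<close>.\<close>
  define b :: "'a \<Rightarrow> ennreal" where "b = (\<lambda>x. of_bool (h x \<noteq> 0))"
  have [measurable]: "b \<in> borel_measurable N" unfolding b_def by measurable
  have "(\<integral>\<^sup>+z. ennreal (W z * (cmod (G z))\<^sup>2) \<partial>Z) = ennreal (\<integral>z. W z * (cmod (G z))\<^sup>2 \<partial>Z)"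
    using W(2) by (intro nn_integral_eq_integral WG) auto
  also have "\<dots> = ennreal (cmod (\<integral>x. h x * (\<integral>x'. k x x' * cnj (h x') \<partial>N) \<partial>N))"
    unfolding eq[symmetric] using W(2) by (subst norm_of_real) (simp add: integral_nonneg_AE)
  also have "\<dots> \<le> (\<integral>\<^sup>+x. ennreal (cmod (h x * (\<integral>x'. k x x' * cnj (h x') \<partial>N))) \<partial>N)"
    by (rule norm_integral_le_nn_integral)
  also have "\<dots> \<le> (\<integral>\<^sup>+x. \<integral>\<^sup>+x'. ennreal (cmod (h x)) * ennreal (cmod (h x')) * \<kappa> x x' \<partial>N \<partial>N)"
  proof (rule nn_integral_mono)
    fix x assume x: "x \<in> space N"
    have "ennreal (cmod (\<integral>x'. k x x' * cnj (h x') \<partial>N)) \<le> (\<integral>\<^sup>+x'. ennreal (cmod (k x x' * cnj (h x'))) \<partial>N)"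
      by (rule norm_integral_le_nn_integral)
    also have "\<dots> \<le> (\<integral>\<^sup>+x'. \<kappa> x x' * ennreal (cmod (h x')) \<partial>N)"
      using ker[OF x] by (intro nn_integral_mono) (simp add: norm_mult ennreal_mult k_def mult_right_mono)
    finally have "ennreal (cmod (h x)) * ennreal (cmod (\<integral>x'. k x x' * cnj (h x') \<partial>N)) \<le> 
       ennreal (cmod (h x)) * (\<integral>\<^sup>+x'. \<kappa> x x' * ennreal (cmod (h x')) \<partial>N)" by (intro mult_left_mono) auto
    also have "\<dots> = (\<integral>\<^sup>+x'. ennreal (cmod (h x)) * (\<kappa> x x' * ennreal (cmod (h x'))) \<partial>N)"
      using x by (subst nn_integral_cmult) auto
    finally show "ennreal (cmod (h x * (\<integral>x'. k x x' * cnj (h x') \<partial>N))) \<le> 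
       (\<integral>\<^sup>+x'. ennreal (cmod (h x)) * ennreal (cmod (h x')) * \<kappa> x x' \<partial>N)"
      by (simp add: norm_mult ennreal_mult ac_simps)
  qed
  also have "\<dots> \<le> (\<integral>\<^sup>+x. \<integral>\<^sup>+x'. ennreal (1/2) * (ennreal ((cmod (h x))\<^sup>2) * b x * (\<kappa> x x' * b x')) 
      + ennreal (1/2) * (ennreal ((cmod (h x'))\<^sup>2) * b x' * (\<kappa> x' x * b x)) \<partial>N \<partial>N)"
  proof (intro nn_integral_mono)
    fix x x' assume x: "x \<in> space N" "x' \<in> space N"
    have "0 \<le> (cmod (h x) - cmod (h x'))\<^sup>2" by simp
    then have "cmod (h x) * cmod (h x') \<le> 1/2 * (cmod (h x))\<^sup>2 + 1/2 * (cmod (h x'))\<^sup>2"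
      by (simp add: power2_eq_square algebra_simps)
    then have *: "ennreal (cmod (h x)) * ennreal (cmod (h x')) \<le> ennreal (1/2) * ennreal ((cmod (h x))\<^sup>2) + ennreal (1/2) * ennreal ((cmod (h x'))\<^sup>2)"
      by (subst (1 2 3) ennreal_mult[symmetric]; simp del: ennreal_plus add: ennreal_plus[symmetric] ennreal_leI)
    show "ennreal (cmod (h x)) * ennreal (cmod (h x')) * \<kappa> x x' \<le> 
      ennreal (1/2) * (ennreal ((cmod (h x))\<^sup>2) * b x * (\<kappa> x x' * b x')) 
      + ennreal (1/2) * (ennreal ((cmod (h x'))\<^sup>2) * b x' * (\<kappa> x' x * b x))"
      using mult_right_mono[OF *, of "\<kappa> x x'"] sym[OF x]
      by (cases "h x = 0"; cases "h x' = 0") (simp_all add: b_def distrib_right distrib_left ac_simps)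
  qed
  also have "\<dots> = ennreal (1/2) * (\<integral>\<^sup>+x. \<integral>\<^sup>+x'. (ennreal ((cmod (h x))\<^sup>2) * b x * (\<kappa> x x' * b x')) \<partial>N \<partial>N) 
      + ennreal (1/2) * (\<integral>\<^sup>+x. \<integral>\<^sup>+x'. (ennreal ((cmod (h x'))\<^sup>2) * b x' * (\<kappa> x' x * b x)) \<partial>N \<partial>N)"
  proof -
    have "(\<integral>\<^sup>+x. \<integral>\<^sup>+x'. ennreal (1/2) * (ennreal ((cmod (h x))\<^sup>2) * b x * (\<kappa> x x' * b x')) 
      + ennreal (1/2) * (ennreal ((cmod (h x'))\<^sup>2) * b x' * (\<kappa> x' x * b x)) \<partial>N \<partial>N) = 
      (\<integral>\<^sup>+x. ennreal (1/2) * (\<integral>\<^sup>+x'. (ennreal ((cmod (h x))\<^sup>2) * b x * (\<kappa> x x' * b x')) \<partial>N)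
      + ennreal (1/2) * (\<integral>\<^sup>+x'. (ennreal ((cmod (h x'))\<^sup>2) * b x' * (\<kappa> x' x * b x)) \<partial>N) \<partial>N)"
      by (intro nn_integral_cong) (simp add: nn_integral_add nn_integral_cmult)
    then show ?thesis by (simp add: nn_integral_add nn_integral_cmult)
  qed
  also have "(\<integral>\<^sup>+x. \<integral>\<^sup>+x'. (ennreal ((cmod (h x'))\<^sup>2) * b x' * (\<kappa> x' x * b x)) \<partial>N \<partial>N) = 
    (\<integral>\<^sup>+x'. \<integral>\<^sup>+x. (ennreal ((cmod (h x'))\<^sup>2) * b x' * (\<kappa> x' x * b x)) \<partial>N \<partial>N)"
    by (rule NN.Fubini') measurable
  also have "ennreal (1/2) * X + ennreal (1/2) * X = X" for X
  proof -
    have "ennreal (1/2) + ennreal (1/2) = 1" by (subst ennreal_plus[symmetric]) (auto simp del: ennreal_plus)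
    then show ?thesis by (metis distrib_right mult_1)
  qed
  also have "(\<integral>\<^sup>+x. \<integral>\<^sup>+x'. (ennreal ((cmod (h x))\<^sup>2) * b x * (\<kappa> x x' * b x')) \<partial>N \<partial>N) \<le> (\<integral>\<^sup>+x. ennreal ((cmod (h x))\<^sup>2) * B \<partial>N)"
  proof (rule nn_integral_mono)
    fix x assume x: "x \<in> space N"
    have "(\<integral>\<^sup>+x'. (ennreal ((cmod (h x))\<^sup>2) * b x * (\<kappa> x x' * b x')) \<partial>N) = ennreal ((cmod (h x))\<^sup>2) * b x * (\<integral>\<^sup>+x'. (\<kappa> x x' * b x') \<partial>N)"
      using x by (intro nn_integral_cmult) auto
    also have "\<dots> \<le> ennreal ((cmod (h x))\<^sup>2) * B"
      using B[OF x] by (cases "h x = 0") (auto simp: b_def intro!: mult_left_mono)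
    finally show "(\<integral>\<^sup>+x'. (ennreal ((cmod (h x))\<^sup>2) * b x * (\<kappa> x x' * b x')) \<partial>N) \<le> ennreal ((cmod (h x))\<^sup>2) * B" .
  qed
  also have "(\<integral>\<^sup>+x. ennreal ((cmod (h x))\<^sup>2) * B \<partial>N) = B * (\<integral>\<^sup>+x. ennreal ((cmod (h x))\<^sup>2) \<partial>N)"
    by (subst nn_integral_multc) (auto simp: mult.commute)
  finally show ?thesis unfolding G_def .
qed

subsection \<open>The cylinder and its frequency space\<close>

lemma of_bool_measurable [measurable (raw)]:
  assumes "Measurable.pred M P"
  shows "(\<lambda>x. of_bool (P x) :: 'b :: {topological_space, zero_neq_one}) \<in> borel_measurable M"
  unfolding of_bool_def using assms by measurable

lemma sigma_finite_freq_eta: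
  fixes l :: real
  assumes "0 < l"
  shows "sigma_finite_measure (scale_measure (ennreal (1 / l)) (count_space (range (\<lambda>k::int. of_int k / l))))"
    (is "sigma_finite_measure ?M")
proof
  have e: "emeasure (count_space (range (\<lambda>k::int. of_int k / l))) {of_int a / l :: real} = 1" for a :: int
    by (subst emeasure_count_space_finite) auto
  let ?A = "(\<lambda>k::int. {of_int k / l :: real}) ` UNIV"
  show "\<exists>A. countable A \<and> A \<subseteq> sets ?M \<and> \<Union>A = space ?M \<and> (\<forall>a\<in>A. emeasure ?M a \<noteq> \<infinity>)"
    by (rule exI[of _ ?A]) (auto simp: space_scale_measure ennreal_mult_eq_top_iff e)
qed

lemma sigma_finite_pair_measure:
  assumes "sigma_finite_measure M1" "sigma_finite_measure M2"
  shows "sigma_finite_measure (M1 \<Otimes>\<^sub>M M2)"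
proof -
  interpret pair_sigma_finite M1 M2 using assms by (intro pair_sigma_finite.intro)
  show ?thesis ..
qed

lemma sigma_finite_freq: "0 < l \<Longrightarrow> sigma_finite_measure (freq l)"
  unfolding freq_def
  by (intro sigma_finite_pair_measure sigma_finite_freq_eta sigma_finite_lborel)

lemma sigma_finite_restrict_lborel: "S \<in> sets borel \<Longrightarrow> sigma_finite_measure (restrict_space lborel S :: real measure)"
  by (rule sigma_finite_measure_restrict_space[OF sigma_finite_lborel]) auto

lemma sigma_finite_cyl: "sigma_finite_measure (cyl l)"
  unfolding cyl_def
  by (intro sigma_finite_pair_measure sigma_finite_restrict_lborel sigma_finite_lborel) auto

lemma fst_freq_measurable [measurable]: "fst \<in> borel_measurable (freq l)"
  unfolding freq_def by measurable

lemma snd_freq_measurable [measurable]: "snd \<in> borel_measurable (freq l)"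
proof -
  have "(\<lambda>x. x) \<in> borel_measurable (scale_measure (ennreal (1 / l)) (count_space (range (\<lambda>k::int. of_int k / l))))"
    by (subst measurable_cong_sets[OF sets_scale_measure refl]) simp
  from measurable_compose[OF measurable_snd this, of lborel] show ?thesis
    unfolding freq_def by simp
qed

lemma fst_cyl_measurable [measurable]: "fst \<in> borel_measurable (cyl l)"
  unfolding cyl_def by measurable

lemma snd_cyl_measurable [measurable]: "snd \<in> borel_measurable (cyl l)"
proof -
  have "(\<lambda>x. x) \<in> borel_measurable (restrict_space lborel {0..<2 * pi * l})"
    by (rule measurable_restrict_space1) simp
  from measurable_compose[OF measurable_snd this, of lborel] show ?thesis
    unfolding cyl_def by simp
qed

text \<open>The second factor of \<open>freq\<close> carries the discrete sigma-algebra of the grid,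
  so this concerns the embedding of the grid lines into the Borel plane. Through it Borel functions
  on the plane restrict to measurable ones on frequency space.\<close>

lemma id_freq_measurable [measurable]: "(\<lambda>x. x) \<in> borel_measurable (freq l)"
proof -
  have "(\<lambda>x. (fst x, snd x)) \<in> borel_measurable (freq l)"
    by (subst borel_prod[symmetric]) measurable
  then show ?thesis by simp
qed

lemma id_cyl_measurable [measurable]: "(\<lambda>x. x) \<in> borel_measurable (cyl l)"
proof -
  have "(\<lambda>x. (fst x, snd x)) \<in> borel_measurable (cyl l)"
    by (subst borel_prod[symmetric]) measurable
  then show ?thesis by simp
qed

lemma space_freq: "space (freq l) = UNIV \<times> range (\<lambda>k::int. of_int k / l)"
  by (simp add: freq_def space_pair_measure space_scale_measure)

text \<open>Disintegration over the lines \<eta> = k/l. The scaled counting measure becomes a sum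
  over integers, the form in which lattice points on circles are summed.\<close>

lemma nn_integral_freq:
  assumes l: "0 < l" and [measurable]: "f \<in> borel_measurable (freq l)"
  shows "(\<integral>\<^sup>+\<xi>. f \<xi> \<partial>freq l) = 
    (\<integral>\<^sup>+k. ennreal (1 / l) * (\<integral>\<^sup>+\<mu>. f (\<mu>, of_int k / l) \<partial>lborel) \<partial>count_space (UNIV :: int set))"
proof -
  let ?C = "count_space (range (\<lambda>k::int. of_int k / l))" 
  let ?E = "scale_measure (ennreal (1 / l)) ?C"
  interpret E: sigma_finite_measure ?E by (rule sigma_finite_freq_eta[OF l])
  interpret P: pair_sigma_finite lborel ?E ..
  have f [measurable]: "f \<in> borel_measurable (lborel \<Otimes>\<^sub>M ?E)" using assms(2) unfolding freq_def .
  have "(\<integral>\<^sup>+\<xi>. f \<xi> \<partial>freq l) = (\<integral>\<^sup>+\<eta>. \<integral>\<^sup>+\<mu>. f (\<mu>, \<eta>) \<partial>lborel \<partial>?E)"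
    unfolding freq_def by (rule P.nn_integral_snd[symmetric]) measurable
  also have "\<dots> = ennreal (1 / l) * (\<integral>\<^sup>+\<eta>. \<integral>\<^sup>+\<mu>. f (\<mu>, \<eta>) \<partial>lborel \<partial>?C)"
    by (rule nn_integral_scale_measure) simp
  also have "(\<integral>\<^sup>+\<eta>. \<integral>\<^sup>+\<mu>. f (\<mu>, \<eta>) \<partial>lborel \<partial>?C) = 
     (\<integral>\<^sup>+k. \<integral>\<^sup>+\<mu>. f (\<mu>, of_int k / l) \<partial>lborel \<partial>count_space (UNIV :: int set))"
    by (rule nn_integral_bij_count_space[symmetric]) (use l in \<open>auto simp: bij_betw_def inj_on_def\<close>)
  finally show ?thesis by (simp add: nn_integral_cmult)
qed

lemma nn_integral_cyl:
  assumes [measurable]: "f \<in> borel_measurable (cyl l)"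
  shows "(\<integral>\<^sup>+z. f z \<partial>cyl l) = (\<integral>\<^sup>+x. \<integral>\<^sup>+y. f (x, y) \<partial>restrict_space lborel {0..<2 * pi * l} \<partial>lborel)"
proof -
  interpret R: sigma_finite_measure "restrict_space lborel {0..<2 * pi * l}"
    by (rule sigma_finite_restrict_lborel) auto
  show ?thesis unfolding cyl_def
    by (rule R.nn_integral_fst[symmetric]) (use assms in \<open>simp add: cyl_def\<close>)
qed

text \<open>The kernels of both Schur tests are products of integrals in separate variables; they
  are factored here.\<close>

lemma integral_product_pair:
  fixes f :: "'a \<Rightarrow> complex" and g :: "'b \<Rightarrow> complex"
  assumes "sigma_finite_measure M1" "sigma_finite_measure M2" and f: "integrable M1 f" and g: "integrable M2 g"
  shows "integrable (M1 \<Otimes>\<^sub>M M2) (\<lambda>z. f (fst z) * g (snd z))"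
    and "(\<integral>z. f (fst z) * g (snd z) \<partial>(M1 \<Otimes>\<^sub>M M2)) = (\<integral>x. f x \<partial>M1) * (\<integral>y. g y \<partial>M2)"
proof -
  interpret M1: sigma_finite_measure M1 by fact
  interpret M2: sigma_finite_measure M2 by fact
  interpret P: pair_sigma_finite M1 M2 ..
  note [measurable] = borel_measurable_integrable[OF f] borel_measurable_integrable[OF g]
  show I: "integrable (M1 \<Otimes>\<^sub>M M2) (\<lambda>z. f (fst z) * g (snd z))"
  proof (rule integrableI_bounded)
    have "(\<integral>\<^sup>+z. ennreal (norm (f (fst z) * g (snd z))) \<partial>(M1 \<Otimes>\<^sub>M M2)) = (\<integral>\<^sup>+x. \<integral>\<^sup>+y. ennreal (norm (f x)) * ennreal (norm (g y)) \<partial>M2 \<partial>M1)"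
      by (subst M2.nn_integral_fst[symmetric]) (auto simp: norm_mult ennreal_mult)
    also have "\<dots> = (\<integral>\<^sup>+x. ennreal (norm (f x)) \<partial>M1) * (\<integral>\<^sup>+y. ennreal (norm (g y)) \<partial>M2)"
      by (simp add: nn_integral_cmult nn_integral_multc)
    also have "\<dots> < \<infinity>" using f g by (auto simp: integrable_iff_bounded ennreal_mult_less_top)
    finally show "(\<integral>\<^sup>+z. ennreal (norm (f (fst z) * g (snd z))) \<partial>(M1 \<Otimes>\<^sub>M M2)) < \<infinity>" .
  qed measurable
  show "(\<integral>z. f (fst z) * g (snd z) \<partial>(M1 \<Otimes>\<^sub>M M2)) = (\<integral>x. f x \<partial>M1) * (\<integral>y. g y \<partial>M2)"
    by (subst P.integral_fst'[symmetric, OF I]) simp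
qed

section \<open>Square-integrable functions with bounded frequency support\<close>

lemma ennreal_norm_le_1_plus_sq:
  fixes z :: "'a :: real_normed_vector"
  shows "ennreal (norm z) \<le> 1 + ennreal ((norm z)\<^sup>2)"
proof -
  have "0 \<le> (norm z - 1/2)\<^sup>2" by simp
  then have "norm z \<le> 1 + (norm z)\<^sup>2" unfolding power2_eq_square by (simp add: algebra_simps)
  then show ?thesis by (metis ennreal_1 ennreal_leI ennreal_plus zero_le_one zero_le_power2)
qed

text \<open>The ball is enlarged to a square, over which the integral factors; the square meets
  finitely many grid lines.\<close>

lemma nn_integral_freq_ball_finite:
  assumes l: "0 < l"
  shows "(\<integral>\<^sup>+\<xi>. of_bool (norm \<xi> \<le> r) \<partial>freq l) < \<infinity>"
proof -
  have "(\<integral>\<^sup>+\<xi>. of_bool (norm \<xi> \<le> r) \<partial>freq l) \<le> (\<integral>\<^sup>+\<xi>. of_bool (\<bar>fst \<xi>\<bar> \<le> r) * of_bool (\<bar>snd \<xi>\<bar> \<le> r) \<partial>freq l)"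
  proof (rule nn_integral_mono)
    fix \<xi> :: "real \<times> real"
    have "\<bar>fst \<xi>\<bar> \<le> norm \<xi>" "\<bar>snd \<xi>\<bar> \<le> norm \<xi>"
      using norm_fst_le[of "fst \<xi>" "snd \<xi>"] norm_snd_le[of "snd \<xi>" "fst \<xi>"] by simp_all
    then show "(of_bool (norm \<xi> \<le> r) :: ennreal) \<le> of_bool (\<bar>fst \<xi>\<bar> \<le> r) * of_bool (\<bar>snd \<xi>\<bar> \<le> r)"
      by (cases "norm \<xi> \<le> r") auto
  qed
  also have "\<dots> = (\<integral>\<^sup>+k. ennreal (1 / l) * (\<integral>\<^sup>+\<mu>. of_bool (\<bar>\<mu>\<bar> \<le> r) * of_bool (\<bar>real_of_int k / l\<bar> \<le> r) \<partial>lborel) \<partial>count_space UNIV)"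
    by (subst nn_integral_freq[OF l]) auto
  also have "\<dots> = (\<integral>\<^sup>+k. ennreal (1 / l) * ((\<integral>\<^sup>+\<mu>. of_bool (\<bar>\<mu>\<bar> \<le> r) \<partial>lborel) * of_bool (\<bar>real_of_int k / l\<bar> \<le> r)) \<partial>count_space UNIV)"
    by (simp add: nn_integral_multc)
  also have "(\<integral>\<^sup>+\<mu>. of_bool (\<bar>\<mu>\<bar> \<le> r) \<partial>lborel) = (\<integral>\<^sup>+\<mu>. indicator {-r..r} \<mu> \<partial>lborel)"
    by (intro nn_integral_cong) (auto simp: indicator_def)
  also have "\<dots> = ennreal (r - - r)" by (cases "-r \<le> r") (auto simp: ennreal_neg)
  also have "(\<integral>\<^sup>+k. ennreal (1 / l) * (ennreal (r - - r) * of_bool (\<bar>real_of_int k / l\<bar> \<le> r)) \<partial>count_space UNIV)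
     = (\<Sum>k\<in>{-\<lceil>r * l\<rceil>..\<lceil>r * l\<rceil>}. ennreal (1 / l) * (ennreal (r - - r) * of_bool (\<bar>real_of_int k / l\<bar> \<le> r)))"
  proof (rule nn_integral_count_space')
    fix k :: int assume k: "k \<notin> {-\<lceil>r * l\<rceil>..\<lceil>r * l\<rceil>}"
    have "\<not> \<bar>real_of_int k / l\<bar> \<le> r"
    proof
      assume "\<bar>real_of_int k / l\<bar> \<le> r"
      then have "\<bar>real_of_int k\<bar> \<le> r * l" using l by (simp add: field_simps)
      then have "real_of_int k \<le> of_int \<lceil>r * l\<rceil>" "- real_of_int k \<le> of_int \<lceil>r * l\<rceil>" by linarith+
      with k show False by (auto simp flip: of_int_minus)
    qed
    then show "ennreal (1 / l) * (ennreal (r - - r) * of_bool (\<bar>real_of_int k / l\<bar> \<le> r)) = 0" by simp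
  qed auto
  also have "\<dots> < \<infinity>" by (auto simp: ennreal_mult_less_top of_bool_def)
  finally show ?thesis .
qed

text \<open>This makes the integral in \<open>bilin\<close> absolutely convergent: on a set of
  finite measure |z| <= 1 + |z|^2 turns square-integrability into integrability.\<close>

lemma integrable_freq_bounded_support:
  assumes l: "0 < l" and g: "in_L2 (freq l) g" and supp: "\<And>\<xi>. g \<xi> \<noteq> 0 \<Longrightarrow> norm \<xi> \<le> r"
  shows "integrable (freq l) g"
proof (rule integrableI_bounded)
  show [measurable]: "g \<in> borel_measurable (freq l)" using g by (simp add: in_L2_def)
  have "(\<integral>\<^sup>+\<xi>. ennreal (norm (g \<xi>)) \<partial>freq l) \<le> (\<integral>\<^sup>+\<xi>. of_bool (norm \<xi> \<le> r) + ennreal ((cmod (g \<xi>))\<^sup>2) \<partial>freq l)"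
  proof (rule nn_integral_mono)
    fix \<xi>
    show "ennreal (norm (g \<xi>)) \<le> of_bool (norm \<xi> \<le> r) + ennreal ((cmod (g \<xi>))\<^sup>2)"
      using supp[of \<xi>] ennreal_norm_le_1_plus_sq[of "g \<xi>"] by (cases "g \<xi> = 0") auto
  qed
  also have "\<dots> = (\<integral>\<^sup>+\<xi>. of_bool (norm \<xi> \<le> r) \<partial>freq l) + (\<integral>\<^sup>+\<xi>. ennreal ((cmod (g \<xi>))\<^sup>2) \<partial>freq l)"
    by (rule nn_integral_add) auto
  also have "\<dots> < \<infinity>" using nn_integral_freq_ball_finite[OF l, of r] g by (auto simp: in_L2_def integrable_iff_bounded)
  finally show "(\<integral>\<^sup>+\<xi>. ennreal (norm (g \<xi>)) \<partial>freq l) < \<infinity>" .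
qed

subsection \<open>Lattice points on a circle\<close>

lemma sum_telescope_int:
  fixes f :: "int \<Rightarrow> real"
  assumes "a \<le> b"
  shows "(\<Sum>k\<in>{a..<b}. f k - f (k + 1)) = f a - f b"
  using assms
proof (induction b rule: int_ge_induct)
  case (step i)
  have "{a..<i + 1} = insert i {a..<i}" using step by auto
  then show ?case using step by simp
qed simp

text \<open>On the arc above height \<open>\<rho> / 2\<close> one lattice step changes the other coordinate by at least
  \<open>\<rho> / (2 l u)\<close>, so the sum telescopes.\<close>

lemma circle_sum_right:
  fixes T :: "int set" and l \<rho> m D c :: real
  defines "v \<equiv> \<lambda>k::int. of_int k / l - c"
  defines "u \<equiv> \<lambda>k. sqrt (\<rho>\<^sup>2 - (v k)\<^sup>2)"
  assumes "finite T" and l: "0 < l" and m: "0 < m" and r: "0 < \<rho>" and D: "0 \<le> D"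
    and T: "\<And>k. k \<in> T \<Longrightarrow> \<rho> / 2 \<le> v k \<and> m\<^sup>2 + (v k)\<^sup>2 \<le> \<rho>\<^sup>2"
    and uD: "\<And>k k'. k \<in> T \<Longrightarrow> k' \<in> T \<Longrightarrow> \<bar>u k - u k'\<bar> \<le> D"
  shows "(\<Sum>k\<in>T. 1 / (l * u k)) \<le> 2 * D / \<rho> + 1 / (l * m)"
proof (cases "T = {}")
  case False
  define a where "a = Min T"
  define b where "b = Max T"
  have ab: "a \<in> T" "b \<in> T" "a \<le> b" and Tab: "T \<subseteq> {a..b}"
    using False assms(3) by (auto simp: a_def b_def)
  \<comment> \<open>Monotonicity of \<open>v\<close> puts every integer between the extreme elements
    of \<open>T\<close> on the same arc, so gaps in \<open>T\<close> can be filled and the sum runs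
    over an interval.\<close>
  have vr: "\<rho> / 2 \<le> v k" "v k \<le> v b" if "a \<le> k" "k \<le> b" for k
  proof -
    have "v a \<le> v k" "v k \<le> v b" using that l by (auto simp: v_def divide_right_mono)
    with T[OF ab(1)] show "\<rho> / 2 \<le> v k" "v k \<le> v b" by auto
  qed
  have um: "m \<le> u k" if "a \<le> k" "k \<le> b" for k
  proof -
    have "(v k)\<^sup>2 \<le> (v b)\<^sup>2" using vr[OF that] r by (intro power_mono) auto
    with T[OF ab(2)] have "m\<^sup>2 \<le> \<rho>\<^sup>2 - (v k)\<^sup>2" by linarith
    with m show ?thesis unfolding u_def by (intro real_le_rsqrt)
  qed
  have u2: "(u k)\<^sup>2 = \<rho>\<^sup>2 - (v k)\<^sup>2" if "a \<le> k" "k \<le> b" for k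
    using um[OF that] m unfolding u_def by (smt (verit) real_sqrt_pow2 real_sqrt_lt_0_iff)
  have step: "1 / (l * u k) \<le> 2 / \<rho> * (u k - u (k + 1))" if "k \<in> {a..<b}" for k
  proof -
    have k: "a \<le> k" "k \<le> b" "a \<le> k + 1" "k + 1 \<le> b" using that by auto
    have vv: "v (k + 1) = v k + 1 / l" by (simp add: v_def add_divide_distrib)
    have "(u k - u (k + 1)) * (u k + u (k + 1)) = (v (k+1))\<^sup>2 - (v k)\<^sup>2"
      using u2[OF k(1,2)] u2[OF k(3,4)] by (simp add: algebra_simps power2_eq_square)
    also have "\<dots> = (1 / l) * (v k + v (k + 1))" unfolding vv by (simp add: algebra_simps power2_eq_square)
    also have "\<dots> \<ge> (1 / l) * \<rho>" using vr[OF k(1,2)] vr[OF k(3,4)] l by (intro mult_left_mono) auto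
    finally have 1: "\<rho> / l \<le> (u k - u (k + 1)) * (u k + u (k + 1))" by simp
    have pos: "0 < u k" "0 < u (k + 1)" using um[OF k(1,2)] um[OF k(3,4)] m by auto
    have "0 < \<rho> / l" using r l by simp
    with 1 have "0 < (u k - u (k + 1)) * (u k + u (k + 1))" by linarith
    with pos have d: "0 < u k - u (k + 1)" by (simp add: zero_less_mult_iff)
    then have "(u k - u (k + 1)) * (u k + u (k + 1)) \<le> (u k - u (k + 1)) * (2 * u k)"
      by (intro mult_left_mono) auto
    with 1 have "\<rho> / l \<le> (u k - u (k + 1)) * (2 * u k)" by linarith
    then show ?thesis using pos l r by (simp add: field_simps)
  qed
  have pos: "0 \<le> 1 / (l * u k)" if "a \<le> k" "k \<le> b" for k using um[OF that] m l by simp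
  have "(\<Sum>k\<in>T. 1 / (l * u k)) \<le> (\<Sum>k\<in>{a..b}. 1 / (l * u k))"
    using Tab pos by (intro sum_mono2) auto
  \<comment> \<open>The top line \<open>b\<close> is split off: its successor may miss the circle,
    so it has no telescoping partner. It is the source of the boundary term 1 / (l m).\<close>
  also have "{a..b} = insert b {a..<b}" using ab by auto
  also have "(\<Sum>k\<in>insert b {a..<b}. 1 / (l * u k)) = (\<Sum>k\<in>{a..<b}. 1 / (l * u k)) + 1 / (l * u b)" by simp
  also have "\<dots> \<le> (\<Sum>k\<in>{a..<b}. 2 / \<rho> * (u k - u (k + 1))) + 1 / (l * m)"
    using step um[of b] ab l m by (intro add_mono sum_mono divide_left_mono mult_left_mono) auto
  also have "(\<Sum>k\<in>{a..<b}. 2 / \<rho> * (u k - u (k + 1))) = 2 / \<rho> * (u a - u b)"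
    using sum_telescope_int[OF ab(3), of u] by (simp only: sum_distrib_left[symmetric])
  also have "\<dots> \<le> 2 / \<rho> * D" using uD[OF ab(1,2)] r by (intro mult_left_mono) auto
  finally show ?thesis by simp
qed (use D r l m in auto)

text \<open>The extra 1 counts the endpoint. It turns into a boundary term in
  \<open>circle_sum\<close> and into the nineteenth index in \<open>slope_overlap\<close>.\<close>

lemma card_int_diameter_le:
  fixes T :: "int set" and l D :: real
  assumes "finite T" "0 < l" "0 \<le> D" "\<And>k k'. k \<in> T \<Longrightarrow> k' \<in> T \<Longrightarrow> \<bar>of_int k - of_int k'\<bar> \<le> l * D"
  shows "real (card T) \<le> l * D + 1"
proof (cases "T = {}")
  case False
  have "T \<subseteq> {Min T..Max T}" using assms by auto
  then have "card T \<le> card {Min T..Max T}" by (intro card_mono) auto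
  moreover have "\<bar>of_int (Max T) - of_int (Min T)\<bar> \<le> l * D" using False assms by (intro assms(4)) auto
  moreover have "Min T \<le> Max T" using False assms(1) by simp
  moreover have "real (card {Min T..Max T}) = of_int (Max T - Min T + 1)" using calculation(3) by simp
  ultimately show ?thesis by (simp add: abs_if split: if_splits)
qed (use assms in auto)

text \<open>The circle is cut at heights \<rho>/2 and -\<rho>/2. In the middle \<open>u\<close> is
  at least \<rho>/2 and counting lines suffices. On the caps \<open>u\<close> may drop to
  \<open>m\<close>, and the telescoping sum is used, the lower cap being a mirror image of the upper
  one. Each part contributes 2 D / \<rho>; the boundary terms are 2 in the middle and 1 on each
  cap.\<close>

lemma circle_sum:
  fixes T :: "int set" and l \<rho> m D c :: real
  defines "v \<equiv> \<lambda>k::int. of_int k / l - c"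
  defines "u \<equiv> \<lambda>k. sqrt (\<rho>\<^sup>2 - (v k)\<^sup>2)"
  assumes fin: "finite T" and l: "0 < l" and m: "0 < m" and r: "0 < \<rho>" and D: "0 \<le> D"
    and T: "\<And>k. k \<in> T \<Longrightarrow> m\<^sup>2 + (v k)\<^sup>2 \<le> \<rho>\<^sup>2"
    and uD: "\<And>k k'. k \<in> T \<Longrightarrow> k' \<in> T \<Longrightarrow> \<bar>u k - u k'\<bar> \<le> D"
    and vD: "\<And>k k'. k \<in> T \<Longrightarrow> k' \<in> T \<Longrightarrow> \<bar>v k - v k'\<bar> \<le> D"
  shows "(\<Sum>k\<in>T. 1 / (l * u k)) \<le> 6 * D / \<rho> + 4 / (l * m)"
proof -
  define T0 where "T0 = {k\<in>T. \<bar>v k\<bar> < \<rho> / 2}"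
  define T1 where "T1 = {k\<in>T. \<rho> / 2 \<le> v k}"
  define T2 where "T2 = {k\<in>T. v k \<le> - (\<rho> / 2)}"
  have TT: "T = T0 \<union> (T1 \<union> T2)" "T0 \<inter> (T1 \<union> T2) = {}" "T1 \<inter> T2 = {}"
    using r unfolding T0_def T1_def T2_def by (auto simp: abs_if)
  have f: "finite T0" "finite T1" "finite T2" using fin by (auto simp: T0_def T1_def T2_def)
  have 1: "(\<Sum>k\<in>T1. 1 / (l * u k)) \<le> 2 * D / \<rho> + 1 / (l * m)"
    unfolding u_def v_def
    by (rule circle_sum_right) (use f l m r D T uD in \<open>auto simp: T1_def u_def v_def\<close>)
  \<comment> \<open>Reflecting k to -k and the centre c to -c carries the lower cap to the upper
    one.\<close>
  have vm: "of_int (- k) / l - - c = - v k" for k by (simp add: v_def)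
  have "(\<Sum>k\<in>uminus ` T2. 1 / (l * sqrt (\<rho>\<^sup>2 - (of_int k / l - - c)\<^sup>2))) \<le> 2 * D / \<rho> + 1 / (l * m)"
  proof (rule circle_sum_right)
    fix k assume "k \<in> uminus ` T2"
    then obtain j where j: "k = - j" "j \<in> T2" by auto
    show "\<rho> / 2 \<le> of_int k / l - - c \<and> m\<^sup>2 + (of_int k / l - - c)\<^sup>2 \<le> \<rho>\<^sup>2"
      unfolding j(1) vm using T[of j] j(2) by (simp add: T2_def)
    fix k' assume "k' \<in> uminus ` T2"
    then obtain j' where j': "k' = - j'" "j' \<in> T2" by auto
    show "\<bar>sqrt (\<rho>\<^sup>2 - (of_int k / l - - c)\<^sup>2) - sqrt (\<rho>\<^sup>2 - (of_int k' / l - - c)\<^sup>2)\<bar> \<le> D"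
      unfolding j(1) j'(1) vm using uD[of j j'] j(2) j'(2) by (simp add: T2_def u_def)
  qed (use f l m r D in auto)
  also have "(\<Sum>k\<in>uminus ` T2. 1 / (l * sqrt (\<rho>\<^sup>2 - (of_int k / l - - c)\<^sup>2))) = (\<Sum>k\<in>T2. 1 / (l * u k))"
    by (subst sum.reindex) (auto simp only: comp_def vm u_def power2_minus inj_on_def neg_equal_iff_equal)
  finally have 2: "(\<Sum>k\<in>T2. 1 / (l * u k)) \<le> 2 * D / \<rho> + 1 / (l * m)" .
  have 0: "(\<Sum>k\<in>T0. 1 / (l * u k)) \<le> 2 * D / \<rho> + 2 / (l * m)"
  proof (cases "T0 = {}")
    case False
    then obtain k0 where k0: "k0 \<in> T" by (auto simp: T0_def)
    have "m\<^sup>2 \<le> \<rho>\<^sup>2" using T[OF k0] zero_le_power2[of "v k0"] by linarith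
    \<comment> \<open>With m <= \<rho> the extra 1 of the lattice count, worth 2 / (l \<rho>), is
      absorbed into the boundary term.\<close>
    then have mr: "m \<le> \<rho>" using m r by (simp add: power2_le_iff_abs_le)
    have "1 / (l * u k) \<le> 2 / (l * \<rho>)" if "k \<in> T0" for k
    proof -
      have "(v k)\<^sup>2 \<le> (\<rho> / 2)\<^sup>2" using that r by (subst abs_le_square_iff[symmetric]) (simp add: T0_def)
      then have "(\<rho> / 2)\<^sup>2 \<le> \<rho>\<^sup>2 - (v k)\<^sup>2" by (simp add: power_divide) (use zero_le_power2[of \<rho>] in linarith)
      then have "\<rho> / 2 \<le> u k" unfolding u_def by (rule real_le_rsqrt)
      then have "1 / (l * u k) \<le> 1 / (l * (\<rho> / 2))"
        using l r by (intro divide_left_mono mult_left_mono mult_pos_pos) auto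
      then show ?thesis by simp
    qed
    then have "(\<Sum>k\<in>T0. 1 / (l * u k)) \<le> real (card T0) * (2 / (l * \<rho>))"
      by (rule sum_bounded_above)
    also have "\<dots> \<le> (l * D + 1) * (2 / (l * \<rho>))"
    proof (intro mult_right_mono card_int_diameter_le f)
      fix k k' assume "k \<in> T0" "k' \<in> T0"
      then have "\<bar>v k - v k'\<bar> \<le> D" using vD by (auto simp: T0_def)
      moreover have "v k - v k' = (of_int k - of_int k') / l" by (simp add: v_def diff_divide_distrib)
      ultimately show "\<bar>of_int k - of_int k'\<bar> \<le> l * D" using l by (simp add: field_simps)
    qed (use l D r in auto)
    also have "\<dots> = 2 * D / \<rho> + 2 / (l * \<rho>)" using l r by (simp add: field_simps)
    also have "\<dots> \<le> 2 * D / \<rho> + 2 / (l * m)" using l m mr by (intro add_left_mono divide_left_mono mult_left_mono) auto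
    finally show ?thesis .
  qed (use D r l m in auto)
  have "(\<Sum>k\<in>T. 1 / (l * u k)) = (\<Sum>k\<in>T0. 1 / (l * u k)) + ((\<Sum>k\<in>T1. 1 / (l * u k)) + (\<Sum>k\<in>T2. 1 / (l * u k)))"
    unfolding TT(1) by (simp add: sum.union_disjoint f TT(2,3))
  also have "\<dots> \<le> 6 * D / \<rho> + 4 / (l * m)" using 0 1 2 by simp
  finally show ?thesis .
qed

text \<open>On each line w = 2 (\<omega>^2 + v^2) replaces \<omega>; as \<omega> > 0 this is
  injective with d\<omega> = dw / (4 u). For fixed w the points on all lines lie on one circle of
  radius sqrt (w/2), so \<open>circle_sum\<close> bounds the summed density uniformly in w, and the
  Gaussian integrates to sqrt (2 pi) for every \<open>T\<close>. The hypotheses \<open>diam\<close>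
  and \<open>rad\<close> supply the size of the arc and a lower bound for the radius.\<close>

lemma fiber_bound:
  fixes Q :: "int \<Rightarrow> real \<Rightarrow> bool" and l m b c D r T :: real and K :: "int set"
  defines "v \<equiv> \<lambda>k::int. of_int k / l - c"
  assumes l: "0 < l" and m: "0 < m" and r: "0 < r" and D: "0 \<le> D" and mb: "m \<le> b"
    and Qm: "\<And>k. Measurable.pred borel (Q k)"
    and K: "finite K" "\<And>k \<omega>. Q k \<omega> \<Longrightarrow> k \<in> K"
    and rng: "\<And>k \<omega>. Q k \<omega> \<Longrightarrow> m \<le> \<omega> \<and> \<omega> \<le> b"
    and diam: "\<And>k \<omega> k' \<omega>'. Q k \<omega> \<Longrightarrow> Q k' \<omega>' \<Longrightarrow> \<omega>\<^sup>2 + (v k)\<^sup>2 = \<omega>'\<^sup>2 + (v k')\<^sup>2 \<Longrightarrow>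
        \<bar>\<omega> - \<omega>'\<bar> \<le> D \<and> \<bar>v k - v k'\<bar> \<le> D"
    and rad: "\<And>k \<omega>. Q k \<omega> \<Longrightarrow> r\<^sup>2 \<le> \<omega>\<^sup>2 + (v k)\<^sup>2"
  shows "(\<integral>\<^sup>+k. ennreal (1 / l) * (\<integral>\<^sup>+\<omega>. of_bool (Q k \<omega>) * ennreal (gauss 1 (T - 2 * (\<omega>\<^sup>2 + (v k)\<^sup>2))) \<partial>lborel)
      \<partial>count_space UNIV) \<le> ennreal (sqrt (2 * pi) * ((6 * D / r + 4 / (l * m)) / 4))"
proof -
  note [measurable] = Qm
  define u where "u k w = sqrt (w / 2 - (v k)\<^sup>2)" for k w
  define g where "g k \<omega> = 2 * (\<omega>\<^sup>2 + (v k)\<^sup>2)" for k \<omega>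
  define f where "f k w = of_bool (Q k (u k w)) * gauss 1 (T - w) / (4 * u k w)" for k w
  define E where "E = 6 * D / r + 4 / (l * m)"
  have E: "0 \<le> E" using D r l m by (simp add: E_def)
  have um [measurable]: "u k \<in> borel_measurable borel" for k unfolding u_def by measurable
  have fm [measurable]: "f k \<in> borel_measurable borel" for k
    unfolding f_def by measurable
  have gm: "g k m \<le> g k b" for k using m mb by (simp add: g_def power_mono)
  have AB: "(\<integral>\<^sup>+\<omega>. of_bool (Q k \<omega>) * ennreal (gauss 1 (T - 2 * (\<omega>\<^sup>2 + (v k)\<^sup>2))) \<partial>lborel) = 
      (\<integral>\<^sup>+w. ennreal (f k w * indicator {g k m..g k b} w) \<partial>lborel)" for k
  proof -
    have "(\<integral>\<^sup>+w. ennreal (f k w * indicator {g k m..g k b} w) \<partial>lborel) = 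
       (\<integral>\<^sup>+\<omega>. ennreal (f k (g k \<omega>) * (4 * \<omega>) * indicator {m..b} \<omega>) \<partial>lborel)"
      by (rule nn_integral_substitution)
        (use m mb in \<open>auto simp: g_def set_borel_measurable_def intro!: derivative_eq_intros continuous_intros\<close>)
    also have "\<dots> = (\<integral>\<^sup>+\<omega>. of_bool (Q k \<omega>) * ennreal (gauss 1 (T - 2 * (\<omega>\<^sup>2 + (v k)\<^sup>2))) \<partial>lborel)"
    proof (rule nn_integral_cong)
      fix \<omega> :: real
      show "ennreal (f k (g k \<omega>) * (4 * \<omega>) * indicator {m..b} \<omega>) = 
        of_bool (Q k \<omega>) * ennreal (gauss 1 (T - 2 * (\<omega>\<^sup>2 + (v k)\<^sup>2)))"
      proof (cases "\<omega> \<in> {m..b}")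
        case True
        have "2 * (\<omega>\<^sup>2 + (v k)\<^sup>2) / 2 - (v k)\<^sup>2 = \<omega>\<^sup>2" by (simp add: field_simps)
        with True have "u k (g k \<omega>) = \<omega>" "0 < \<omega>" using m by (simp_all only: u_def g_def) auto
        then show ?thesis using True by (simp add: f_def) (simp add: g_def)
      qed (use rng[of k \<omega>] in auto)
    qed
    finally show ?thesis ..
  qed
  \<comment> \<open>The sum over lines is taken at fixed w: \<open>diam\<close> compares only points
    on a common circle, so it becomes usable after lines and w have been interchanged.\<close>
  have D1: "(\<integral>\<^sup>+k. ennreal (1 / l) * ennreal (f k w * indicator {g k m..g k b} w) \<partial>count_space UNIV)
     \<le> ennreal (gauss 1 (T - w)) * ennreal (E / 4)" for w
  proof -
    define T' where "T' = {k\<in>K. w \<in> {g k m..g k b} \<and> Q k (u k w)}"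
    have T': "finite T'" using K(1) by (simp add: T'_def)
    have S: "(\<Sum>k\<in>T'. 1 / (l * u k w)) \<le> E"
    proof (cases "T' = {}")
      case False
      define \<rho> where "\<rho> = sqrt (w / 2)"
      have mv: "m\<^sup>2 + (v k)\<^sup>2 \<le> w / 2" if "k \<in> T'" for k using that by (auto simp: T'_def g_def)
      from False obtain k0 where k0: "k0 \<in> T'" by auto
      have w0: "0 < w / 2" using mv[OF k0] m by (smt (verit) zero_less_power2 zero_le_power2)
      then have \<rho>: "0 < \<rho>" "\<rho>\<^sup>2 = w / 2" by (auto simp: \<rho>_def)
      have uv: "(u k w)\<^sup>2 + (v k)\<^sup>2 = \<rho>\<^sup>2" if "k \<in> T'" for k
        
      proof -
        have "0 \<le> w / 2 - (v k)\<^sup>2" using mv[OF that] zero_le_power2[of m] by linarith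
        then show ?thesis unfolding u_def \<rho>(2) by simp
      qed
      have Q: "Q k (u k w)" if "k \<in> T'" for k using that by (simp add: T'_def)
      have "r\<^sup>2 \<le> \<rho>\<^sup>2" using rad[OF Q[OF k0]] uv[OF k0] by simp
      then have rr: "r \<le> \<rho>" using r \<rho>(1) by (simp add: power2_le_iff_abs_le)
      have "(\<Sum>k\<in>T'. 1 / (l * sqrt (\<rho>\<^sup>2 - (of_int k / l - c)\<^sup>2))) \<le> 6 * D / \<rho> + 4 / (l * m)"
      proof (rule circle_sum)
        fix k k' assume k: "k \<in> T'" "k' \<in> T'"
        from diam[OF Q[OF k(1)] Q[OF k(2)]] uv[OF k(1)] uv[OF k(2)]
        show "\<bar>sqrt (\<rho>\<^sup>2 - (of_int k / l - c)\<^sup>2) - sqrt (\<rho>\<^sup>2 - (of_int k' / l - c)\<^sup>2)\<bar> \<le> D"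
          "\<bar>of_int k / l - c - (of_int k' / l - c)\<bar> \<le> D" 
          unfolding \<rho>(2) by (auto simp: v_def u_def)
      next
        fix k assume "k \<in> T'"
        then show "m\<^sup>2 + (of_int k / l - c)\<^sup>2 \<le> \<rho>\<^sup>2" using mv[of k] unfolding \<rho>(2) v_def by simp
      qed (use T' l m \<rho> D in auto)
      also have "\<dots> \<le> E" unfolding E_def using D r rr by (intro add_right_mono divide_left_mono) auto
      finally show ?thesis by (simp add: u_def v_def \<rho>(2))
    qed (use E in auto)
    have "(\<integral>\<^sup>+k. ennreal (1 / l) * ennreal (f k w * indicator {g k m..g k b} w) \<partial>count_space UNIV)
      = (\<Sum>k\<in>T'. ennreal (1 / l) * ennreal (f k w * indicator {g k m..g k b} w))"
      by (rule nn_integral_count_space') (use T' K(2) in \<open>auto simp: T'_def f_def indicator_def\<close>)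
    also have "\<dots> = (\<Sum>k\<in>T'. ennreal (gauss 1 (T - w) / 4 * (1 / (l * u k w))))"
    proof (intro sum.cong refl)
      fix k assume k: "k \<in> T'"
      then have "m \<le> u k w" using rng by (auto simp: T'_def)
      then show "ennreal (1 / l) * ennreal (f k w * indicator {g k m..g k b} w) = 
          ennreal (gauss 1 (T - w) / 4 * (1 / (l * u k w)))"
        using k l m gauss_pos[of 1 "T - w"]
        by (subst ennreal_mult[symmetric]) (auto simp: T'_def f_def field_simps)
    qed
    also have "\<dots> = ennreal (\<Sum>k\<in>T'. gauss 1 (T - w) / 4 * (1 / (l * u k w)))"
    proof (rule sum_ennreal)
      fix k assume "k \<in> T'"
      then have "m \<le> u k w" using rng by (auto simp: T'_def)
      then show "0 \<le> gauss 1 (T - w) / 4 * (1 / (l * u k w))"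
        using l m gauss_pos[of 1 "T - w"] by simp
    qed
    also have "\<dots> = ennreal (gauss 1 (T - w) / 4 * (\<Sum>k\<in>T'. (1 / (l * u k w))))"
      by (simp only: sum_distrib_left)
    also have "\<dots> \<le> ennreal (gauss 1 (T - w) / 4 * E)"
      using S gauss_pos[of 1 "T - w"] by (intro ennreal_leI mult_left_mono) auto
    also have "\<dots> = ennreal (gauss 1 (T - w)) * ennreal (E / 4)"
      using gauss_pos[of 1 "T - w"] E by (simp add: ennreal_mult[symmetric] less_imp_le)
    finally show ?thesis .
  qed
  have "(\<integral>\<^sup>+k. ennreal (1 / l) * (\<integral>\<^sup>+\<omega>. of_bool (Q k \<omega>) * ennreal (gauss 1 (T - 2 * (\<omega>\<^sup>2 + (v k)\<^sup>2))) \<partial>lborel)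
      \<partial>count_space UNIV) = 
     (\<integral>\<^sup>+k. \<integral>\<^sup>+w. ennreal (1 / l) * ennreal (f k w * indicator {g k m..g k b} w) \<partial>lborel \<partial>count_space UNIV)"
    unfolding AB by (intro nn_integral_cong nn_integral_cmult[symmetric]) measurable
  also have "\<dots> = (\<integral>\<^sup>+w. \<integral>\<^sup>+k. ennreal (1 / l) * ennreal (f k w * indicator {g k m..g k b} w) \<partial>count_space UNIV \<partial>lborel)"
    by (rule nn_integral_count_space_nn_integral[symmetric]) auto
  also have "\<dots> \<le> (\<integral>\<^sup>+w. ennreal (gauss 1 (T - w)) * ennreal (E / 4) \<partial>lborel)"
    by (intro nn_integral_mono D1)
  also have "\<dots> = ennreal (sqrt (2 * pi)) * ennreal (E / 4)"
    by (subst nn_integral_multc) (auto simp: nn_integral_gauss_shift)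
  also have "\<dots> = ennreal (sqrt (2 * pi) * (E / 4))" using E by (subst ennreal_mult) auto
  finally show ?thesis unfolding E_def .
qed

subsection \<open>Pairs of nearly orthogonal frequencies\<close>

text \<open>Up to relative error \<theta> the vector (x, y) is parallel to (1, s). Dividing the
  inner product by x leaves p + s q with two errors, 3/2 \<theta> b from near-orthogonality and
  \<theta> b from the slope; 3 rounds up 5/2.\<close>

lemma perp_slope:
  fixes x y p q s \<theta> a b :: real
  assumes "\<bar>y - s * x\<bar> \<le> \<theta> * \<bar>x\<bar>" "0 < x \<or> x < 0" "a \<le> 3/2 * \<bar>x\<bar>" "\<bar>q\<bar> \<le> b" "0 \<le> \<theta>"
    and "\<bar>x * p + y * q\<bar> \<le> \<theta> * (a * b)"
  shows "\<bar>p + s * q\<bar> \<le> 3 * \<theta> * b"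
proof -
  have b: "0 \<le> b" using assms(4) by linarith
  have x: "0 < \<bar>x\<bar>" using assms(2) by auto
  have "\<bar>x\<bar> * \<bar>p + s * q\<bar> = \<bar>(x * p + y * q) - (y - s * x) * q\<bar>"
    by (simp add: abs_mult[symmetric] algebra_simps)
  also have "\<dots> \<le> \<bar>x * p + y * q\<bar> + \<bar>y - s * x\<bar> * \<bar>q\<bar>" by (simp add: abs_mult[symmetric] abs_triangle_ineq4)
  also have "\<dots> \<le> \<theta> * (a * b) + \<theta> * \<bar>x\<bar> * b" using assms b by (intro add_mono mult_mono) auto
  also have "\<dots> \<le> \<theta> * (3/2 * \<bar>x\<bar> * b) + \<theta> * \<bar>x\<bar> * b" using assms b
    by (intro add_mono mult_left_mono mult_right_mono) auto
  also have "\<dots> \<le> \<bar>x\<bar> * (3 * \<theta> * b)" using b assms(5) x by (simp add: field_simps)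
  finally show ?thesis using x by simp
qed

text \<open>\<open>3/2\<close> stands in for sqrt 2: within a sector the larger coordinate controls
  the norm.\<close>

lemma norm_le_three_halves:
  fixes x y :: real assumes "\<bar>y\<bar> \<le> \<bar>x\<bar>" shows "sqrt (x\<^sup>2 + y\<^sup>2) \<le> 3/2 * \<bar>x\<bar>"
proof (rule real_le_lsqrt)
  have "y\<^sup>2 \<le> x\<^sup>2" using assms by (simp add: abs_le_square_iff)
  moreover have "(3 / 2 * \<bar>x\<bar>)\<^sup>2 = 9/4 * x\<^sup>2" by (simp add: power_mult_distrib power_divide)
  ultimately show "x\<^sup>2 + y\<^sup>2 \<le> (3 / 2 * \<bar>x\<bar>)\<^sup>2" using zero_le_power2[of x] by linarith
qed auto

text \<open>The points \<open>(x, y)\<close> and \<open>(x', y')\<close> lie on one circle through nearly the origin (Thales) and in one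
  narrow sector seen from the origin. The circle crosses the sector transversally, which is
  the lower bound on the factor \<open>f\<close> below.\<close>

lemma sector_transversal:
  fixes x y x' y' z w s \<theta> c1 c2 N b :: real
  assumes c: "0 < c1" "0 < c2" "0 < N" and th: "0 < \<theta>" "\<theta> \<le> 1/10"
    and sec: "\<bar>y\<bar> \<le> \<bar>x\<bar>" "\<bar>y - s * x\<bar> \<le> \<theta> * \<bar>x\<bar>" "\<bar>y'\<bar> \<le> \<bar>x'\<bar>" "\<bar>y' - s * x'\<bar> \<le> \<theta> * \<bar>x'\<bar>"
    and a: "c1 * N \<le> sqrt (x\<^sup>2 + y\<^sup>2)" "sqrt (x\<^sup>2 + y\<^sup>2) \<le> c2 * N"
    and a': "c1 * N \<le> sqrt (x'\<^sup>2 + y'\<^sup>2)" "sqrt (x'\<^sup>2 + y'\<^sup>2) \<le> c2 * N"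
    and b: "sqrt ((z - x)\<^sup>2 + (w - y)\<^sup>2) \<le> c2 * N"
    and ang: "\<bar>x * (z - x) + y * (w - y)\<bar> \<le> \<theta> * (sqrt (x\<^sup>2 + y\<^sup>2) * sqrt ((z - x)\<^sup>2 + (w - y)\<^sup>2))"
    and eq: "x * (z - x) + y * (w - y) = x' * (z - x') + y' * (w - y')"
  shows "\<bar>x - x'\<bar> \<le> 200 * (c2\<^sup>2 / c1) * \<theta> * N \<and> \<bar>y - y'\<bar> \<le> 200 * (c2\<^sup>2 / c1) * \<theta> * N"
proof -
  define R where "R = c2 * N"
  have R: "0 < R" using c by (simp add: R_def)
  have le: "\<bar>x\<bar> \<le> R" "\<bar>y\<bar> \<le> R" "\<bar>x'\<bar> \<le> R" "\<bar>y'\<bar> \<le> R" "\<bar>z - x\<bar> \<le> R" "\<bar>w - y\<bar> \<le> R"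
    unfolding R_def
    by (rule order_trans[OF real_sqrt_ge_abs1 a(2)] order_trans[OF real_sqrt_ge_abs2 a(2)]
      order_trans[OF real_sqrt_ge_abs1 a'(2)] order_trans[OF real_sqrt_ge_abs2 a'(2)]
      order_trans[OF real_sqrt_ge_abs1 b] order_trans[OF real_sqrt_ge_abs2 b])+
  have c12: "c1 \<le> c2" using a c(3) by (meson dual_order.trans mult_le_cancel_right_pos)
  have c2q: "c2 \<le> c2\<^sup>2 / c1" using c c12 by (simp add: field_simps power2_eq_square)
  have RR: "\<theta> * R \<le> c2\<^sup>2 / c1 * \<theta> * N" 
  proof -
    have "(\<theta> * N) * c2 \<le> (\<theta> * N) * (c2\<^sup>2 / c1)" using c2q c th by (intro mult_left_mono) auto
    then show ?thesis by (simp add: R_def mult.commute mult.left_commute)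
  qed
  show ?thesis
  \<comment> \<open>Beyond c1 / (10 c2) the trivial diameter bound 2 R is already below the right
    side. Transversality is needed only for smaller \<theta>, and this split keeps the threshold
    1/10 free of c1 and c2.\<close>
  proof (cases "\<theta> \<le> c1 / (10 * c2)")
    case False
    then have "1 \<le> 10 * (c2 / c1) * \<theta>" using c by (simp add: field_simps)
    then have "2 * R * 1 \<le> 2 * R * (10 * (c2 / c1) * \<theta>)" using R by (intro mult_left_mono) auto
    also have "\<dots> = 20 * (c2\<^sup>2 / c1) * \<theta> * N" by (simp add: R_def power2_eq_square)
    also have "\<dots> \<le> 200 * (c2\<^sup>2 / c1) * \<theta> * N" using c th by (intro mult_right_mono) auto
    finally show ?thesis using le by auto
  next
    case True
    have tR: "\<theta> * R \<le> c1 * N / 10" using True c by (simp add: R_def field_simps)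
    define d where "d = y - s * x"
    define d' where "d' = y' - s * x'"
    have xl: "2/3 * (c1 * N) \<le> \<bar>x\<bar>" "2/3 * (c1 * N) \<le> \<bar>x'\<bar>"
      using norm_le_three_halves[OF sec(1)] norm_le_three_halves[OF sec(3)] a a' by linarith+
    have x0: "0 < \<bar>x\<bar>" "0 < \<bar>x'\<bar>" using xl mult_pos_pos[OF c(1,3)] by linarith+
    have s2: "\<bar>s\<bar> \<le> 11/10"
    proof -
      have "\<bar>s\<bar> * \<bar>x\<bar> \<le> \<bar>y - s * x\<bar> + \<bar>y\<bar>" by (simp add: abs_mult[symmetric])
      also have "\<dots> \<le> \<theta> * \<bar>x\<bar> + \<bar>x\<bar>" using sec by linarith
      also have "\<dots> \<le> 1/10 * \<bar>x\<bar> + \<bar>x\<bar>" using th by (intro add_right_mono mult_right_mono) auto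
      finally have "\<bar>s\<bar> * \<bar>x\<bar> \<le> 11/10 * \<bar>x\<bar>" by simp
      with x0(1) show ?thesis by simp
    qed
    have dd: "\<bar>d\<bar> \<le> \<theta> * R" "\<bar>d'\<bar> \<le> \<theta> * R"
      using sec(2,4) le(1,3) th mult_left_mono[of "\<bar>x\<bar>" R \<theta>] mult_left_mono[of "\<bar>x'\<bar>" R \<theta>]
      unfolding d_def d'_def by linarith+
    have ps: "\<bar>(z - x) + s * (w - y)\<bar> \<le> 3 * \<theta> * R"
    proof -
      have "\<bar>(z - x) + s * (w - y)\<bar> \<le> 3 * \<theta> * sqrt ((z - x)\<^sup>2 + (w - y)\<^sup>2)"
        by (rule perp_slope[OF sec(2) _ norm_le_three_halves[OF sec(1)] _ _ ang])
          (use x0 th real_sqrt_ge_abs2[of "w - y" "z - x"] in \<open>auto\<close>)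
      also have "\<dots> \<le> 3 * \<theta> * R" using b th by (simp add: R_def)
      finally show ?thesis .
    qed
    \<comment> \<open>Substituting y = s x + d and y' = s x' + d' into \<open>eq\<close> leaves (x -
      x') f equal to terms that all contain d or d'. In \<open>f\<close> the part (z - x) + s (w -
      y) is small by near-orthogonality and s d by the sector width, so (1 + s^2) x', which is of
      order N, dominates.\<close>
    define f where "f = (z - x) + s * (w - y) + s * d - (1 + s\<^sup>2) * x'"
    have sq: "1 * \<bar>x'\<bar> \<le> (1 + s\<^sup>2) * \<bar>x'\<bar>" by (intro mult_right_mono) auto
    have sd: "\<bar>s * d\<bar> \<le> 11/10 * (\<theta> * R)" unfolding abs_mult using s2 dd by (intro mult_mono) auto
    have sx: "\<bar>(1 + s\<^sup>2) * x'\<bar> = (1 + s\<^sup>2) * \<bar>x'\<bar>" by (simp add: abs_mult)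
    \<comment> \<open>In units of c1 N: 2/3 from x', minus 3/10 and 11/100 for the two small parts,
      exceeds 1/5.\<close>
    have fl: "c1 * N / 5 \<le> \<bar>f\<bar>"
    proof -
      have "\<bar>(1 + s\<^sup>2) * x'\<bar> \<le> \<bar>f\<bar> + (\<bar>(z - x) + s * (w - y)\<bar> + \<bar>s * d\<bar>)"
        unfolding f_def by (smt (verit))
      with sq ps xl(2) tR mult_pos_pos[OF c(1,3)] sd sx show ?thesis by linarith
    qed
    have "(x - x') * f = - (d - d') * w + 2 * s * (x * d - x' * d') + d\<^sup>2 - d'\<^sup>2"
    proof -
      have "(x - x') * f - (- (d - d') * w + 2 * s * (x * d - x' * d') + d\<^sup>2 - d'\<^sup>2) = 
        (x * (z - x) + y * (w - y)) - (x' * (z - x') + y' * (w - y'))"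
        unfolding f_def d_def d'_def by (simp add: algebra_simps power2_eq_square)
      with eq show ?thesis by simp
    qed
    also have "\<bar>\<dots>\<bar> \<le> 16 * \<theta> * R * R"
    proof -
      have "\<bar>w\<bar> \<le> 2 * R" using le by linarith
      then have 1: "\<bar>(d - d') * w\<bar> \<le> 2 * (\<theta> * R) * (2 * R)" unfolding abs_mult using dd by (intro mult_mono) auto
      have "\<bar>x * d\<bar> \<le> R * (\<theta> * R)" "\<bar>x' * d'\<bar> \<le> R * (\<theta> * R)"
        unfolding abs_mult using dd le R by (intro mult_mono; auto)+
      then have "\<bar>x * d - x' * d'\<bar> \<le> 2 * (R * (\<theta> * R))" by linarith
      then have 2: "\<bar>2 * s * (x * d - x' * d')\<bar> \<le> 2 * (11/10) * (2 * (R * (\<theta> * R)))"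
        unfolding abs_mult using s2 by (intro mult_mono) auto
      have "\<bar>d\<bar> * \<bar>d\<bar> \<le> (\<theta> * R) * R" "\<bar>d'\<bar> * \<bar>d'\<bar> \<le> (\<theta> * R) * R"
        using dd th R by (intro mult_mono; auto simp: order_trans[OF dd(1)] order_trans[OF dd(2)])+
      then have 3: "d\<^sup>2 \<le> (\<theta> * R) * R" "d'\<^sup>2 \<le> (\<theta> * R) * R" by (simp_all add: power2_eq_square)
      have p: "0 \<le> \<theta> * R * R" using th R by simp
      have "\<bar>- (d - d') * w + 2 * s * (x * d - x' * d') + d\<^sup>2 - d'\<^sup>2\<bar> \<le> 
        \<bar>(d - d') * w\<bar> + \<bar>2 * s * (x * d - x' * d')\<bar> + d\<^sup>2 + d'\<^sup>2" 
        using zero_le_power2[of d] zero_le_power2[of d'] by linarith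
      also have "\<dots> \<le> 2 * (\<theta> * R) * (2 * R) + 2 * (11/10) * (2 * (R * (\<theta> * R))) + (\<theta> * R) * R + (\<theta> * R) * R"
        using 1 2 3 by linarith
      also have "\<dots> \<le> 16 * \<theta> * R * R" using p by (simp add: algebra_simps)
      finally show ?thesis .
    qed
    finally have "\<bar>x - x'\<bar> * \<bar>f\<bar> \<le> 16 * \<theta> * R * R" by (simp add: abs_mult)
    moreover have "\<bar>x - x'\<bar> * (c1 * N / 5) \<le> \<bar>x - x'\<bar> * \<bar>f\<bar>" using fl by (intro mult_left_mono) auto
    \<comment> \<open>80 is the 16 of the error terms times the 5 from the lower bound on |f|; the
      \<open>200\<close> of the claim leaves room for the other coordinate, which adds a slope
      factor 11/10 and the sector widths.\<close>
    ultimately have "\<bar>x - x'\<bar> * (c1 * N) \<le> 80 * \<theta> * R * R" by linarith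
    then have "\<bar>x - x'\<bar> \<le> 80 * \<theta> * R * R / (c1 * N)" using c by (simp add: pos_le_divide_eq)
    also have "\<dots> = 80 * (c2\<^sup>2 / c1 * \<theta> * N)" using c by (simp add: R_def power2_eq_square)
    finally have X: "\<bar>x - x'\<bar> \<le> 80 * (c2\<^sup>2 / c1 * \<theta> * N)" .
    have "y - y' = s * (x - x') + (d - d')" by (simp add: d_def d'_def algebra_simps)
    then have "\<bar>y - y'\<bar> \<le> \<bar>s\<bar> * \<bar>x - x'\<bar> + (\<bar>d\<bar> + \<bar>d'\<bar>)" by (simp add: abs_mult[symmetric])
    also have "\<dots> \<le> 11/10 * \<bar>x - x'\<bar> + 2 * (\<theta> * R)" using s2 dd by (intro add_mono mult_right_mono) auto
    also have "\<dots> \<le> 11/10 * (80 * (c2\<^sup>2 / c1 * \<theta> * N)) + 2 * (c2\<^sup>2 / c1 * \<theta> * N)"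
      using X RR by (intro add_mono mult_left_mono) auto
    also have "\<dots> = 90 * (c2\<^sup>2 / c1 * \<theta> * N)" by simp
    finally have Y: "\<bar>y - y'\<bar> \<le> 90 * (c2\<^sup>2 / c1 * \<theta> * N)" .
    have "0 \<le> c2\<^sup>2 / c1 * \<theta> * N" using c th by simp
    then have "80 * (c2\<^sup>2 / c1 * \<theta> * N) \<le> 200 * (c2\<^sup>2 / c1 * \<theta> * N)" 
      "90 * (c2\<^sup>2 / c1 * \<theta> * N) \<le> 200 * (c2\<^sup>2 / c1 * \<theta> * N)"
      by (intro mult_right_mono; simp)+
    from order_trans[OF X this(1)] order_trans[OF Y this(2)] show ?thesis
      by (simp add: mult.assoc)
  qed
qed

text \<open>Slopes are rounded to multiples of \<open>\<theta>\<close>; the flag tells which coordinate is the larger one.\<close>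

definition sector :: "real \<Rightarrow> real \<times> real \<Rightarrow> int \<times> bool" where
  "sector \<theta> \<xi> = (if \<bar>snd \<xi>\<bar> \<le> \<bar>fst \<xi>\<bar> then (\<lfloor>snd \<xi> / fst \<xi> / \<theta>\<rfloor>, True) else (\<lfloor>fst \<xi> / snd \<xi> / \<theta>\<rfloor>, False))"

lemma sector_measurable [measurable]: "sector \<theta> \<in> measurable borel (count_space UNIV)"
proof -
  have [measurable]: "fst \<in> borel_measurable (borel :: (real \<times> real) measure)"
    "snd \<in> borel_measurable (borel :: (real \<times> real) measure)"
    by (auto intro!: borel_measurable_continuous_onI continuous_intros)
  show ?thesis unfolding sector_def by measurable
qed

text \<open>Rounding costs at most one unit of \<theta> in slope. For x = 0 the second hypothesis
  forces y = 0, so the default value of the quotient does no harm.\<close>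

lemma floor_slope:
  fixes x y \<theta> :: real
  assumes "0 < \<theta>" "\<bar>y\<bar> \<le> \<bar>x\<bar>"
  shows "\<bar>y - of_int \<lfloor>y / x / \<theta>\<rfloor> * \<theta> * x\<bar> \<le> \<theta> * \<bar>x\<bar>"
proof (cases "x = 0")
  case False
  have "y - of_int \<lfloor>y / x / \<theta>\<rfloor> * \<theta> * x = (y / x / \<theta> - of_int \<lfloor>y / x / \<theta>\<rfloor>) * (\<theta> * x)"
    using False assms(1) by (simp add: field_simps)
  also have "\<bar>\<dots>\<bar> = \<bar>y / x / \<theta> - of_int \<lfloor>y / x / \<theta>\<rfloor>\<bar> * (\<theta> * \<bar>x\<bar>)"
    using assms(1) by (simp add: abs_mult)
  also have "\<dots> \<le> 1 * (\<theta> * \<bar>x\<bar>)"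
    by (intro mult_right_mono) (linarith, simp add: assms(1) less_imp_le)
  finally show ?thesis by simp
qed (use assms in auto)

lemma sector_cases:
  assumes "0 < \<theta>"
  shows "sector \<theta> (x, y) = (j, True) \<Longrightarrow> \<bar>y\<bar> \<le> \<bar>x\<bar> \<and> \<bar>y - of_int j * \<theta> * x\<bar> \<le> \<theta> * \<bar>x\<bar>"
    and "sector \<theta> (x, y) = (j, False) \<Longrightarrow> \<bar>x\<bar> < \<bar>y\<bar> \<and> \<bar>x - of_int j * \<theta> * y\<bar> \<le> \<theta> * \<bar>y\<bar>"
  using floor_slope[OF assms, of y x] floor_slope[OF assms, of x y]
  by (auto simp: sector_def split: if_splits)

text \<open>Here \<open>N\<close> is the larger of the two frequency scales.\<close>

definition interaction ::
  "real \<Rightarrow> real \<Rightarrow> real \<Rightarrow> real \<Rightarrow> real \<Rightarrow> int \<times> bool \<Rightarrow> real \<times> real \<Rightarrow> real \<times> real \<Rightarrow> bool" where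
  "interaction c1 c2 N K \<theta> i \<xi>1 \<xi>2 \<longleftrightarrow>
     c1 * N \<le> norm \<xi>1 \<and> norm \<xi>1 \<le> c2 * N \<and> norm \<xi>2 \<le> c2 * N \<and> K \<le> \<bar>fst \<xi>1 - fst \<xi>2\<bar> \<and>
     \<bar>\<xi>1 \<bullet> \<xi>2\<bar> \<le> \<theta> * (norm \<xi>1 * norm \<xi>2) \<and> sector \<theta> \<xi>1 = i"

lemma interaction_measurable [measurable (raw)]:
  assumes [measurable]: "f \<in> borel_measurable M" "g \<in> borel_measurable M"
  shows "Measurable.pred M (\<lambda>x. interaction c1 c2 N K \<theta> i (f x) (g x))"
proof -
  have [measurable]: "fst \<in> borel_measurable (borel :: (real \<times> real) measure)"
    by (auto intro!: borel_measurable_continuous_onI continuous_intros)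
  show ?thesis unfolding interaction_def by measurable
qed

lemma norm_pair_eq_sqrt: "norm (x :: real, y :: real) = sqrt (x\<^sup>2 + y\<^sup>2)"
  by (simp add: norm_Pair)

text \<open>For a common sum (z, w), lying on one circle means having the same inner product, which
  is the form of \<open>eq\<close>. The flag of the sector decides which coordinate serves as
  abscissa; for \<open>False\<close> the transversality estimate is applied with the coordinates
  exchanged.\<close>

lemma interaction_diam:
  fixes x y x' y' z w :: real
  assumes c: "0 < c1" "0 < c2" "0 < N" and th: "0 < \<theta>" "\<theta> \<le> 1/10"
    and I: "interaction c1 c2 N K \<theta> i (x, y) (z - x, w - y)"
    and I': "interaction c1 c2 N K \<theta> i (x', y') (z - x', w - y')"
    and eq: "x * (z - x) + y * (w - y) = x' * (z - x') + y' * (w - y')"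
  shows "\<bar>x - x'\<bar> \<le> 200 * (c2\<^sup>2 / c1) * \<theta> * N \<and> \<bar>y - y'\<bar> \<le> 200 * (c2\<^sup>2 / c1) * \<theta> * N"
proof (cases i)
  case (Pair j b)
  show ?thesis
  proof (cases b)
    case True
    show ?thesis
      by (rule sector_transversal[where s = "of_int j * \<theta>" and z = z and w = w])
        (use I I' Pair True c th eq sector_cases(1)[OF th(1), of x y j] sector_cases(1)[OF th(1), of x' y' j]
          in \<open>auto simp: interaction_def norm_pair_eq_sqrt\<close>)
  next
    case False
    have "\<bar>y - y'\<bar> \<le> 200 * (c2\<^sup>2 / c1) * \<theta> * N \<and> \<bar>x - x'\<bar> \<le> 200 * (c2\<^sup>2 / c1) * \<theta> * N"
      by (rule sector_transversal[where s = "of_int j * \<theta>" and z = w and w = z])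
        (use I I' Pair False c th eq sector_cases(2)[OF th(1), of x y j] sector_cases(2)[OF th(1), of x' y' j]
          in \<open>auto simp: interaction_def norm_pair_eq_sqrt add.commute\<close>)
    then show ?thesis by blast
  qed
qed

text \<open>The radius of the circle around half the sum is half of |xi_1 - xi_2|.
  Near-orthogonality excludes cancellation: |xi_1 - xi_2|^2 is at least 9/10 of |xi_1|^2 + |xi_2|^2,
  and xi_1 alone makes this of order N^2.\<close>

lemma interaction_radius:
  fixes x y z w :: real
  assumes c: "0 < c1" "0 < N" and th: "0 < \<theta>" "\<theta> \<le> 1/10"
    and I: "interaction c1 c2 N K \<theta> i (x, y) (z - x, w - y)"
  shows "(c1 * N / 4)\<^sup>2 \<le> (x - z / 2)\<^sup>2 + (y - w / 2)\<^sup>2"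
proof -
  define a where "a = norm (x, y)"
  define b where "b = norm (z - x, w - y)"
  define s where "s = x * (z - x) + y * (w - y)"
  have ab: "a\<^sup>2 = x\<^sup>2 + y\<^sup>2" "b\<^sup>2 = (z - x)\<^sup>2 + (w - y)\<^sup>2" "0 \<le> a" "0 \<le> b"
    unfolding a_def b_def by (simp_all add: norm_pair_eq_sqrt)
  have s: "\<bar>s\<bar> \<le> \<theta> * (a * b)" and a: "c1 * N \<le> a"
    using I by (simp_all add: interaction_def a_def b_def s_def)
  have "\<theta> * (a * b) \<le> 1/10 * (a * b)" using th ab by (intro mult_right_mono) auto
  then have 1: "s \<le> 1/10 * (a * b)" using s by linarith
  have "0 \<le> (a - b)\<^sup>2" by simp
  then have 2: "2 * (a * b) \<le> a\<^sup>2 + b\<^sup>2" by (simp add: power2_eq_square algebra_simps)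
  have 3: "(c1 * N)\<^sup>2 \<le> a\<^sup>2" using a c by (intro power_mono) auto
  have 4: "4 * ((x - z / 2)\<^sup>2 + (y - w / 2)\<^sup>2) = a\<^sup>2 + b\<^sup>2 - 2 * s"
    unfolding ab s_def by (simp add: power2_eq_square field_simps)
  \<comment> \<open>Stated for abstract quantities, so that squares and products are atoms of a
    linear problem.\<close>
  have "P / 16 \<le> X" if "S \<le> 1/10 * R" "2 * R \<le> A + B" "P \<le> A" "4 * X = A + B - 2 * S" "0 \<le> B" "0 \<le> A"
    for P X S R A B :: real using that by linarith
  from this[OF 1 2 3 4] show ?thesis by (simp add: power_divide)
qed

text \<open>Pairs with sum (\<sigma>, \<kappa>/l) are parametrized by the offset (\<omega>, k/l -
  c0) of xi_1 from the midpoint. The first coordinates differ by 2 \<omega>, so the condition on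
  \<open>K\<close> reads |\<omega>| >= K/2, and the two signs are treated separately. As D / r = 800
  c2^2 / c1^2 \<theta>, twice a quarter of 6 D / r + 8 / (l K) is the stated constant.\<close>

lemma fiber_interaction:
  fixes c1 c2 N K \<theta> l \<sigma> T :: real and \<kappa> :: int and i :: "int \<times> bool"
  assumes c: "0 < c1" "0 < c2" "0 < N" and th: "0 < \<theta>" "\<theta> \<le> 1/10" and l: "0 < l" and K: "0 < K"
  defines "p \<equiv> \<lambda>k \<omega>. (\<sigma> / 2 + \<omega>, of_int k / l)"
  defines "q \<equiv> \<lambda>k \<omega>. (\<sigma> / 2 - \<omega>, of_int (\<kappa> - k) / l)"
  shows "(\<integral>\<^sup>+k. ennreal (1 / l) * (\<integral>\<^sup>+\<omega>. of_bool (interaction c1 c2 N K \<theta> i (p k \<omega>) (q k \<omega>)) * 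
        ennreal (gauss 1 (T - ((norm (p k \<omega>))\<^sup>2 + (norm (q k \<omega>))\<^sup>2))) \<partial>lborel) \<partial>count_space UNIV)
    \<le> ennreal (sqrt (2 * pi) * (2400 * c2\<^sup>2 / c1\<^sup>2 * \<theta> + 4 / (l * K)))"
proof -
  define c0 where "c0 = of_int \<kappa> / (2 * l)"
  define v where "v k = of_int k / l - c0" for k :: int
  define D where "D = 200 * (c2\<^sup>2 / c1) * \<theta> * N"
  define r where "r = c1 * N / 4"
  define T0 where "T0 = T - (\<sigma>\<^sup>2 / 2 + 2 * c0\<^sup>2)"
  \<comment> \<open>\<open>s\<close> is the sign of the offset; folding it in keeps the variable
    \<omega> positive, as \<open>fiber_bound\<close> requires.\<close>
  define Q where "Q s k \<omega> \<longleftrightarrow> K / 2 \<le> \<omega> \<and> interaction c1 c2 N K \<theta> i (p k (s * \<omega>)) (q k (s * \<omega>))" for s \<omega> :: real and k :: int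
  have D: "0 \<le> D" using c th by (simp add: D_def)
  have r: "0 < r" using c by (simp add: r_def)
  have pm [measurable]: "p k \<in> borel_measurable borel" "q k \<in> borel_measurable borel" for k
    unfolding p_def q_def by (auto intro!: borel_measurable_continuous_onI continuous_intros)
  have pq: "q k \<omega> = (\<sigma> - (\<sigma> / 2 + \<omega>), of_int \<kappa> / l - of_int k / l)" for k \<omega>
    by (simp add: q_def diff_divide_distrib)
  have nrm: "(norm (p k \<omega>))\<^sup>2 + (norm (q k \<omega>))\<^sup>2 = \<sigma>\<^sup>2 / 2 + 2 * c0\<^sup>2 + 2 * (\<omega>\<^sup>2 + (v k)\<^sup>2)" for k \<omega>
  proof -
    have "of_int (\<kappa> - k) / l = c0 - v k" "of_int k / l = c0 + v k"
      using l by (simp_all add: c0_def v_def field_simps)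
    then show ?thesis by (simp add: p_def q_def norm_pair_eq_sqrt) (simp add: power2_eq_square field_simps)
  qed
  have s2: "s\<^sup>2 = 1" "\<bar>s\<bar> = 1" if "s \<in> {1, -1 :: real}" for s using that by auto
  have Qs: "(\<integral>\<^sup>+k. ennreal (1 / l) * (\<integral>\<^sup>+\<omega>. of_bool (Q s k \<omega>) * ennreal (gauss 1 (T0 - 2 * (\<omega>\<^sup>2 + (v k)\<^sup>2))) \<partial>lborel)
      \<partial>count_space UNIV) \<le> ennreal (sqrt (2 * pi) * ((6 * D / r + 4 / (l * (K / 2))) / 4))" if s: "s \<in> {1, -1}" for s
    unfolding v_def
  proof (rule fiber_bound)
    show "Measurable.pred borel (Q s k)" for k unfolding Q_def by measurable
    show "0 < K / 2" "K / 2 \<le> K / 2 + c2 * N" using K c by auto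
    show "finite {-\<lceil>c2 * N * l\<rceil>..\<lceil>c2 * N * l\<rceil>}" by simp
  next
    fix k \<omega> assume "Q s k \<omega>"
    then have I: "interaction c1 c2 N K \<theta> i (p k (s * \<omega>)) (q k (s * \<omega>))" and o: "K / 2 \<le> \<omega>" by (auto simp: Q_def)
    have P: "norm (p k (s * \<omega>)) \<le> c2 * N" and Q: "norm (q k (s * \<omega>)) \<le> c2 * N" using I by (auto simp: interaction_def)
    have "\<bar>of_int k / l\<bar> \<le> c2 * N" using norm_snd_le[of "snd (p k (s * \<omega>))" "fst (p k (s * \<omega>))"] P by (simp add: p_def)
    then have "\<bar>of_int k\<bar> \<le> c2 * N * l" using l by (simp add: field_simps)
    then have "of_int k \<le> (of_int \<lceil>c2 * N * l\<rceil> :: real)" "- of_int k \<le> (of_int \<lceil>c2 * N * l\<rceil> :: real)" by linarith+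
    then show "k \<in> {-\<lceil>c2 * N * l\<rceil>..\<lceil>c2 * N * l\<rceil>}" by (simp flip: of_int_minus)
    have "\<bar>\<sigma> / 2 + s * \<omega>\<bar> \<le> c2 * N" "\<bar>\<sigma> / 2 - s * \<omega>\<bar> \<le> c2 * N"
      using norm_fst_le[of "fst (p k (s * \<omega>))" "snd (p k (s * \<omega>))"] P 
        norm_fst_le[of "fst (q k (s * \<omega>))" "snd (q k (s * \<omega>))"] Q by (simp_all add: p_def q_def)
    then have "\<bar>s * \<omega>\<bar> \<le> c2 * N" by linarith
    then have "\<bar>\<omega>\<bar> \<le> c2 * N" using s2[OF s] by (simp add: abs_mult)
    with o K show "K / 2 \<le> \<omega> \<and> \<omega> \<le> K / 2 + c2 * N" by linarith
    have "(c1 * N / 4)\<^sup>2 \<le> ((\<sigma> / 2 + s * \<omega>) - \<sigma> / 2)\<^sup>2 + (of_int k / l - of_int \<kappa> / l / 2)\<^sup>2"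
      by (rule interaction_radius[OF c(1,3) th]) (use I in \<open>unfold pq, unfold p_def\<close>)
    then show "r\<^sup>2 \<le> \<omega>\<^sup>2 + (of_int k / l - c0)\<^sup>2"
      using s2[OF s] by (simp add: r_def c0_def power_mult_distrib mult.commute)
    fix k' \<omega>' assume "Q s k' \<omega>'" and eq: "\<omega>\<^sup>2 + (of_int k / l - c0)\<^sup>2 = \<omega>'\<^sup>2 + (of_int k' / l - c0)\<^sup>2"
    then have I': "interaction c1 c2 N K \<theta> i (p k' (s * \<omega>')) (q k' (s * \<omega>'))" by (auto simp: Q_def)
    \<comment> \<open>The inner product is a constant minus the squared distance to the midpoint, so
      points at equal distance meet the last hypothesis of \<open>interaction_diam\<close>.\<close>
    have form: "(\<sigma> / 2 + s * w) * (\<sigma> - (\<sigma> / 2 + s * w)) + of_int j / l * (of_int \<kappa> / l - of_int j / l) = 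
      \<sigma>\<^sup>2 / 4 + c0\<^sup>2 - (w\<^sup>2 + (of_int j / l - c0)\<^sup>2)" for w and j :: int
    proof -
      have 1: "of_int \<kappa> / l = 2 * c0" by (simp add: c0_def)
      have 2: "(s * w)\<^sup>2 = w\<^sup>2" using s2[OF s] by (simp add: power_mult_distrib)
      have "(\<sigma> / 2 + a) * (\<sigma> - (\<sigma> / 2 + a)) + y * (2 * c0 - y) = \<sigma>\<^sup>2 / 4 + c0\<^sup>2 - (a\<^sup>2 + (y - c0)\<^sup>2)" for a y
        by (simp add: power2_eq_square field_simps)
      from this[of "s * w" "of_int j / l"] show ?thesis unfolding 1 2 .
    qed
    have "\<bar>(\<sigma> / 2 + s * \<omega>) - (\<sigma> / 2 + s * \<omega>')\<bar> \<le> 200 * (c2\<^sup>2 / c1) * \<theta> * N \<and> 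
        \<bar>of_int k / l - of_int k' / l\<bar> \<le> 200 * (c2\<^sup>2 / c1) * \<theta> * N"
    proof (rule interaction_diam[OF c th])
      show "interaction c1 c2 N K \<theta> i (\<sigma> / 2 + s * \<omega>, of_int k / l) (\<sigma> - (\<sigma> / 2 + s * \<omega>), of_int \<kappa> / l - of_int k / l)"
        using I unfolding pq unfolding p_def .
      show "interaction c1 c2 N K \<theta> i (\<sigma> / 2 + s * \<omega>', of_int k' / l) (\<sigma> - (\<sigma> / 2 + s * \<omega>'), of_int \<kappa> / l - of_int k' / l)"
        using I' unfolding pq unfolding p_def .
    qed (simp only: form eq)
    moreover have "(\<sigma> / 2 + s * \<omega>) - (\<sigma> / 2 + s * \<omega>') = s * (\<omega> - \<omega>')" by (simp add: algebra_simps)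
    ultimately show "\<bar>\<omega> - \<omega>'\<bar> \<le> D \<and> \<bar>of_int k / l - c0 - (of_int k' / l - c0)\<bar> \<le> D"
      using s2[OF s] by (simp add: D_def abs_mult)
  qed (use l r D in auto)
  define I where "I k \<omega> = of_bool (interaction c1 c2 N K \<theta> i (p k \<omega>) (q k \<omega>)) * 
        ennreal (gauss 1 (T - ((norm (p k \<omega>))\<^sup>2 + (norm (q k \<omega>))\<^sup>2)))" for k \<omega>
  define J where "J s k \<omega> = of_bool (Q s k \<omega>) * ennreal (gauss 1 (T0 - 2 * (\<omega>\<^sup>2 + (v k)\<^sup>2)))" for s k \<omega>
  have [measurable]: "J s k \<in> borel_measurable borel" for s k unfolding J_def Q_def by measurable
  have split: "(\<integral>\<^sup>+\<omega>. I k \<omega> \<partial>lborel) \<le> (\<integral>\<^sup>+\<omega>. J 1 k \<omega> \<partial>lborel) + (\<integral>\<^sup>+\<omega>. J (-1) k \<omega> \<partial>lborel)" for k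
  proof -
    have "(\<integral>\<^sup>+\<omega>. I k \<omega> \<partial>lborel) \<le> (\<integral>\<^sup>+\<omega>. J 1 k \<omega> + J (-1) k (0 + - 1 * \<omega>) \<partial>lborel)"
    proof (rule nn_integral_mono)
      fix \<omega> :: real
      have G: "gauss 1 (T - ((norm (p k \<omega>))\<^sup>2 + (norm (q k \<omega>))\<^sup>2)) = gauss 1 (T0 - 2 * (\<omega>\<^sup>2 + (v k)\<^sup>2))"
        unfolding nrm T0_def by (simp add: algebra_simps)
      have "interaction c1 c2 N K \<theta> i (p k \<omega>) (q k \<omega>) \<Longrightarrow> Q 1 k \<omega> \<or> Q (-1) k (- \<omega>)"
        by (auto simp: Q_def interaction_def p_def q_def abs_if split: if_splits)
      then show "I k \<omega> \<le> J 1 k \<omega> + J (-1) k (0 + - 1 * \<omega>)"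
        unfolding I_def J_def G by (auto simp: of_bool_def)
    qed
    also have "\<dots> = (\<integral>\<^sup>+\<omega>. J 1 k \<omega> \<partial>lborel) + (\<integral>\<^sup>+\<omega>. J (-1) k (0 + - 1 * \<omega>) \<partial>lborel)"
      by (rule nn_integral_add) auto
    also have "(\<integral>\<^sup>+\<omega>. J (-1) k (0 + - 1 * \<omega>) \<partial>lborel) = (\<integral>\<^sup>+\<omega>. J (-1) k \<omega> \<partial>lborel)"
      using nn_integral_real_affine[of "J (-1) k" "-1" 0] by simp
    finally show ?thesis .
  qed
  have "(\<integral>\<^sup>+k. ennreal (1 / l) * (\<integral>\<^sup>+\<omega>. I k \<omega> \<partial>lborel) \<partial>count_space UNIV) \<le>
     (\<integral>\<^sup>+k. ennreal (1 / l) * (\<integral>\<^sup>+\<omega>. J 1 k \<omega> \<partial>lborel) + ennreal (1 / l) * (\<integral>\<^sup>+\<omega>. J (-1) k \<omega> \<partial>lborel) \<partial>count_space UNIV)"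
    by (intro nn_integral_mono) (metis distrib_left mult_left_mono split zero_le)
  also have "\<dots> = (\<integral>\<^sup>+k. ennreal (1 / l) * (\<integral>\<^sup>+\<omega>. J 1 k \<omega> \<partial>lborel) \<partial>count_space UNIV) +
      (\<integral>\<^sup>+k. ennreal (1 / l) * (\<integral>\<^sup>+\<omega>. J (-1) k \<omega> \<partial>lborel) \<partial>count_space UNIV)"
    by (rule nn_integral_add) auto
  also have "\<dots> \<le> ennreal (sqrt (2 * pi) * ((6 * D / r + 4 / (l * (K / 2))) / 4)) + ennreal (sqrt (2 * pi) * ((6 * D / r + 4 / (l * (K / 2))) / 4))"
    using Qs[of 1] Qs[of "-1"] unfolding J_def by (intro add_mono) auto
  also have "\<dots> = ennreal (sqrt (2 * pi) * ((6 * D / r + 4 / (l * (K / 2))) / 2))"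
    using D r l K by (subst ennreal_plus[symmetric]) (auto intro!: mult_nonneg_nonneg add_nonneg_nonneg divide_nonneg_nonneg)
  also have "(6 * D / r + 4 / (l * (K / 2))) / 2 = 2400 * c2\<^sup>2 / c1\<^sup>2 * \<theta> + 4 / (l * K)"
    using c l K by (simp add: D_def r_def field_simps power2_eq_square)
  finally show ?thesis unfolding I_def .
qed

subsection \<open>The space-time kernel\<close>

lemma integrable_restrict_bounded:
  fixes f :: "real \<Rightarrow> complex"
  assumes [measurable]: "f \<in> borel_measurable borel" and "\<And>y. cmod (f y) \<le> B"
  shows "integrable (restrict_space lborel {a..<b}) f"
proof -
  have "finite_measure (restrict_space lborel {a..<b :: real})"
    by (rule finite_measureI) (cases "a \<le> b"; simp add: emeasure_restrict_space space_restrict_space emeasure_lborel_Ico)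
  then show ?thesis
    by (rule finite_measure.integrable_const_bound[where B = B]) (use assms in \<open>auto intro: measurable_restrict_space1\<close>)
qed

lemma integral_exp_period:
  assumes l: "0 < l"
  shows "(\<integral>y. exp (\<i> * of_real (y * (of_int n / l))) \<partial>restrict_space lborel {0..<2 * pi * l})
    = complex_of_real (2 * pi * l * of_bool (n = 0))"
proof -
  have "(\<integral>y. exp (\<i> * of_real (y * (of_int n / l))) \<partial>restrict_space lborel {0..<2 * pi * l}) = 
    (\<integral>y. indicator {0..<2 * pi * l} y *\<^sub>R exp (\<i> * of_real (y * (of_int n / l))) \<partial>lborel)"
    by (subst integral_restrict_space) auto
  \<comment> \<open>The null endpoint is added because the fundamental theorem of calculus is
    applied on a closed interval.\<close>
  also have "\<dots> = (\<integral>y. indicator {0..2 * pi * l} y *\<^sub>R exp (\<i> * of_real (y * (of_int n / l))) \<partial>lborel)"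
  proof (rule integral_cong_AE)
    show "AE y in lborel. indicator {0..<2 * pi * l} y *\<^sub>R exp (\<i> * of_real (y * (of_int n / l))) = 
      indicator {0..2 * pi * l} y *\<^sub>R exp (\<i> * complex_of_real (y * (of_int n / l)))"
      using AE_lborel_singleton[of "2 * pi * l"] by eventually_elim (auto simp: indicator_def)
  qed auto
  also have "\<dots> = complex_of_real (2 * pi * l * of_bool (n = 0))"
  proof (cases "n = 0")
    case True
    then show ?thesis using l by simp (simp add: scaleR_conv_of_real)
  next
    case False
    define F where "F y = exp (\<i> * of_real (y * (of_int n / l))) / (\<i> * of_real (of_int n / l))" for y :: real
    have "(\<integral>y. indicator {0..2 * pi * l} y *\<^sub>R exp (\<i> * of_real (y * (of_int n / l))) \<partial>lborel) = F (2 * pi * l) - F 0"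
    proof (rule integral_FTC_Icc)
      fix y assume "0 \<le> y" "y \<le> 2 * pi * l"
      have "(F has_vector_derivative exp (\<i> * of_real (y * (of_int n / l)))) (at y)"
        unfolding F_def using False l
        by (auto intro!: derivative_eq_intros has_vector_derivative_real_field simp: field_simps of_real_mult)
      then show "(F has_vector_derivative exp (\<i> * of_real (y * (of_int n / l)))) (at y within {0..2 * pi * l})"
        by (rule has_vector_derivative_at_within)
    qed (use l in \<open>auto intro!: continuous_intros\<close>)
    moreover have "exp (\<i> * of_real (2 * pi * l * (of_int n / l))) = 1"
    proof -
      have "\<i> * complex_of_real (2 * pi * l * (of_int n / l)) = of_real (2 * of_int n * pi) * \<i>" using l by simp
      then show ?thesis using exp_integer_2pi[OF Ints_of_int[of n]] by (simp only:)
    qed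
    ultimately show ?thesis using False by (simp add: F_def)
  qed
  finally show ?thesis .
qed

section \<open>The exponential of the bilinear form and its weighted kernel\<close>

lemma fst_pair_freq_measurable [measurable]: "fst \<in> borel_measurable (freq l \<Otimes>\<^sub>M M)"
  using measurable_compose[OF measurable_fst id_freq_measurable] by simp

lemma snd_pair_freq_measurable [measurable]: "snd \<in> borel_measurable (M \<Otimes>\<^sub>M freq l)"
  using measurable_compose[OF measurable_snd id_freq_measurable] by simp

lemma snd_pair_cyl_measurable [measurable]: "snd \<in> borel_measurable (M \<Otimes>\<^sub>M cyl l)"
  using measurable_compose[OF measurable_snd id_cyl_measurable] by simp

text \<open>The exponential of \<open>bilin\<close> with time and position packed into one argument
  and the frequency pair into the other, the shape that \<open>TTstar_bound\<close> expects.\<close>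

definition phase :: "real \<times> (real \<times> real) \<Rightarrow> (real \<times> real) \<times> (real \<times> real) \<Rightarrow> complex" where
  "phase z \<xi> = exp (- \<i> * of_real (fst z * ((norm (fst \<xi>))\<^sup>2 + (norm (snd \<xi>))\<^sup>2)) 
      - \<i> * of_real (snd z \<bullet> (fst \<xi> + snd \<xi>)))"

lemma norm_phase: "cmod (phase z \<xi>) = 1"
  by (simp add: phase_def)

lemma phase_measurable [measurable (raw)]:
  assumes [measurable]: "f \<in> borel_measurable M" "x \<in> borel_measurable M" "g \<in> borel_measurable M" "h \<in> borel_measurable M"
  shows "(\<lambda>w. phase (f w, x w) (g w, h w)) \<in> borel_measurable M"
  unfolding phase_def fst_conv snd_conv by measurable

lemma phase_joint_measurable:
  assumes [measurable]: "(\<lambda>t. t) \<in> borel_measurable T"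
  shows "(\<lambda>(z, \<xi>). phase z \<xi>) \<in> borel_measurable ((T \<Otimes>\<^sub>M cyl l) \<Otimes>\<^sub>M (freq l \<Otimes>\<^sub>M freq l))"
proof -
  have "(\<lambda>w. phase (fst (fst w), snd (fst w)) (fst (snd w), snd (snd w))) \<in>
      borel_measurable ((T \<Otimes>\<^sub>M cyl l) \<Otimes>\<^sub>M (freq l \<Otimes>\<^sub>M freq l))" (is "_ \<in> borel_measurable ?M")
  proof (rule phase_measurable)
    show "(\<lambda>w. fst (fst w)) \<in> borel_measurable ?M"
      using measurable_compose[OF measurable_compose[OF measurable_fst measurable_fst] assms] .
    show "(\<lambda>w. snd (fst w)) \<in> borel_measurable ?M" using measurable_compose[OF measurable_fst snd_pair_cyl_measurable] .
    show "(\<lambda>w. fst (snd w)) \<in> borel_measurable ?M" using measurable_compose[OF measurable_snd fst_pair_freq_measurable] .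
    show "(\<lambda>w. snd (snd w)) \<in> borel_measurable ?M" using measurable_compose[OF measurable_snd snd_pair_freq_measurable] .
  qed
  then show ?thesis by (simp add: case_prod_unfold)
qed

text \<open>The integrand splits into a t-, an x- and a y-factor. The first two give Gaussians in
  the differences of the energies and of the \<mu>-sums; the third vanishes unless the \<eta>-sums
  coincide, because their difference is an integer multiple of 1/l. The prefactor is the product of
  sqrt (2 pi), A sqrt (2 pi) and 2 pi l.\<close>

lemma phase_kernel:
  fixes \<xi> \<zeta> :: "(real \<times> real) \<times> (real \<times> real)" and n :: int
  assumes l: "0 < l" and A: "0 < A" 
    and n: "snd (fst \<zeta>) + snd (snd \<zeta>) - (snd (fst \<xi>) + snd (snd \<xi>)) = of_int n / l"
  shows "(\<integral>z. of_real (gauss 1 (fst z) * gauss A (fst (snd z))) * phase z \<xi> * cnj (phase z \<zeta>) \<partial>(lborel \<Otimes>\<^sub>M cyl l)) =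
    of_real (4 * pi\<^sup>2 * l * A * gauss 1 ((norm (fst \<zeta>))\<^sup>2 + (norm (snd \<zeta>))\<^sup>2 - ((norm (fst \<xi>))\<^sup>2 + (norm (snd \<xi>))\<^sup>2))
      * gauss 1 (A * (fst (fst \<zeta>) + fst (snd \<zeta>) - (fst (fst \<xi>) + fst (snd \<xi>)))) * of_bool (n = 0))"
proof -
  define \<tau> where "\<tau> = (norm (fst \<zeta>))\<^sup>2 + (norm (snd \<zeta>))\<^sup>2 - ((norm (fst \<xi>))\<^sup>2 + (norm (snd \<xi>))\<^sup>2)"
  define \<mu> where "\<mu> = fst (fst \<zeta>) + fst (snd \<zeta>) - (fst (fst \<xi>) + fst (snd \<xi>))"
  define F1 :: "real \<Rightarrow> complex" where "F1 t = of_real (gauss 1 t) * exp (\<i> * of_real (t * \<tau>))" for t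
  define F2 :: "real \<Rightarrow> complex" where "F2 x = of_real (gauss A x) * exp (\<i> * of_real (x * \<mu>))" for x
  define F3 :: "real \<Rightarrow> complex" where "F3 y = exp (\<i> * of_real (y * (of_int n / l)))" for y
  let ?R = "restrict_space lborel {0..<2 * pi * l}"
  have gI: "integrable lborel (\<lambda>x. complex_of_real (gauss a x) * exp (\<i> * of_real (x * c)))" if "0 < a" for a c
    by (rule Bochner_Integration.integrable_bound[OF integrable_gauss[OF that]])
      (auto simp: norm_mult gauss_pos less_imp_le)
  have I: "integrable lborel F1" "integrable lborel F2" "integrable ?R F3"
    unfolding F1_def F2_def F3_def using gI A by (auto intro!: integrable_restrict_bounded[where B=1])
  have R: "sigma_finite_measure ?R" by (rule sigma_finite_restrict_lborel) auto
  note P = integral_product_pair[OF sigma_finite_lborel R I(2,3), folded cyl_def]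
  note P' = integral_product_pair[OF sigma_finite_lborel sigma_finite_cyl I(1) P(1)]
  have "of_real (gauss 1 (fst z) * gauss A (fst (snd z))) * phase z \<xi> * cnj (phase z \<zeta>) = 
     F1 (fst z) * (F2 (fst (snd z)) * F3 (snd (snd z)))" for z
  proof -
    have "phase z \<xi> * cnj (phase z \<zeta>) = exp (\<i> * of_real (fst z * \<tau>)) * (exp (\<i> * of_real (fst (snd z) * \<mu>)) * exp (\<i> * of_real (snd (snd z) * (of_int n / l))))"
      unfolding phase_def exp_cnj mult_exp_exp n[symmetric] \<tau>_def \<mu>_def
      by (rule arg_cong[where f = exp]) (simp add: inner_prod_def algebra_simps)
    then show ?thesis unfolding F1_def F2_def F3_def by (simp add: mult_ac)
  qed
  then have "(\<integral>z. of_real (gauss 1 (fst z) * gauss A (fst (snd z))) * phase z \<xi> * cnj (phase z \<zeta>) \<partial>(lborel \<Otimes>\<^sub>M cyl l)) = 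
      integral\<^sup>L lborel F1 * (integral\<^sup>L lborel F2 * integral\<^sup>L ?R F3)"
    using P'(2) P(2) by simp
  also have "\<dots> = of_real ((1 * sqrt (2 * pi) * gauss 1 (1 * \<tau>)) * ((A * sqrt (2 * pi) * gauss 1 (A * \<mu>)) * (2 * pi * l * of_bool (n = 0))))"
    unfolding F1_def F2_def F3_def using gauss_fourier[of 1 \<tau>] gauss_fourier[OF A, of \<mu>] integral_exp_period[OF l, of n] by simp
  also have "(1 * sqrt (2 * pi) * gauss 1 (1 * \<tau>)) * ((A * sqrt (2 * pi) * gauss 1 (A * \<mu>)) * (2 * pi * l * of_bool (n = 0)))
     = (sqrt (2 * pi) * sqrt (2 * pi)) * (2 * pi * l * A * gauss 1 \<tau> * gauss 1 (A * \<mu>) * of_bool (n = 0))"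
    by (simp add: mult_ac)
  also have "sqrt (2 * pi) * sqrt (2 * pi) = 2 * pi" by simp
  finally show ?thesis unfolding \<tau>_def \<mu>_def by (simp add: power2_eq_square mult_ac)
qed

text \<open>All scales cancel. Prescribing the \<eta>-sum fixes the line of the second frequency and
  leaves a 1/l against the \<open>l\<close> of the kernel; the Gaussian in the \<mu>-sum integrates
  to sqrt (2 pi) / A against the \<open>A\<close>. What remains is the fiber integral, whose bound
  is uniform in the \<mu>-sum. Its factor sqrt (2 pi) and the one just mentioned make 8 pi^3 out of
  4 pi^2.\<close>

lemma interaction_kernel_integral:
  fixes c1 c2 N K \<theta> l \<tau> \<mu> A :: real and \<kappa> :: int and i :: "int \<times> bool"
  assumes c: "0 < c1" "0 < c2" "0 < N" and th: "0 < \<theta>" "\<theta> \<le> 1/10" and l: "0 < l" and K: "0 < K" and A: "0 < A"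
  shows "(\<integral>\<^sup>+\<zeta>. ennreal (4 * pi\<^sup>2 * l * A * gauss 1 (\<tau> - ((norm (fst \<zeta>))\<^sup>2 + (norm (snd \<zeta>))\<^sup>2)) * gauss 1 (A * (fst (fst \<zeta>) + fst (snd \<zeta>) - \<mu>)))
      * of_bool (snd (fst \<zeta>) + snd (snd \<zeta>) = of_int \<kappa> / l) * of_bool (interaction c1 c2 N K \<theta> i (fst \<zeta>) (snd \<zeta>)) \<partial>(freq l \<Otimes>\<^sub>M freq l))
    \<le> ennreal (8 * pi^3 * (2400 * c2\<^sup>2 / c1\<^sup>2 * \<theta> + 4 / (l * K)))"
proof -
  interpret F: sigma_finite_measure "freq l" by (rule sigma_finite_freq[OF l])
  define R :: "real \<times> real \<Rightarrow> real \<times> real \<Rightarrow> ennreal" where 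
    "R a b = ennreal (4 * pi\<^sup>2 * l * A * gauss 1 (\<tau> - ((norm a)\<^sup>2 + (norm b)\<^sup>2)) * gauss 1 (A * (fst a + fst b - \<mu>)))
      * of_bool (interaction c1 c2 N K \<theta> i a b)" for a b
  define S where "S a b = R a b * of_bool (snd a + snd b = of_int \<kappa> / l)" for a b
  have fst' [measurable (raw)]: "(\<lambda>x. fst (f x)) \<in> borel_measurable M" "(\<lambda>x. snd (f x)) \<in> borel_measurable M"
    if [measurable]: "f \<in> borel_measurable M" for f :: "'a \<Rightarrow> real \<times> real" and M
    by (rule borel_measurable_continuous_on[OF _ that]; intro continuous_intros)+
  have R [measurable (raw)]: "(\<lambda>x. R (f x) (g x)) \<in> borel_measurable M" "(\<lambda>x. S (f x) (g x)) \<in> borel_measurable M"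
    if [measurable]: "f \<in> borel_measurable M" "g \<in> borel_measurable M" for f g :: "'a \<Rightarrow> real \<times> real" and M
    unfolding R_def S_def by measurable
  define p where "p \<sigma> k \<omega> = (\<sigma> / 2 + \<omega>, of_int k / l)" for \<sigma> \<omega> :: real and k :: int
  define q where "q \<sigma> k \<omega> = (\<sigma> / 2 - \<omega>, of_int (\<kappa> - k) / l)" for \<sigma> \<omega> :: real and k :: int
  define C where "C = 4 * pi\<^sup>2 * l * A"
  have C: "0 < C" using l A by (simp add: C_def)
  define E where "E = 2400 * c2\<^sup>2 / c1\<^sup>2 * \<theta> + 4 / (l * K)"
  have E: "0 \<le> E" using l K c th by (simp add: E_def)
  have inner: "(\<integral>\<^sup>+b. S (\<mu>1, of_int k / l) b \<partial>freq l) = ennreal (1 / l) * (\<integral>\<^sup>+\<mu>2. R (\<mu>1, of_int k / l) (\<mu>2, of_int (\<kappa> - k) / l) \<partial>lborel)" for \<mu>1 k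
  proof -
    have "(\<integral>\<^sup>+b. S (\<mu>1, of_int k / l) b \<partial>freq l) = 
       (\<integral>\<^sup>+k2. ennreal (1 / l) * (\<integral>\<^sup>+\<mu>2. S (\<mu>1, of_int k / l) (\<mu>2, of_int k2 / l) \<partial>lborel) \<partial>count_space UNIV)"
      by (rule nn_integral_freq[OF l]) measurable
    also have "\<dots> = (\<Sum>k2\<in>{\<kappa> - k}. ennreal (1 / l) * (\<integral>\<^sup>+\<mu>2. S (\<mu>1, of_int k / l) (\<mu>2, of_int k2 / l) \<partial>lborel))"
    proof (rule nn_integral_count_space')
      fix k2 :: int assume "k2 \<notin> {\<kappa> - k}"
      then have "k + k2 \<noteq> \<kappa>" by auto
      then have "real_of_int (k + k2) \<noteq> of_int \<kappa>" by (simp only: of_int_eq_iff not_False_eq_True)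
      then have "of_int k / l + of_int k2 / l \<noteq> of_int \<kappa> / l" using l by (simp add: add_divide_distrib[symmetric])
      then show "ennreal (1 / l) * (\<integral>\<^sup>+\<mu>2. S (\<mu>1, of_int k / l) (\<mu>2, of_int k2 / l) \<partial>lborel) = 0" by (simp add: S_def)
    qed auto
    also have "\<dots> = ennreal (1 / l) * (\<integral>\<^sup>+\<mu>2. R (\<mu>1, of_int k / l) (\<mu>2, of_int (\<kappa> - k) / l) \<partial>lborel)"
      using l by (simp add: S_def add_divide_distrib[symmetric])
    finally show ?thesis .
  qed
  \<comment> \<open>From (\<mu>1, \<mu>2) to the sum s and the offset \<omega> = \<mu>1 - s/2: two
    translations with an exchange of integrals between them, so no Jacobian appears.\<close>
  have change: "(\<integral>\<^sup>+\<mu>1. \<integral>\<^sup>+\<mu>2. R (\<mu>1, of_int k / l) (\<mu>2, of_int (\<kappa> - k) / l) \<partial>lborel \<partial>lborel) = 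
     (\<integral>\<^sup>+s. \<integral>\<^sup>+\<omega>. R (p s k \<omega>) (q s k \<omega>) \<partial>lborel \<partial>lborel)" for k
  proof -
    have "(\<integral>\<^sup>+\<mu>1. \<integral>\<^sup>+\<mu>2. R (\<mu>1, of_int k / l) (\<mu>2, of_int (\<kappa> - k) / l) \<partial>lborel \<partial>lborel) = 
       (\<integral>\<^sup>+\<mu>1. \<integral>\<^sup>+s. R (\<mu>1, of_int k / l) (s - \<mu>1, of_int (\<kappa> - k) / l) \<partial>lborel \<partial>lborel)"
    proof (rule nn_integral_cong)
      fix \<mu>1 :: real
      show "(\<integral>\<^sup>+\<mu>2. R (\<mu>1, of_int k / l) (\<mu>2, of_int (\<kappa> - k) / l) \<partial>lborel) = 
        (\<integral>\<^sup>+s. R (\<mu>1, of_int k / l) (s - \<mu>1, of_int (\<kappa> - k) / l) \<partial>lborel)"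
        using nn_integral_real_affine[of "\<lambda>\<mu>2. R (\<mu>1, of_int k / l) (\<mu>2, of_int (\<kappa> - k) / l)" 1 "- \<mu>1"] by simp
    qed
    also have "\<dots> = (\<integral>\<^sup>+s. \<integral>\<^sup>+\<mu>1. R (\<mu>1, of_int k / l) (s - \<mu>1, of_int (\<kappa> - k) / l) \<partial>lborel \<partial>lborel)"
      by (rule lborel_pair.Fubini') measurable
    also have "\<dots> = (\<integral>\<^sup>+s. \<integral>\<^sup>+\<omega>. R (p s k \<omega>) (q s k \<omega>) \<partial>lborel \<partial>lborel)"
    proof (rule nn_integral_cong)
      fix s :: real
      show "(\<integral>\<^sup>+\<mu>1. R (\<mu>1, of_int k / l) (s - \<mu>1, of_int (\<kappa> - k) / l) \<partial>lborel) = (\<integral>\<^sup>+\<omega>. R (p s k \<omega>) (q s k \<omega>) \<partial>lborel)"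
        using nn_integral_real_affine[of "\<lambda>\<mu>1. R (\<mu>1, of_int k / l) (s - \<mu>1, of_int (\<kappa> - k) / l)" 1 "s / 2"] 
        by (simp add: p_def q_def algebra_simps)
    qed
    finally show ?thesis .
  qed
  define H where "H s k \<omega> = of_bool (interaction c1 c2 N K \<theta> i (p s k \<omega>) (q s k \<omega>)) * 
      ennreal (gauss 1 (\<tau> - ((norm (p s k \<omega>))\<^sup>2 + (norm (q s k \<omega>))\<^sup>2)))" for s k \<omega>
  have pm [measurable]: "(\<lambda>x. p (f x) k (g x)) \<in> borel_measurable M" "(\<lambda>x. q (f x) k (g x)) \<in> borel_measurable M"
    if [measurable]: "f \<in> borel_measurable M" "g \<in> borel_measurable M" for f g :: "'a \<Rightarrow> real" and M k
    unfolding p_def q_def by measurable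
  have Hm [measurable]: "(\<lambda>(s, \<omega>). H s k \<omega>) \<in> borel_measurable (borel \<Otimes>\<^sub>M borel)" "H s k \<in> borel_measurable borel" for k s
    unfolding H_def by measurable
  have RH: "R (p s k \<omega>) (q s k \<omega>) = ennreal (C * gauss 1 (A * (s - \<mu>))) * H s k \<omega>" for s k \<omega>
  proof -
    have "fst (p s k \<omega>) + fst (q s k \<omega>) = s" by (simp add: p_def q_def)
    then show ?thesis unfolding R_def H_def C_def
      using l A gauss_pos[of 1] by (simp add: ennreal_mult[symmetric] less_imp_le mult_ac of_bool_def)
  qed
  have fib: "(\<integral>\<^sup>+k. ennreal (1 / l) * (\<integral>\<^sup>+\<omega>. H s k \<omega> \<partial>lborel) \<partial>count_space UNIV) \<le> ennreal (sqrt (2 * pi) * E)" for s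
    unfolding H_def p_def q_def E_def by (rule fiber_interaction[OF c th l K])
  have "(\<integral>\<^sup>+\<zeta>. S (fst \<zeta>) (snd \<zeta>) \<partial>(freq l \<Otimes>\<^sub>M freq l)) = (\<integral>\<^sup>+a. \<integral>\<^sup>+b. S a b \<partial>freq l \<partial>freq l)"
    by (subst F.nn_integral_fst[symmetric]) auto
  also have "\<dots> = (\<integral>\<^sup>+k. ennreal (1 / l) * (\<integral>\<^sup>+\<mu>1. \<integral>\<^sup>+b. S (\<mu>1, of_int k / l) b \<partial>freq l \<partial>lborel) \<partial>count_space UNIV)"
    by (rule nn_integral_freq[OF l]) measurable
  also have "\<dots> = (\<integral>\<^sup>+k. ennreal (1 / l) * (ennreal (1 / l) * 
      (\<integral>\<^sup>+\<mu>1. \<integral>\<^sup>+\<mu>2. R (\<mu>1, of_int k / l) (\<mu>2, of_int (\<kappa> - k) / l) \<partial>lborel \<partial>lborel)) \<partial>count_space UNIV)"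
    unfolding inner by (intro nn_integral_cong arg_cong2[where f = times] refl nn_integral_cmult) measurable
  also have "\<dots> = (\<integral>\<^sup>+k. \<integral>\<^sup>+s. (ennreal (1 / l) * ennreal (C * gauss 1 (A * (s - \<mu>)))) * (ennreal (1 / l) * (\<integral>\<^sup>+\<omega>. H s k \<omega> \<partial>lborel)) \<partial>lborel \<partial>count_space UNIV)"
  proof (rule nn_integral_cong)
    fix k
    have "(\<integral>\<^sup>+\<mu>1. \<integral>\<^sup>+\<mu>2. R (\<mu>1, of_int k / l) (\<mu>2, of_int (\<kappa> - k) / l) \<partial>lborel \<partial>lborel) = 
        (\<integral>\<^sup>+s. ennreal (C * gauss 1 (A * (s - \<mu>))) * (\<integral>\<^sup>+\<omega>. H s k \<omega> \<partial>lborel) \<partial>lborel)"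
      unfolding change RH by (intro nn_integral_cong nn_integral_cmult) simp
    then have "ennreal (1 / l) * (ennreal (1 / l) * (\<integral>\<^sup>+\<mu>1. \<integral>\<^sup>+\<mu>2. R (\<mu>1, of_int k / l) (\<mu>2, of_int (\<kappa> - k) / l) \<partial>lborel \<partial>lborel)) =
      (\<integral>\<^sup>+s. ennreal (1 / l) * (ennreal (1 / l) * (ennreal (C * gauss 1 (A * (s - \<mu>))) * (\<integral>\<^sup>+\<omega>. H s k \<omega> \<partial>lborel))) \<partial>lborel)"
      by (simp add: nn_integral_cmult)
    then show "ennreal (1 / l) * (ennreal (1 / l) * (\<integral>\<^sup>+\<mu>1. \<integral>\<^sup>+\<mu>2. R (\<mu>1, of_int k / l) (\<mu>2, of_int (\<kappa> - k) / l) \<partial>lborel \<partial>lborel)) =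
      (\<integral>\<^sup>+s. (ennreal (1 / l) * ennreal (C * gauss 1 (A * (s - \<mu>)))) * (ennreal (1 / l) * (\<integral>\<^sup>+\<omega>. H s k \<omega> \<partial>lborel)) \<partial>lborel)"
      by (simp add: mult_ac)
  qed
  also have "\<dots> = (\<integral>\<^sup>+s. \<integral>\<^sup>+k. (ennreal (1 / l) * ennreal (C * gauss 1 (A * (s - \<mu>)))) * (ennreal (1 / l) * (\<integral>\<^sup>+\<omega>. H s k \<omega> \<partial>lborel)) \<partial>count_space UNIV \<partial>lborel)"
    by (rule nn_integral_count_space_nn_integral[symmetric]) auto
  also have "\<dots> = (\<integral>\<^sup>+s. (ennreal (1 / l) * ennreal (C * gauss 1 (A * (s - \<mu>)))) * (\<integral>\<^sup>+k. (ennreal (1 / l) * (\<integral>\<^sup>+\<omega>. H s k \<omega> \<partial>lborel)) \<partial>count_space UNIV) \<partial>lborel)"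
    by (intro nn_integral_cong nn_integral_cmult) simp
  also have "\<dots> \<le> (\<integral>\<^sup>+s. (ennreal (1 / l) * ennreal (C * gauss 1 (A * (s - \<mu>)))) * ennreal (sqrt (2 * pi) * E) \<partial>lborel)"
    by (intro nn_integral_mono mult_left_mono fib) auto
  also have "\<dots> = (\<integral>\<^sup>+s. ennreal (C / l * (sqrt (2 * pi) * E)) * ennreal (gauss 1 (A * (s - \<mu>))) \<partial>lborel)"
    using l C E gauss_pos[of 1] by (intro nn_integral_cong) (simp add: ennreal_mult[symmetric] less_imp_le mult_ac)
  also have "\<dots> = ennreal (C / l * (sqrt (2 * pi) * E)) * (\<integral>\<^sup>+s. ennreal (gauss 1 (A * (s - \<mu>))) \<partial>lborel)"
    by (rule nn_integral_cmult) measurable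
  also have "(\<integral>\<^sup>+s. ennreal (gauss 1 (A * (s - \<mu>))) \<partial>lborel) = ennreal (1 / A * sqrt (2 * pi))"
    by (rule nn_integral_gauss_dilated[OF A])
  also have "ennreal (C / l * (sqrt (2 * pi) * E)) * ennreal (1 / A * sqrt (2 * pi)) = ennreal (C / l * (sqrt (2 * pi) * E) * (1 / A * sqrt (2 * pi)))"
    using C l E A by (intro ennreal_mult[symmetric]) auto
  also have "C / l * (sqrt (2 * pi) * E) * (1 / A * sqrt (2 * pi)) = (4 * pi\<^sup>2) * E * (sqrt (2 * pi) * sqrt (2 * pi))"
    unfolding C_def using l A by (simp add: mult_ac)
  also have "sqrt (2 * pi) * sqrt (2 * pi) = 2 * pi" by simp
  also have "4 * pi\<^sup>2 * E * (2 * pi) = 8 * pi^3 * E" by (simp add: power2_eq_square power3_eq_cube)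
  finally have "(\<integral>\<^sup>+\<zeta>. S (fst \<zeta>) (snd \<zeta>) \<partial>(freq l \<Otimes>\<^sub>M freq l)) \<le> ennreal (8 * pi^3 * E)" .
  then show ?thesis unfolding S_def R_def E_def by (simp only: mult_ac)
qed

lemma integrable_weight:
  assumes "0 < A"
  shows "integrable (lborel \<Otimes>\<^sub>M cyl l) (\<lambda>z. gauss 1 (fst z) * gauss A (fst (snd z)))"
proof -
  have R: "sigma_finite_measure (restrict_space lborel {0..<2 * pi * l})" by (rule sigma_finite_restrict_lborel) auto
  have g: "integrable lborel (\<lambda>x. complex_of_real (gauss a x))" if "0 < a" for a
    using integrable_gauss[OF that] by simp
  have "integrable (restrict_space lborel {0..<2 * pi * l}) (\<lambda>y. 1 :: complex)"
    by (rule integrable_restrict_bounded[where B = 1]) auto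
  note P = integral_product_pair(1)[OF sigma_finite_lborel R g[OF assms] this, folded cyl_def]
  have "integrable (lborel \<Otimes>\<^sub>M cyl l) (\<lambda>z. complex_of_real (gauss 1 (fst z)) * (complex_of_real (gauss A (fst (snd z))) * 1))"
    by (rule integral_product_pair(1)[OF sigma_finite_lborel sigma_finite_cyl g P]) simp
  then have "integrable (lborel \<Otimes>\<^sub>M cyl l) (\<lambda>z. complex_of_real (gauss 1 (fst z) * gauss A (fst (snd z))))"
    by simp
  then show ?thesis unfolding complex_of_real_integrable_eq .
qed

text \<open>The rows over the support of \<open>h\<close> are enlarged to all interacting pairs of
  one sector. The base point enters the row integral only through its energy, \<mu>-sum and
  \<eta>-sum, which are free parameters of \<open>interaction_kernel_integral\<close>; hence the
  bound is uniform.\<close>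

lemma interaction_phase_bound:
  fixes c1 c2 N K \<theta> l A :: real and i :: "int \<times> bool"
  assumes c: "0 < c1" "0 < c2" "0 < N" and th: "0 < \<theta>" "\<theta> \<le> 1/10" and l: "0 < l" and K: "0 < K" and A: "0 < A"
    and h: "integrable (freq l \<Otimes>\<^sub>M freq l) h"
    and supp: "\<And>\<xi>. h \<xi> \<noteq> 0 \<Longrightarrow> interaction c1 c2 N K \<theta> i (fst \<xi>) (snd \<xi>)"
  shows "(\<integral>\<^sup>+z. ennreal (gauss 1 (fst z) * gauss A (fst (snd z)) * (cmod (\<integral>\<xi>. phase z \<xi> * h \<xi> \<partial>(freq l \<Otimes>\<^sub>M freq l)))\<^sup>2)
        \<partial>(lborel \<Otimes>\<^sub>M cyl l))
    \<le> ennreal (8 * pi^3 * (2400 * c2\<^sup>2 / c1\<^sup>2 * \<theta> + 4 / (l * K))) * (\<integral>\<^sup>+\<xi>. ennreal ((cmod (h \<xi>))\<^sup>2) \<partial>(freq l \<Otimes>\<^sub>M freq l))"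
proof -
  define E where "E = 2400 * c2\<^sup>2 / c1\<^sup>2 * \<theta> + 4 / (l * K)"
  define \<tau> where "\<tau> \<xi> = (norm (fst \<xi>))\<^sup>2 + (norm (snd \<xi>))\<^sup>2" for \<xi> :: "(real \<times> real) \<times> (real \<times> real)"
  define \<mu> where "\<mu> \<xi> = fst (fst \<xi>) + fst (snd \<xi>)" for \<xi> :: "(real \<times> real) \<times> (real \<times> real)"
  define \<eta> where "\<eta> \<xi> = snd (fst \<xi>) + snd (snd \<xi>)" for \<xi> :: "(real \<times> real) \<times> (real \<times> real)"
  define \<kappa> where "\<kappa> \<xi> \<zeta> = ennreal (4 * pi\<^sup>2 * l * A * gauss 1 (\<tau> \<xi> - \<tau> \<zeta>) * gauss 1 (A * (\<mu> \<zeta> - \<mu> \<xi>))) * of_bool (\<eta> \<zeta> = \<eta> \<xi>)" for \<xi> \<zeta>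
  have m [measurable]: "\<tau> \<in> borel_measurable (freq l \<Otimes>\<^sub>M freq l)" "\<mu> \<in> borel_measurable (freq l \<Otimes>\<^sub>M freq l)"
    "\<eta> \<in> borel_measurable (freq l \<Otimes>\<^sub>M freq l)"
    unfolding \<tau>_def \<mu>_def \<eta>_def by measurable
  \<comment> \<open>Exact orthogonality in y needs frequencies in the grid, and membership in the
    space of the measure provides this.\<close>
  have grid: "\<exists>n::int. \<eta> \<xi> = of_int n / l" if "\<xi> \<in> space (freq l \<Otimes>\<^sub>M freq l)" for \<xi>
  proof -
    have "snd (fst \<xi>) \<in> range (\<lambda>k::int. of_int k / l)" "snd (snd \<xi>) \<in> range (\<lambda>k::int. of_int k / l)"
      using that by (auto simp: space_pair_measure space_freq)
    then obtain a b :: int where "snd (fst \<xi>) = of_int a / l" "snd (snd \<xi>) = of_int b / l"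
      by (elim rangeE)
    then have "\<eta> \<xi> = of_int (a + b) / l" by (simp add: \<eta>_def add_divide_distrib)
    then show ?thesis ..
  qed
  show ?thesis unfolding E_def[symmetric]
  proof (rule TTstar_bound[where \<kappa> = \<kappa>])
    show "sigma_finite_measure (freq l \<Otimes>\<^sub>M freq l)" "sigma_finite_measure (lborel \<Otimes>\<^sub>M cyl l)"
      by (intro sigma_finite_pair_measure sigma_finite_freq l sigma_finite_lborel sigma_finite_cyl)+
    show "(\<lambda>(z, \<xi>). phase z \<xi>) \<in> borel_measurable ((lborel \<Otimes>\<^sub>M cyl l) \<Otimes>\<^sub>M (freq l \<Otimes>\<^sub>M freq l))"
      by (rule phase_joint_measurable) simp
    show "integrable (lborel \<Otimes>\<^sub>M cyl l) (\<lambda>z. gauss 1 (fst z) * gauss A (fst (snd z)))"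
      by (rule integrable_weight[OF A])
    show "0 \<le> gauss 1 (fst z) * gauss A (fst (snd z))" for z :: "real \<times> (real \<times> real)"
      using gauss_pos[of 1 "fst z"] gauss_pos[of A "fst (snd z)"] by simp
    show "cmod (phase z \<xi>) = 1" for z \<xi> by (rule norm_phase)
    show "integrable (freq l \<Otimes>\<^sub>M freq l) h" by fact
    show "(\<lambda>(x, x'). \<kappa> x x') \<in> borel_measurable ((freq l \<Otimes>\<^sub>M freq l) \<Otimes>\<^sub>M (freq l \<Otimes>\<^sub>M freq l))"
      unfolding \<kappa>_def by measurable
  next
    fix \<xi> \<zeta> assume s: "\<xi> \<in> space (freq l \<Otimes>\<^sub>M freq l)" "\<zeta> \<in> space (freq l \<Otimes>\<^sub>M freq l)"
    show "\<kappa> \<xi> \<zeta> = \<kappa> \<zeta> \<xi>"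
      unfolding \<kappa>_def using gauss_minus[of 1 "\<tau> \<xi> - \<tau> \<zeta>"] gauss_minus[of 1 "A * (\<mu> \<xi> - \<mu> \<zeta>)"]
      by (simp add: eq_commute right_diff_distrib)
    from grid[OF s(1)] grid[OF s(2)] obtain a b :: int where ab: "\<eta> \<xi> = of_int a / l" "\<eta> \<zeta> = of_int b / l" by blast
    have eq: "b - a = 0 \<longleftrightarrow> \<eta> \<zeta> = \<eta> \<xi>" unfolding ab using l by simp
    have "snd (fst \<zeta>) + snd (snd \<zeta>) - (snd (fst \<xi>) + snd (snd \<xi>)) = of_int (b - a) / l"
      using ab by (simp add: \<eta>_def diff_divide_distrib)
    note k = phase_kernel[OF l A this, folded \<tau>_def \<mu>_def, unfolded eq]
    show "ennreal (cmod (\<integral>z. of_real (gauss 1 (fst z) * gauss A (fst (snd z))) * phase z \<xi> * cnj (phase z \<zeta>) \<partial>(lborel \<Otimes>\<^sub>M cyl l))) \<le> \<kappa> \<xi> \<zeta>"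
      unfolding k norm_of_real \<kappa>_def using gauss_minus[of 1 "\<tau> \<xi> - \<tau> \<zeta>"] l A gauss_pos[of 1]
      by (simp add: abs_mult less_imp_le of_bool_def)
  next
    fix \<xi> assume s: "\<xi> \<in> space (freq l \<Otimes>\<^sub>M freq l)"
    from grid[OF s] obtain a :: int where a: "\<eta> \<xi> = of_int a / l" by blast
    have "(\<integral>\<^sup>+\<zeta>. \<kappa> \<xi> \<zeta> * of_bool (h \<zeta> \<noteq> 0) \<partial>(freq l \<Otimes>\<^sub>M freq l)) \<le> 
       (\<integral>\<^sup>+\<zeta>. \<kappa> \<xi> \<zeta> * of_bool (interaction c1 c2 N K \<theta> i (fst \<zeta>) (snd \<zeta>)) \<partial>(freq l \<Otimes>\<^sub>M freq l))"
      using supp by (intro nn_integral_mono mult_left_mono) (auto simp: of_bool_def)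
    also have "\<dots> \<le> ennreal (8 * pi^3 * E)"
      using interaction_kernel_integral[OF c th l K A, of "\<tau> \<xi>" "\<mu> \<xi>" a i, folded \<tau>_def \<mu>_def \<eta>_def E_def, folded a]
      unfolding \<kappa>_def .
    finally show "(\<integral>\<^sup>+\<zeta>. \<kappa> \<xi> \<zeta> * of_bool (h \<zeta> \<noteq> 0) \<partial>(freq l \<Otimes>\<^sub>M freq l)) \<le> ennreal (8 * pi^3 * E)" .
  qed
qed

subsection \<open>The Plancherel bound\<close>

text \<open>Each k with |k| <= n equals j - j' for every j in [n, 2n), with j' = j - k in [0, 3n):
  at least n representations. The sum over frequencies can thus be exchanged for one over pairs,
  whose kernel is a squared modulus.\<close>

lemma sum_differences_ge:
  fixes F :: "int \<Rightarrow> ennreal" and n :: nat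
  shows "of_nat n * (\<Sum>k\<in>{- int n..int n}. F k) \<le> (\<Sum>(j, j')\<in>{..<3 * n} \<times> {..<3 * n}. F (int j - int j'))"
proof -
  have *: "(\<Sum>k\<in>{- int n..int n}. F k) \<le> (\<Sum>j'\<in>{..<3 * n}. F (int j - int j'))" if j: "j \<in> {n..<2 * n}" for j
  proof -
    define r where "r k = nat (int j - k)" for k
    have r: "int j - int (r k) = k" "r k < 3 * n" if "k \<in> {- int n..int n}" for k
      using that j by (auto simp: r_def)
    have "inj_on r {- int n..int n}" by (rule inj_onI) (metis r(1))
    then have "(\<Sum>j'\<in>r ` {- int n..int n}. F (int j - int j')) = (\<Sum>k\<in>{- int n..int n}. F (int j - int (r k)))"
      by (simp add: sum.reindex)
    also have "\<dots> = (\<Sum>k\<in>{- int n..int n}. F k)" using r(1) by (intro sum.cong) auto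
    finally show ?thesis using r(2) by (metis (no_types, lifting) sum_mono2 finite_lessThan image_subset_iff lessThan_iff zero_le)
  qed
  have "of_nat n * (\<Sum>k\<in>{- int n..int n}. F k) = (\<Sum>j\<in>{n..<2 * n}. \<Sum>k\<in>{- int n..int n}. F k)" by simp
  also have "\<dots> \<le> (\<Sum>j\<in>{n..<2 * n}. \<Sum>j'\<in>{..<3 * n}. F (int j - int j'))" by (intro sum_mono *)
  also have "\<dots> \<le> (\<Sum>j\<in>{..<3 * n}. \<Sum>j'\<in>{..<3 * n}. F (int j - int j'))" by (intro sum_mono2) auto
  also have "\<dots> = (\<Sum>(j, j')\<in>{..<3 * n} \<times> {..<3 * n}. F (int j - int j'))" by (rule sum.cartesian_product)
  finally show ?thesis .
qed

text \<open>Summing over pairs \<open>(j, j')\<close> with frequency \<open>(j - j') / l\<close> produces the Fejer kernel, which is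
  nonnegative and hence suited to the Schur test.\<close>

definition dirichlet :: "real \<Rightarrow> nat \<Rightarrow> real \<Rightarrow> complex" where
  "dirichlet l n y = (\<Sum>j<n. exp (\<i> * of_real (y * (real j / l))))"

lemma dirichlet_measurable [measurable]: "dirichlet l n \<in> borel_measurable borel"
  unfolding dirichlet_def by measurable

lemma dirichlet_minus: "dirichlet l n (- y) = cnj (dirichlet l n y)"
  by (simp add: dirichlet_def exp_cnj)

lemma dirichlet_sq:
  "complex_of_real ((cmod (dirichlet l n y))\<^sup>2) = (\<Sum>(j, j')\<in>{..<n} \<times> {..<n}. exp (\<i> * of_real (y * ((real j - real j') / l))))"
proof -
  have "complex_of_real ((cmod (dirichlet l n y))\<^sup>2) = dirichlet l n y * cnj (dirichlet l n y)"
    by (rule complex_norm_square)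
  also have "\<dots> = (\<Sum>j<n. \<Sum>j'<n. exp (\<i> * of_real (y * ((real j - real j') / l))))"
    unfolding dirichlet_def sum_product cnj_sum exp_cnj mult_exp_exp
    by (intro sum.cong refl arg_cong[where f = exp]) (simp add: diff_divide_distrib algebra_simps)
  finally show ?thesis by (simp add: sum.cartesian_product)
qed

text \<open>Only the n diagonal pairs survive over a period; the shift \<open>c\<close> contributes
  unimodular factors. The mass is linear in n, matching the n-fold multiplicity of frequencies in
  \<open>sum_differences_ge\<close>.\<close>

lemma nn_integral_dirichlet:
  assumes l: "0 < l"
  shows "(\<integral>\<^sup>+y. ennreal ((cmod (dirichlet l n (y - c)))\<^sup>2) \<partial>restrict_space lborel {0..<2 * pi * l}) = ennreal (real n * (2 * pi * l))"
proof -
  let ?R = "restrict_space lborel {0..<2 * pi * l}"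
  define g where "g j j' y = exp (- \<i> * of_real (c * ((real j - real j') / l))) * exp (\<i> * of_real (y * (of_int (int j - int j') / l)))" for j j' :: nat and y :: real
  have g: "integrable ?R (g j j')" for j j'
    unfolding g_def by (rule integrable_restrict_bounded[where B = 1]) (auto simp: norm_mult)
  have gi: "(\<integral>y. g j j' y \<partial>?R) = of_real (2 * pi * l * of_bool (j = j'))" for j j'
  proof -
    have "(\<integral>y. g j j' y \<partial>?R) = exp (- \<i> * of_real (c * ((real j - real j') / l))) * of_real (2 * pi * l * of_bool (int j - int j' = 0))"
      unfolding g_def using integral_exp_period[OF l, of "int j - int j'"] by simp
    then show ?thesis by (cases "j = j'") auto
  qed
  have eq: "complex_of_real ((cmod (dirichlet l n (y - c)))\<^sup>2) = (\<Sum>(j, j')\<in>{..<n} \<times> {..<n}. g j j' y)" for y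
    unfolding dirichlet_sq g_def mult_exp_exp case_prod_unfold
    by (intro sum.cong refl arg_cong[where f = exp]) (simp add: left_diff_distrib right_diff_distrib diff_divide_distrib)
  have I: "integrable ?R (\<lambda>y. complex_of_real ((cmod (dirichlet l n (y - c)))\<^sup>2))"
    unfolding eq case_prod_unfold by (intro Bochner_Integration.integrable_sum g)
  have "complex_of_real (\<integral>y. (cmod (dirichlet l n (y - c)))\<^sup>2 \<partial>?R) = (\<integral>y. complex_of_real ((cmod (dirichlet l n (y - c)))\<^sup>2) \<partial>?R)"
    by (rule integral_complex_of_real[symmetric])
  also have "\<dots> = (\<Sum>(j, j')\<in>{..<n} \<times> {..<n}. of_real (2 * pi * l * of_bool (j = j')))"
    unfolding eq case_prod_unfold by (subst Bochner_Integration.integral_sum) (auto simp: g gi)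
  also have "\<dots> = (\<Sum>j<n. \<Sum>j'<n. of_real (2 * pi * l * of_bool (j = j')))" by (simp add: sum.cartesian_product)
  also have "\<dots> = of_real (real n * (2 * pi * l))" by (simp add: of_bool_def if_distrib cong: if_cong)
  finally have "(\<integral>y. (cmod (dirichlet l n (y - c)))\<^sup>2 \<partial>?R) = real n * (2 * pi * l)" by (simp only: of_real_eq_iff)
  moreover have "integrable ?R (\<lambda>y. (cmod (dirichlet l n (y - c)))\<^sup>2)"
    using I unfolding complex_of_real_integrable_eq .
  ultimately show ?thesis by (subst nn_integral_eq_integral) auto
qed

text \<open>The counterpart of \<open>phase_kernel\<close> with frequency integrated out and two
  positions held fixed: a Gaussian in x and an unnormalized Fejer kernel in y.\<close>

lemma frequency_kernel:
  fixes z z' :: "real \<times> real"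
  assumes A: "0 < A" and l: "0 < l"
  defines "e \<equiv> \<lambda>w z. exp (- \<i> * of_real (z \<bullet> (fst w, (real (fst (snd w)) - real (snd (snd w))) / l)))"
  shows "(\<integral>w. of_real (gauss A (fst w)) * e w z * cnj (e w z') \<partial>(lborel \<Otimes>\<^sub>M count_space ({..<n} \<times> {..<n}))) = 
     of_real (A * sqrt (2 * pi) * gauss 1 (A * (fst z' - fst z)) * (cmod (dirichlet l n (snd z' - snd z)))\<^sup>2)"
proof -
  define F1 :: "real \<Rightarrow> complex" where "F1 t = of_real (gauss A t) * exp (\<i> * of_real (t * (fst z' - fst z)))" for t
  define F2 :: "nat \<times> nat \<Rightarrow> complex" where "F2 p = exp (\<i> * of_real ((snd z' - snd z) * ((real (fst p) - real (snd p)) / l)))" for p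
  have "integrable lborel F1" unfolding F1_def
    by (rule Bochner_Integration.integrable_bound[OF integrable_gauss[OF A]])
      (auto simp: norm_mult gauss_pos less_imp_le)
  moreover have "integrable (count_space ({..<n} \<times> {..<n})) F2" by (rule integrable_count_space) auto
  ultimately have P: "(\<integral>w. F1 (fst w) * F2 (snd w) \<partial>(lborel \<Otimes>\<^sub>M count_space ({..<n} \<times> {..<n}))) = 
     integral\<^sup>L lborel F1 * integral\<^sup>L (count_space ({..<n} \<times> {..<n})) F2"
    by (intro integral_product_pair(2) sigma_finite_lborel sigma_finite_measure_count_space_finite) auto
  have "of_real (gauss A (fst w)) * e w z * cnj (e w z') = F1 (fst w) * F2 (snd w)" for w
  proof -
    have "e w z * cnj (e w z') = exp (\<i> * of_real (fst w * (fst z' - fst z))) * F2 (snd w)"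
      unfolding e_def F2_def exp_cnj mult_exp_exp
      by (rule arg_cong[where f = exp]) (simp add: inner_prod_def algebra_simps diff_divide_distrib)
    then show ?thesis by (simp add: F1_def mult.assoc)
  qed
  then have "(\<integral>w. of_real (gauss A (fst w)) * e w z * cnj (e w z') \<partial>(lborel \<Otimes>\<^sub>M count_space ({..<n} \<times> {..<n}))) = 
      integral\<^sup>L lborel F1 * integral\<^sup>L (count_space ({..<n} \<times> {..<n})) F2"
    using P by simp
  also have "integral\<^sup>L lborel F1 = of_real (A * sqrt (2 * pi) * gauss 1 (A * (fst z' - fst z)))"
    unfolding F1_def using gauss_fourier[OF A, of "fst z' - fst z"] by simp
  also have "integral\<^sup>L (count_space ({..<n} \<times> {..<n})) F2 = of_real ((cmod (dirichlet l n (snd z' - snd z)))\<^sup>2)"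
    unfolding dirichlet_sq by (simp add: lebesgue_integral_count_space_finite F2_def case_prod_unfold)
  finally show ?thesis by simp
qed

text \<open>The row integral is the Gaussian mass 2 pi, in which the width has cancelled, times the
  Fejer mass 3 n times 2 pi l. One parameter \<open>n\<close> serves as the width in \<mu> and as
  the order in \<eta>.\<close>

lemma fourier_cutoff_bound:
  fixes f :: "real \<times> real \<Rightarrow> complex" and n :: nat
  assumes l: "0 < l" and f: "integrable (cyl l) f" and n: "0 < n"
  shows "(\<integral>\<^sup>+w. ennreal (gauss (real n) (fst w) * (cmod (\<integral>z. exp (- \<i> * of_real (z \<bullet> (fst w, (real (fst (snd w)) - real (snd (snd w))) / l))) * f z \<partial>cyl l))\<^sup>2)
       \<partial>(lborel \<Otimes>\<^sub>M count_space ({..<3 * n} \<times> {..<3 * n}))) \<le> ennreal (12 * pi\<^sup>2 * l * real n) * (\<integral>\<^sup>+z. ennreal ((cmod (f z))\<^sup>2) \<partial>cyl l)"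
proof -
  define A where "A = real n"
  have A: "0 < A" using n by (simp add: A_def)
  let ?J = "count_space ({..<3 * n} \<times> {..<3 * n})"
  define e where "e w z = exp (- \<i> * of_real (z \<bullet> (fst w, (real (fst (snd w)) - real (snd (snd w))) / l)))" for w :: "real \<times> (nat \<times> nat)" and z
  define \<kappa> where "\<kappa> z z' = ennreal (A * sqrt (2 * pi) * gauss 1 (A * (fst z' - fst z)) * (cmod (dirichlet l (3 * n) (snd z' - snd z)))\<^sup>2)" for z z' :: "real \<times> real"
  interpret J: sigma_finite_measure ?J by (rule sigma_finite_measure_count_space_finite) simp
  have \<kappa>m [measurable]: "(\<lambda>(z, z'). \<kappa> z z') \<in> borel_measurable (cyl l \<Otimes>\<^sub>M cyl l)"
    unfolding \<kappa>_def by measurable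
  show ?thesis unfolding A_def[symmetric] e_def[symmetric]
  proof (rule TTstar_bound[where \<kappa> = \<kappa>])
    show "sigma_finite_measure (cyl l)" "sigma_finite_measure (lborel \<Otimes>\<^sub>M ?J)"
      by (intro sigma_finite_pair_measure sigma_finite_lborel sigma_finite_cyl J.sigma_finite_measure_axioms)+
    have m1: "(\<lambda>p. (real (fst p) - real (snd p)) / l) \<in> borel_measurable ?J" by simp
    have [measurable]: "(\<lambda>w. (real (fst (snd (fst w))) - real (snd (snd (fst w)))) / l) \<in> borel_measurable ((lborel \<Otimes>\<^sub>M ?J) \<Otimes>\<^sub>M cyl l)"
      using measurable_compose[OF measurable_compose[OF measurable_fst measurable_snd] m1] .
    have [measurable]: "(\<lambda>w. fst (fst w)) \<in> borel_measurable ((lborel \<Otimes>\<^sub>M ?J) \<Otimes>\<^sub>M cyl l)" by measurable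
    show "(\<lambda>(w, z). e w z) \<in> borel_measurable ((lborel \<Otimes>\<^sub>M ?J) \<Otimes>\<^sub>M cyl l)"
      unfolding e_def case_prod_unfold by measurable
    show "integrable (lborel \<Otimes>\<^sub>M ?J) (\<lambda>w. gauss A (fst w))"
    proof -
      have 1: "integrable lborel (\<lambda>x. complex_of_real (gauss A x))" using integrable_gauss[OF A] by simp
      have 2: "integrable ?J (\<lambda>_. 1 :: complex)" by (rule integrable_count_space) auto
      have "integrable (lborel \<Otimes>\<^sub>M ?J) (\<lambda>w. complex_of_real (gauss A (fst w)) * 1)"
        by (rule integral_product_pair(1)[OF sigma_finite_lborel J.sigma_finite_measure_axioms 1 2])
      then show ?thesis unfolding mult_1_right complex_of_real_integrable_eq .
    qed
    show "0 \<le> gauss A (fst w)" for w :: "real \<times> (nat \<times> nat)" using gauss_pos[of A "fst w"] by simp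
    show "cmod (e w z) = 1" for w z by (simp add: e_def)
    show "ennreal (cmod (\<integral>w. of_real (gauss A (fst w)) * e w z * cnj (e w z') \<partial>(lborel \<Otimes>\<^sub>M ?J))) \<le> \<kappa> z z'" for z z'
      unfolding e_def frequency_kernel[OF A l] norm_of_real \<kappa>_def using A gauss_pos[of 1]
      by (simp add: abs_mult less_imp_le)
    show "\<kappa> z z' = \<kappa> z' z" for z z'
      unfolding \<kappa>_def using gauss_minus[of 1 "A * (fst z - fst z')"] dirichlet_minus[of l "3 * n" "snd z - snd z'"]
      by (simp add: right_diff_distrib)
    show "(\<integral>\<^sup>+z'. \<kappa> z z' * of_bool (f z' \<noteq> 0) \<partial>cyl l) \<le> ennreal (12 * pi\<^sup>2 * l * A)" for z
    proof -
      have "(\<integral>\<^sup>+z'. \<kappa> z z' * of_bool (f z' \<noteq> 0) \<partial>cyl l) \<le> (\<integral>\<^sup>+z'. \<kappa> z z' \<partial>cyl l)"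
        by (intro nn_integral_mono) (auto simp: of_bool_def)
      also have "\<dots> = (\<integral>\<^sup>+x. \<integral>\<^sup>+y. \<kappa> z (x, y) \<partial>restrict_space lborel {0..<2 * pi * l} \<partial>lborel)"
        unfolding \<kappa>_def by (rule nn_integral_cyl) measurable
      also have "\<dots> = (\<integral>\<^sup>+x. ennreal (A * sqrt (2 * pi)) * ennreal (gauss 1 (A * (x - fst z))) * ennreal (real (3 * n) * (2 * pi * l)) \<partial>lborel)"
      proof (rule nn_integral_cong)
        fix x :: real
        have "(\<integral>\<^sup>+y. \<kappa> z (x, y) \<partial>restrict_space lborel {0..<2 * pi * l}) = 
          (\<integral>\<^sup>+y. ennreal (A * sqrt (2 * pi)) * ennreal (gauss 1 (A * (x - fst z))) * ennreal ((cmod (dirichlet l (3 * n) (y - snd z)))\<^sup>2) \<partial>restrict_space lborel {0..<2 * pi * l})"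
          unfolding \<kappa>_def using A gauss_pos[of 1] by (intro nn_integral_cong) (simp add: ennreal_mult less_imp_le)
        also have "\<dots> = ennreal (A * sqrt (2 * pi)) * ennreal (gauss 1 (A * (x - fst z))) * ennreal (real (3 * n) * (2 * pi * l))"
        proof (subst nn_integral_cmult)
          have "(\<lambda>y. ennreal ((cmod (dirichlet l (3 * n) (y - snd z)))\<^sup>2)) \<in> borel_measurable borel" by measurable
          then show "(\<lambda>y. ennreal ((cmod (dirichlet l (3 * n) (y - snd z)))\<^sup>2)) \<in> borel_measurable (restrict_space lborel {0..<2 * pi * l})"
            by (intro measurable_restrict_space1) simp
        qed (simp only: nn_integral_dirichlet[OF l])
        finally show "(\<integral>\<^sup>+y. \<kappa> z (x, y) \<partial>restrict_space lborel {0..<2 * pi * l}) = \<dots>" .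
      qed
      also have "\<dots> = ennreal (A * sqrt (2 * pi)) * (\<integral>\<^sup>+x. ennreal (gauss 1 (A * (x - fst z))) \<partial>lborel) * ennreal (real (3 * n) * (2 * pi * l))"
        by (simp add: nn_integral_multc nn_integral_cmult)
      also have "(\<integral>\<^sup>+x. ennreal (gauss 1 (A * (x - fst z))) \<partial>lborel) = ennreal (1 / A * sqrt (2 * pi))"
        by (rule nn_integral_gauss_dilated[OF A])
      also have "ennreal (A * sqrt (2 * pi)) * ennreal (1 / A * sqrt (2 * pi)) * ennreal (real (3 * n) * (2 * pi * l)) = 
         ennreal (A * sqrt (2 * pi) * (1 / A * sqrt (2 * pi)) * (real (3 * n) * (2 * pi * l)))"
        using A l by (simp add: ennreal_mult[symmetric])
      also have "A * sqrt (2 * pi) * (1 / A * sqrt (2 * pi)) * (real (3 * n) * (2 * pi * l)) = 12 * pi\<^sup>2 * l * A"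
      proof -
        have "A * sqrt (2 * pi) * (1 / A * sqrt (2 * pi)) = sqrt (2 * pi) * sqrt (2 * pi)" using A by (simp add: mult_ac)
        also have "\<dots> = 2 * pi" by simp
        finally show ?thesis by (simp add: A_def power2_eq_square)
      qed
      finally show ?thesis .
    qed
  qed (use f in auto)
qed

lemma fourier_measurable:
  assumes "integrable (cyl l) f"
  shows "fourier l f \<in> borel_measurable (freq l)"
proof -
  interpret C: sigma_finite_measure "cyl l" by (rule sigma_finite_cyl)
  note [measurable] = borel_measurable_integrable[OF assms]
  show ?thesis unfolding fourier_def by measurable
qed

text \<open>The loss 6 against the exact identity is 2 times 3: the Gaussian is only known to be at
  least 1/2 on |\<mu>| <= n, and n representations of each frequency are paid for with the kernel
  mass of 3 n indices. The factors 4 pi^2 l cancel against the normalizations of the transform and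
  of the measure.\<close>

lemma fourier_L2_bound:
  fixes f :: "real \<times> real \<Rightarrow> complex"
  assumes l: "0 < l" and f: "integrable (cyl l) f"
  shows "(\<integral>\<^sup>+\<xi>. ennreal ((cmod (fourier l f \<xi>))\<^sup>2) \<partial>freq l) \<le> ennreal 6 * (\<integral>\<^sup>+z. ennreal ((cmod (f z))\<^sup>2) \<partial>cyl l)"
proof -
  interpret C: sigma_finite_measure "cyl l" by (rule sigma_finite_cyl)
  note [measurable] = borel_measurable_integrable[OF f] fourier_measurable[OF f]
  define X where "X = (\<integral>\<^sup>+z. ennreal ((cmod (f z))\<^sup>2) \<partial>cyl l)"
  define G where "G \<mu> \<eta> = (\<integral>z. exp (- \<i> * of_real (z \<bullet> (\<mu>, \<eta>))) * f z \<partial>cyl l)" for \<mu> \<eta>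
  have fG: "fourier l f (\<mu>, \<eta>) = of_real (1 / (2 * pi)) * G \<mu> \<eta>" for \<mu> \<eta>
    by (simp add: fourier_def G_def mult.commute[of "f _"])
  have Gm [measurable (raw)]: "(\<lambda>x. G (u x) (v x)) \<in> borel_measurable M" if [measurable]: "u \<in> borel_measurable M" "v \<in> borel_measurable M" for u v and M :: "'b measure"
    unfolding G_def by measurable
  \<comment> \<open>The cutoff to |\<mu>| <= n and |k| <= n is the region seen by the weighted sum
    of order n; monotone convergence removes it.\<close>
  define S where "S n \<xi> = ennreal ((cmod (fourier l f \<xi>))\<^sup>2) * of_bool (\<bar>fst \<xi>\<bar> \<le> real n \<and> \<bar>snd \<xi>\<bar> * l \<le> real n)" for n \<xi>
  have Sm [measurable]: "S n \<in> borel_measurable (freq l)" for n unfolding S_def by measurable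
  have bound: "(\<integral>\<^sup>+\<xi>. S n \<xi> \<partial>freq l) \<le> ennreal 6 * X" if n: "0 < n" for n
  proof -
    let ?J = "count_space ({..<3 * n} \<times> {..<3 * n})"
    interpret J: sigma_finite_measure ?J by (rule sigma_finite_measure_count_space_finite) simp
    define H where "H \<mu> k = ennreal ((cmod (G \<mu> (of_int k / l)))\<^sup>2) * of_bool (\<bar>\<mu>\<bar> \<le> real n)" for \<mu> and k :: int
    have Hm [measurable]: "(\<lambda>\<mu>. H \<mu> k) \<in> borel_measurable borel" for k unfolding H_def by measurable
    have fst1: "(\<integral>\<^sup>+\<xi>. S n \<xi> \<partial>freq l) = ennreal (1 / (4 * pi\<^sup>2 * l)) * (\<integral>\<^sup>+\<mu>. (\<Sum>k\<in>{- int n..int n}. H \<mu> k) \<partial>lborel)"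
    proof -
      have "(\<integral>\<^sup>+\<xi>. S n \<xi> \<partial>freq l) = (\<integral>\<^sup>+k. ennreal (1 / l) * (\<integral>\<^sup>+\<mu>. S n (\<mu>, of_int k / l) \<partial>lborel) \<partial>count_space UNIV)"
        by (rule nn_integral_freq[OF l]) simp
      also have "\<dots> = (\<Sum>k\<in>{- int n..int n}. ennreal (1 / l) * (\<integral>\<^sup>+\<mu>. S n (\<mu>, of_int k / l) \<partial>lborel))"
      proof (rule nn_integral_count_space')
        fix k :: int assume "k \<notin> {- int n..int n}"
        then have "\<not> \<bar>real_of_int k\<bar> \<le> real n" by auto
        then show "ennreal (1 / l) * (\<integral>\<^sup>+\<mu>. S n (\<mu>, of_int k / l) \<partial>lborel) = 0" using l by (simp add: S_def)
      qed auto
      also have "\<dots> = (\<Sum>k\<in>{- int n..int n}. ennreal (1 / (4 * pi\<^sup>2 * l)) * (\<integral>\<^sup>+\<mu>. H \<mu> k \<partial>lborel))"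
      proof (rule sum.cong[OF refl])
        fix k assume k: "k \<in> {- int n..int n}"
        have "S n (\<mu>, of_int k / l) = ennreal (1 / (4 * pi\<^sup>2)) * H \<mu> k" for \<mu>
        proof -
          have "\<bar>real_of_int k\<bar> \<le> real n" using k by auto
          moreover have "(cmod (fourier l f (\<mu>, of_int k / l)))\<^sup>2 = 1 / (4 * pi\<^sup>2) * (cmod (G \<mu> (of_int k / l)))\<^sup>2"
            unfolding fG by (simp add: norm_mult norm_divide power_mult_distrib power_divide)
          ultimately show ?thesis using l by (simp add: S_def H_def ennreal_mult[symmetric] of_bool_def)
        qed
        then have "(\<integral>\<^sup>+\<mu>. S n (\<mu>, of_int k / l) \<partial>lborel) = ennreal (1 / (4 * pi\<^sup>2)) * (\<integral>\<^sup>+\<mu>. H \<mu> k \<partial>lborel)"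
          by (simp add: nn_integral_cmult)
        then have "ennreal (1 / l) * (\<integral>\<^sup>+\<mu>. S n (\<mu>, of_int k / l) \<partial>lborel) = (ennreal (1 / l) * ennreal (1 / (4 * pi\<^sup>2))) * (\<integral>\<^sup>+\<mu>. H \<mu> k \<partial>lborel)"
          by (simp add: mult.assoc)
        also have "ennreal (1 / l) * ennreal (1 / (4 * pi\<^sup>2)) = ennreal (1 / (4 * pi\<^sup>2 * l))"
          using l by (subst ennreal_mult[symmetric]) (auto simp: mult.commute)
        finally show "ennreal (1 / l) * (\<integral>\<^sup>+\<mu>. S n (\<mu>, of_int k / l) \<partial>lborel) = ennreal (1 / (4 * pi\<^sup>2 * l)) * (\<integral>\<^sup>+\<mu>. H \<mu> k \<partial>lborel)" .
      qed
      finally show ?thesis by (simp add: sum_distrib_left[symmetric] nn_integral_sum)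
    qed
    \<comment> \<open>n / 2 is the n-fold multiplicity of a frequency times the lower bound 1/2 of
      the Gaussian.\<close>
    have "ennreal (real n / 2) * (\<integral>\<^sup>+\<mu>. (\<Sum>k\<in>{- int n..int n}. H \<mu> k) \<partial>lborel) = 
      (\<integral>\<^sup>+\<mu>. of_nat n * (\<Sum>k\<in>{- int n..int n}. ennreal (1 / 2) * H \<mu> k) \<partial>lborel)"
    proof -
      have "ennreal (real n / 2) = of_nat n * ennreal (1 / 2)"
        unfolding ennreal_of_nat_eq_real_of_nat by (subst ennreal_mult[symmetric]) auto
      then show ?thesis by (simp add: sum_distrib_left[symmetric] nn_integral_cmult[symmetric] mult.assoc del: ennreal_half)
    qed
    also have "\<dots> \<le> (\<integral>\<^sup>+\<mu>. \<integral>\<^sup>+p. ennreal (gauss (real n) \<mu> * (cmod (G \<mu> ((real (fst p) - real (snd p)) / l)))\<^sup>2) \<partial>?J \<partial>lborel)"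
    proof (rule nn_integral_mono)
      fix \<mu> :: real
      define F where "F k = ennreal (gauss (real n) \<mu> * (cmod (G \<mu> (of_int k / l)))\<^sup>2)" for k :: int
      have "ennreal (1 / 2) * H \<mu> k \<le> F k" for k
      proof (cases "\<bar>\<mu>\<bar> \<le> real n")
        case True
        then have "1 / 2 \<le> gauss (real n) \<mu>" using gauss_ge[of "real n" \<mu>] n by simp
        then have "ennreal (1 / 2 * (cmod (G \<mu> (of_int k / l)))\<^sup>2) \<le> F k"
          unfolding F_def by (intro ennreal_leI mult_right_mono) auto
        then show ?thesis using True by (simp add: H_def ennreal_mult[symmetric] del: ennreal_half)
      qed (simp add: H_def)
      then have "of_nat n * (\<Sum>k\<in>{- int n..int n}. ennreal (1 / 2) * H \<mu> k) \<le> of_nat n * (\<Sum>k\<in>{- int n..int n}. F k)"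
        by (intro mult_left_mono sum_mono) auto
      also have "\<dots> \<le> (\<Sum>(j, j')\<in>{..<3 * n} \<times> {..<3 * n}. F (int j - int j'))" by (rule sum_differences_ge)
      also have "\<dots> = (\<integral>\<^sup>+p. ennreal (gauss (real n) \<mu> * (cmod (G \<mu> ((real (fst p) - real (snd p)) / l)))\<^sup>2) \<partial>?J)"
        by (simp add: nn_integral_count_space_finite F_def case_prod_unfold)
      finally show "of_nat n * (\<Sum>k\<in>{- int n..int n}. ennreal (1 / 2) * H \<mu> k) \<le> \<dots>" .
    qed
    also have "\<dots> = (\<integral>\<^sup>+w. ennreal (gauss (real n) (fst w) * (cmod (G (fst w) ((real (fst (snd w)) - real (snd (snd w))) / l)))\<^sup>2) \<partial>(lborel \<Otimes>\<^sub>M ?J))"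
    proof -
      have m1: "(\<lambda>p. (real (fst p) - real (snd p)) / l) \<in> borel_measurable ?J" by simp
      have [measurable]: "(\<lambda>w. (real (fst (snd w)) - real (snd (snd w))) / l) \<in> borel_measurable (lborel \<Otimes>\<^sub>M ?J)"
        using measurable_compose[OF measurable_snd m1] .
      have "(\<lambda>w. ennreal (gauss (real n) (fst w) * (cmod (G (fst w) ((real (fst (snd w)) - real (snd (snd w))) / l)))\<^sup>2)) \<in> borel_measurable (lborel \<Otimes>\<^sub>M ?J)"
        by measurable
      from J.nn_integral_fst[OF this] show ?thesis by simp
    qed
    also have "\<dots> \<le> ennreal (12 * pi\<^sup>2 * l * real n) * X"
      unfolding G_def X_def by (rule fourier_cutoff_bound[OF l f n])
    finally have *: "ennreal (real n / 2) * (\<integral>\<^sup>+\<mu>. (\<Sum>k\<in>{- int n..int n}. H \<mu> k) \<partial>lborel) \<le> ennreal (12 * pi\<^sup>2 * l * real n) * X" .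
    have "(\<integral>\<^sup>+\<xi>. S n \<xi> \<partial>freq l) = ennreal (1 / (2 * pi\<^sup>2 * l * real n)) * (ennreal (real n / 2) * (\<integral>\<^sup>+\<mu>. (\<Sum>k\<in>{- int n..int n}. H \<mu> k) \<partial>lborel))"
    proof -
      have "ennreal (1 / (4 * pi\<^sup>2 * l)) = ennreal (1 / (2 * pi\<^sup>2 * l * real n)) * ennreal (real n / 2)"
        using n l by (subst ennreal_mult[symmetric]) (auto simp: field_simps)
      then show ?thesis unfolding fst1 by (simp add: mult.assoc)
    qed
    also have "\<dots> \<le> ennreal (1 / (2 * pi\<^sup>2 * l * real n)) * (ennreal (12 * pi\<^sup>2 * l * real n) * X)"
      by (intro mult_left_mono *) simp
    also have "\<dots> = ennreal (1 / (2 * pi\<^sup>2 * l * real n) * (12 * pi\<^sup>2 * l * real n)) * X"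
      using l by (subst ennreal_mult) (auto simp: mult.assoc)
    also have "1 / (2 * pi\<^sup>2 * l * real n) * (12 * pi\<^sup>2 * l * real n) = 6" using n l by simp
    finally show ?thesis .
  qed
  have inc: "incseq S"
    unfolding incseq_def le_fun_def S_def by (auto simp: of_bool_def intro: order_trans)
  have sup: "(SUP n. S n \<xi>) = ennreal ((cmod (fourier l f \<xi>))\<^sup>2)" for \<xi>
  proof (rule antisym)
    show "(SUP n. S n \<xi>) \<le> ennreal ((cmod (fourier l f \<xi>))\<^sup>2)"
      by (intro SUP_least) (auto simp: S_def of_bool_def)
    obtain n :: nat where "max \<bar>fst \<xi>\<bar> (\<bar>snd \<xi>\<bar> * l) \<le> real n" using real_arch_simple by blast
    then have "S n \<xi> = ennreal ((cmod (fourier l f \<xi>))\<^sup>2)" by (simp add: S_def)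
    then show "ennreal ((cmod (fourier l f \<xi>))\<^sup>2) \<le> (SUP n. S n \<xi>)" by (metis SUP_upper UNIV_I)
  qed
  have "(\<integral>\<^sup>+\<xi>. ennreal ((cmod (fourier l f \<xi>))\<^sup>2) \<partial>freq l) = (SUP n. \<integral>\<^sup>+\<xi>. S n \<xi> \<partial>freq l)"
    unfolding sup[symmetric] by (rule nn_integral_monotone_convergence_SUP[OF inc]) simp
  also have "\<dots> \<le> ennreal 6 * X"
  proof (rule SUP_least)
    \<comment> \<open>Passing to \<open>Suc n\<close> avoids the cutoff 0, which
      \<open>bound\<close> excludes.\<close>
    fix n
    have "(\<integral>\<^sup>+\<xi>. S n \<xi> \<partial>freq l) \<le> (\<integral>\<^sup>+\<xi>. S (Suc n) \<xi> \<partial>freq l)"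
      using inc by (intro nn_integral_mono) (auto simp: incseq_Suc_iff le_fun_def)
    also have "\<dots> \<le> ennreal 6 * X" by (rule bound) simp
    finally show "(\<integral>\<^sup>+\<xi>. S n \<xi> \<partial>freq l) \<le> ennreal 6 * X" .
  qed
  finally show ?thesis unfolding X_def .
qed

section \<open>The bound for the extended Fourier transform\<close>

lemma integrable_truncation:
  assumes f: "in_L2 (cyl l) f"
  shows "integrable (cyl l) (\<lambda>z. if \<bar>fst z\<bar> \<le> R then f z else 0)"
proof (rule integrableI_bounded)
  have [measurable]: "f \<in> borel_measurable (cyl l)" using f by (simp add: in_L2_def)
  show "(\<lambda>z. if \<bar>fst z\<bar> \<le> R then f z else 0) \<in> borel_measurable (cyl l)" by measurable
  have "(\<integral>\<^sup>+z. ennreal (norm (if \<bar>fst z\<bar> \<le> R then f z else 0)) \<partial>cyl l) \<le> 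
     (\<integral>\<^sup>+z. of_bool (\<bar>fst z\<bar> \<le> R) + ennreal ((cmod (f z))\<^sup>2) \<partial>cyl l)"
  proof (rule nn_integral_mono)
    fix z
    show "ennreal (norm (if \<bar>fst z\<bar> \<le> R then f z else 0)) \<le> of_bool (\<bar>fst z\<bar> \<le> R) + ennreal ((cmod (f z))\<^sup>2)"
      using ennreal_norm_le_1_plus_sq[of "f z"] by auto
  qed
  also have "\<dots> = (\<integral>\<^sup>+z. of_bool (\<bar>fst z\<bar> \<le> R) \<partial>cyl l) + (\<integral>\<^sup>+z. ennreal ((cmod (f z))\<^sup>2) \<partial>cyl l)"
    by (rule nn_integral_add) auto
  also have "(\<integral>\<^sup>+z. of_bool (\<bar>fst z\<bar> \<le> R) \<partial>cyl l) = (\<integral>\<^sup>+x. of_bool (\<bar>x\<bar> \<le> R) * emeasure lborel {0..<2 * pi * l} \<partial>lborel)"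
    by (subst nn_integral_cyl) (auto simp: emeasure_restrict_space space_restrict_space)
  also have "\<dots> = emeasure lborel {- R..R} * emeasure lborel {0..<2 * pi * l}"
  proof -
    have "(\<integral>\<^sup>+x. of_bool (\<bar>x\<bar> \<le> R) \<partial>lborel) = (\<integral>\<^sup>+x. indicator {- R..R} x \<partial>lborel)"
      by (intro nn_integral_cong) (auto simp: indicator_def)
    then show ?thesis by (simp add: nn_integral_multc)
  qed
  also have "\<dots> + (\<integral>\<^sup>+z. ennreal ((cmod (f z))\<^sup>2) \<partial>cyl l) < \<infinity>"
    using f by (cases "- R \<le> R"; cases "0 \<le> 2 * pi * l") (auto simp: in_L2_def integrable_iff_bounded ennreal_mult_less_top)
  finally show "(\<integral>\<^sup>+z. ennreal (norm (if \<bar>fst z\<bar> \<le> R then f z else 0)) \<partial>cyl l) < \<infinity>" .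
qed

text \<open>The bound for the truncations passes to the limit through |g|^2 <= 2 |g - v|^2 + 2
  |v|^2, where v is the transform of a truncation; this doubles 6 to 12.\<close>

lemma has_fourier_L2_bound:
  assumes l: "0 < l" and f: "in_L2 (cyl l) f" and g: "has_fourier_L2 l f g"
  shows "(\<integral>\<xi>. (cmod (g \<xi>))\<^sup>2 \<partial>freq l) \<le> 12 * (\<integral>z. (cmod (f z))\<^sup>2 \<partial>cyl l)"
proof -
  define T where "T R z = (if \<bar>fst z\<bar> \<le> R then f z else 0)" for R z
  have gL: "in_L2 (freq l) g" and lim: "((\<lambda>R::real. \<integral>\<^sup>+ \<xi>. ennreal ((cmod (g \<xi> - fourier l (T R) \<xi>))\<^sup>2) \<partial>freq l) \<longlongrightarrow> 0) at_top"
    using g unfolding has_fourier_L2_def T_def[abs_def] by auto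
  have TI: "integrable (cyl l) (T R)" for R unfolding T_def[abs_def] by (rule integrable_truncation[OF f])
  have [measurable]: "g \<in> borel_measurable (freq l)" "f \<in> borel_measurable (cyl l)" using gL f by (simp_all add: in_L2_def)
  note [measurable] = fourier_measurable[OF TI]
  define X where "X = (\<integral>\<^sup>+z. ennreal ((cmod (f z))\<^sup>2) \<partial>cyl l)"
  have X: "X = ennreal (\<integral>z. (cmod (f z))\<^sup>2 \<partial>cyl l)"
    unfolding X_def using f by (intro nn_integral_eq_integral) (auto simp: in_L2_def)
  have "(\<integral>\<^sup>+\<xi>. ennreal ((cmod (g \<xi>))\<^sup>2) \<partial>freq l) \<le> ennreal (12 * (\<integral>z. (cmod (f z))\<^sup>2 \<partial>cyl l))"
  proof (rule ennreal_le_epsilon)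
    fix e :: real assume e: "0 < e"
    have "eventually (\<lambda>R. (\<integral>\<^sup>+ \<xi>. ennreal ((cmod (g \<xi> - fourier l (T R) \<xi>))\<^sup>2) \<partial>freq l) < ennreal (e / 2)) at_top"
      by (rule order_tendstoD(2)[OF lim]) (use e in auto)
    then obtain R where R: "(\<integral>\<^sup>+ \<xi>. ennreal ((cmod (g \<xi> - fourier l (T R) \<xi>))\<^sup>2) \<partial>freq l) < ennreal (e / 2)"
      by (auto simp: eventually_at_top_linorder)
    have "(\<integral>\<^sup>+\<xi>. ennreal ((cmod (fourier l (T R) \<xi>))\<^sup>2) \<partial>freq l) \<le> ennreal 6 * (\<integral>\<^sup>+z. ennreal ((cmod (T R z))\<^sup>2) \<partial>cyl l)"
      by (rule fourier_L2_bound[OF l TI])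
    also have "\<dots> \<le> ennreal 6 * X"
      unfolding X_def T_def by (intro mult_left_mono nn_integral_mono) auto
    finally have F: "(\<integral>\<^sup>+\<xi>. ennreal ((cmod (fourier l (T R) \<xi>))\<^sup>2) \<partial>freq l) \<le> ennreal 6 * X" .
    have "(\<integral>\<^sup>+\<xi>. ennreal ((cmod (g \<xi>))\<^sup>2) \<partial>freq l) \<le> 
      (\<integral>\<^sup>+\<xi>. ennreal 2 * ennreal ((cmod (g \<xi> - fourier l (T R) \<xi>))\<^sup>2) + ennreal 2 * ennreal ((cmod (fourier l (T R) \<xi>))\<^sup>2) \<partial>freq l)"
    proof (rule nn_integral_mono)
      fix \<xi>
      let ?a = "cmod (g \<xi> - fourier l (T R) \<xi>)" and ?b = "cmod (fourier l (T R) \<xi>)"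
      have "cmod (g \<xi>) \<le> ?a + ?b" by (metis diff_add_cancel norm_triangle_ineq)
      then have "(cmod (g \<xi>))\<^sup>2 \<le> (?a + ?b)\<^sup>2" by (intro power_mono) auto
      also have "\<dots> \<le> 2 * ?a\<^sup>2 + 2 * ?b\<^sup>2"
        using zero_le_power2[of "?a - ?b"] by (simp add: power2_eq_square algebra_simps)
      finally have "ennreal ((cmod (g \<xi>))\<^sup>2) \<le> ennreal (2 * ?a\<^sup>2 + 2 * ?b\<^sup>2)" by (rule ennreal_leI)
      then show "ennreal ((cmod (g \<xi>))\<^sup>2) \<le> ennreal 2 * ennreal (?a\<^sup>2) + ennreal 2 * ennreal (?b\<^sup>2)"
        by (subst (asm) ennreal_plus) (auto simp: ennreal_mult)
    qed
    also have "\<dots> = ennreal 2 * (\<integral>\<^sup>+\<xi>. ennreal ((cmod (g \<xi> - fourier l (T R) \<xi>))\<^sup>2) \<partial>freq l) + ennreal 2 * (\<integral>\<^sup>+\<xi>. ennreal ((cmod (fourier l (T R) \<xi>))\<^sup>2) \<partial>freq l)"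
      by (subst nn_integral_add) (auto simp: nn_integral_cmult)
    also have "\<dots> \<le> ennreal 2 * ennreal (e / 2) + ennreal 2 * (ennreal 6 * X)"
      using R F by (intro add_mono mult_left_mono) auto
    also have "\<dots> = ennreal (12 * (\<integral>z. (cmod (f z))\<^sup>2 \<partial>cyl l)) + ennreal e"
    proof -
      have "ennreal 2 * ennreal (e / 2) = ennreal e" using e by (subst ennreal_mult[symmetric]) auto
      moreover have "ennreal 2 * (ennreal 6 * X) = ennreal (2 * (6 * (\<integral>z. (cmod (f z))\<^sup>2 \<partial>cyl l)))"
        unfolding X by (simp only: ennreal_mult'[symmetric])
      ultimately show ?thesis by (simp add: add.commute)
    qed
    finally show "(\<integral>\<^sup>+\<xi>. ennreal ((cmod (g \<xi>))\<^sup>2) \<partial>freq l) \<le> \<dots>" .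
  qed
  moreover have "(\<integral>\<^sup>+\<xi>. ennreal ((cmod (g \<xi>))\<^sup>2) \<partial>freq l) = ennreal (\<integral>\<xi>. (cmod (g \<xi>))\<^sup>2 \<partial>freq l)"
    using gL by (intro nn_integral_eq_integral) (auto simp: in_L2_def)
  ultimately have "ennreal (\<integral>\<xi>. (cmod (g \<xi>))\<^sup>2 \<partial>freq l) \<le> ennreal (12 * (\<integral>z. (cmod (f z))\<^sup>2 \<partial>cyl l))" by simp
  moreover have "0 \<le> 12 * (\<integral>z. (cmod (f z))\<^sup>2 \<partial>cyl l)" by (simp add: integral_nonneg)
  ultimately show ?thesis by (simp only: ennreal_le_iff)
qed

subsection \<open>Summation over sectors\<close>

text \<open>The directions of \<open>\<xi>2\<close> nearly orthogonal to those of \<open>\<xi>1\<close> in sector \<open>i\<close>.\<close>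

definition dual_sector :: "real \<Rightarrow> int \<times> bool \<Rightarrow> real \<times> real \<Rightarrow> bool" where
  "dual_sector \<theta> i \<xi> \<longleftrightarrow>
     (if snd i then \<bar>fst \<xi> + of_int (fst i) * \<theta> * snd \<xi>\<bar> \<le> 3 * \<theta> * norm \<xi>
      else \<bar>snd \<xi> + of_int (fst i) * \<theta> * fst \<xi>\<bar> \<le> 3 * \<theta> * norm \<xi>)"

text \<open>Being nearly orthogonal to a direction known up to \<theta> determines the direction of
  xi_2 up to 3 \<theta>. The resulting condition does not mention xi_1, so the mass of a sector
  piece is bounded by a product of one integral per profile.\<close>

lemma interaction_dual_sector:
  assumes c: "0 < c1 * N" and th: "0 < \<theta>" and I: "interaction c1 c2 N K \<theta> i \<xi>1 \<xi>2"
  shows "dual_sector \<theta> i \<xi>2"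
proof -
  obtain x y p q j b where eq: "\<xi>1 = (x, y)" "\<xi>2 = (p, q)" "i = (j, b)" by (metis surj_pair)
  have n: "0 < norm (x, y)" and ang: "\<bar>x * p + y * q\<bar> \<le> \<theta> * (norm (x, y) * norm (p, q))"
    and sec: "sector \<theta> (x, y) = (j, b)"
    using I c unfolding eq interaction_def by auto
  have pq: "\<bar>p\<bar> \<le> norm (p, q)" "\<bar>q\<bar> \<le> norm (p, q)"
    using norm_fst_le[of p q] norm_snd_le[of q p] by simp_all
  show ?thesis
  proof (cases b)
    case True
    with sec have s: "\<bar>y\<bar> \<le> \<bar>x\<bar> \<and> \<bar>y - of_int j * \<theta> * x\<bar> \<le> \<theta> * \<bar>x\<bar>"
      by (intro sector_cases(1)[OF th]) simp
    have "x \<noteq> 0" using s n by (auto simp: norm_pair_eq_sqrt)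
    then have "\<bar>p + of_int j * \<theta> * q\<bar> \<le> 3 * \<theta> * norm (p, q)"
      using s th ang pq norm_le_three_halves[of y x] by (intro perp_slope[where x = x and y = y and a = "norm (x, y)"]) (auto simp: norm_pair_eq_sqrt)
    then show ?thesis using True by (simp add: dual_sector_def eq)
  next
    case False
    with sec have s: "\<bar>x\<bar> < \<bar>y\<bar> \<and> \<bar>x - of_int j * \<theta> * y\<bar> \<le> \<theta> * \<bar>y\<bar>"
      by (intro sector_cases(2)[OF th]) simp
    have "y \<noteq> 0" using s n by (auto simp: norm_pair_eq_sqrt)
    then have "\<bar>q + of_int j * \<theta> * p\<bar> \<le> 3 * \<theta> * norm (p, q)"
      using s th ang pq norm_le_three_halves[of x y] by (intro perp_slope[where x = y and y = x and a = "norm (x, y)"]) (auto simp: norm_pair_eq_sqrt add.commute)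
    then show ?thesis using False by (simp add: dual_sector_def eq)
  qed
qed

text \<open>If p + j \<theta> q is small then q is not: |j \<theta>| <= 11/10 and \<theta> <= 1/10
  give n <= 3 |q|. Two admissible indices satisfy |j - j'| \<theta> |q| <= 6 \<theta> n <= 18
  \<theta> |q|, so they are at most 18 apart and there are at most 19.\<close>

lemma slope_overlap:
  fixes p q \<theta> n :: real and J :: int
  assumes th: "0 < \<theta>" "\<theta> \<le> 1/10" and J: "of_int J * \<theta> \<le> 11/10" and n: "0 < n" "n \<le> \<bar>p\<bar> + \<bar>q\<bar>"
  shows "real (card {j\<in>{-J..J}. \<bar>p + of_int j * \<theta> * q\<bar> \<le> 3 * \<theta> * n}) \<le> 19"
proof -
  let ?T = "{j\<in>{-J..J}. \<bar>p + of_int j * \<theta> * q\<bar> \<le> 3 * \<theta> * n}"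
  have "real (card ?T) \<le> 1 * 18 + 1"
  proof (rule card_int_diameter_le)
    fix j j' assume "j \<in> ?T" "j' \<in> ?T"
    then have j: "j \<in> {-J..J}" and b: "\<bar>p + of_int j * \<theta> * q\<bar> \<le> 3 * \<theta> * n" "\<bar>p + of_int j' * \<theta> * q\<bar> \<le> 3 * \<theta> * n" by auto
    have "\<bar>real_of_int j\<bar> * \<theta> \<le> of_int J * \<theta>" using j th by (intro mult_right_mono) auto
    then have "\<bar>real_of_int j * \<theta>\<bar> \<le> 11/10" using J th by (simp only: abs_mult abs_of_pos)
    then have "\<bar>of_int j * \<theta> * q\<bar> \<le> 11/10 * \<bar>q\<bar>"
      unfolding abs_mult[of _ q] by (rule mult_right_mono) simp
    moreover have "3 * \<theta> * n \<le> 3/10 * n" using th n by (intro mult_right_mono) auto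
    ultimately have "\<bar>p\<bar> \<le> 11/10 * \<bar>q\<bar> + 3/10 * n" using b(1) by linarith
    then have nq: "n \<le> 3 * \<bar>q\<bar>" using n(2) by linarith
    then have q: "0 < \<bar>q\<bar>" using n(1) by linarith
    have "\<bar>(of_int j - of_int j') * \<theta> * q\<bar> \<le> 6 * \<theta> * n"
      using b abs_triangle_ineq4[of "p + of_int j * \<theta> * q" "p + of_int j' * \<theta> * q"] by (simp add: algebra_simps)
    also have "\<dots> \<le> 6 * \<theta> * (3 * \<bar>q\<bar>)" using nq th by (intro mult_left_mono) auto
    finally have "\<bar>of_int j - of_int j'\<bar> * (\<theta> * \<bar>q\<bar>) \<le> 18 * (\<theta> * \<bar>q\<bar>)" using th by (simp add: abs_mult mult.assoc)
    then show "\<bar>of_int j - of_int j'\<bar> \<le> 1 * (18 :: real)" using q th by simp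
  qed (rule finite_subset[of _ "{-J..J}"], auto)
  then show ?thesis by simp
qed

text \<open>At most 19 indices for each value of the flag. Rounding 1/\<theta> up adds at most
  \<theta> to the largest slope, hence the 11/10.\<close>

lemma dual_sector_overlap:
  assumes th: "0 < \<theta>" "\<theta> \<le> 1/10" and \<xi>: "\<xi> \<noteq> 0"
  shows "real (card {i\<in>{-\<lceil>1 / \<theta>\<rceil>..\<lceil>1 / \<theta>\<rceil>} \<times> UNIV. dual_sector \<theta> i \<xi>}) \<le> 38"
proof -
  define J where "J = \<lceil>1 / \<theta>\<rceil>"
  obtain p q where eq: "\<xi> = (p, q)" by fastforce
  have n: "0 < norm \<xi>" "norm \<xi> \<le> \<bar>p\<bar> + \<bar>q\<bar>" "norm \<xi> \<le> \<bar>q\<bar> + \<bar>p\<bar>"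
    using \<xi> sqrt_sum_squares_le_sum_abs[of p q] by (simp_all add: eq norm_pair_eq_sqrt zero_prod_def add.commute sum_power2_gt_zero_iff)
  have "of_int J \<le> 1 / \<theta> + 1" unfolding J_def by linarith
  then have "of_int J * \<theta> \<le> (1 / \<theta> + 1) * \<theta>" using th by (intro mult_right_mono) auto
  also have "\<dots> \<le> 11/10" using th by (simp add: field_simps)
  finally have J: "of_int J * \<theta> \<le> 11/10" .
  let ?A = "{j\<in>{-J..J}. \<bar>p + of_int j * \<theta> * q\<bar> \<le> 3 * \<theta> * norm \<xi>}"
  let ?B = "{j\<in>{-J..J}. \<bar>q + of_int j * \<theta> * p\<bar> \<le> 3 * \<theta> * norm \<xi>}"
  have fin: "finite ?A" "finite ?B" by (rule finite_subset[of _ "{-J..J}"], auto)+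
  have "{i\<in>{-J..J} \<times> UNIV. dual_sector \<theta> i \<xi>} \<subseteq> (\<lambda>j. (j, True)) ` ?A \<union> (\<lambda>j. (j, False)) ` ?B"
    by (auto simp: dual_sector_def eq split: if_splits)
  then have "card {i\<in>{-J..J} \<times> UNIV. dual_sector \<theta> i \<xi>} \<le> card ((\<lambda>j. (j, True)) ` ?A \<union> (\<lambda>j. (j, False)) ` ?B)"
    by (intro card_mono finite_UnI finite_imageI fin)
  also have "\<dots> \<le> card ?A + card ?B"
    by (intro order_trans[OF card_Un_le] add_mono card_image_le fin)
  finally show ?thesis
    using slope_overlap[OF th J n(1,2)] slope_overlap[OF th J n(1,3)] unfolding J_def by linarith
qed

lemma sector_index_range:
  assumes th: "0 < \<theta>"
  shows "sector \<theta> \<xi> \<in> {-\<lceil>1 / \<theta>\<rceil>..\<lceil>1 / \<theta>\<rceil>} \<times> UNIV"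
proof -
  have *: "\<lfloor>a / b / \<theta>\<rfloor> \<in> {-\<lceil>1 / \<theta>\<rceil>..\<lceil>1 / \<theta>\<rceil>}" if "\<bar>a\<bar> \<le> \<bar>b\<bar>" for a b :: real
  proof -
    have "\<bar>a / b\<bar> \<le> 1" using that by (cases "b = 0") auto
    then have "\<bar>a / b\<bar> / \<bar>\<theta>\<bar> \<le> 1 / \<theta>" using th by (simp only: abs_of_pos) (rule divide_right_mono, auto)
    then have "\<bar>a / b / \<theta>\<bar> \<le> 1 / \<theta>" by (simp only: abs_divide[of "a / b" \<theta>])
    then show ?thesis unfolding atLeastAtMost_iff by linarith
  qed
  show ?thesis using *[of "snd \<xi>" "fst \<xi>"] *[of "fst \<xi>" "snd \<xi>"] by (auto simp: sector_def)
qed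

section \<open>Cauchy-Schwarz in the sector index\<close>

lemma weighted_sum_sq_le:
  fixes x w :: "'i \<Rightarrow> real"
  assumes "\<And>i. i \<in> I \<Longrightarrow> 0 < w i"
  shows "(\<Sum>i\<in>I. x i)\<^sup>2 \<le> (\<Sum>i\<in>I. w i) * (\<Sum>i\<in>I. (x i)\<^sup>2 / w i)"
proof -
  have "(\<Sum>i\<in>I. x i)\<^sup>2 = (\<Sum>i\<in>I. sqrt (w i) * (x i / sqrt (w i)))\<^sup>2"
    using assms by (intro arg_cong[where f = "\<lambda>s. s\<^sup>2"] sum.cong) (auto dest!: assms)
  also have "\<dots> \<le> (\<Sum>i\<in>I. (sqrt (w i))\<^sup>2) * (\<Sum>i\<in>I. (x i / sqrt (w i))\<^sup>2)" by (rule Cauchy_Schwarz_ineq_sum)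
  also have "\<dots> = (\<Sum>i\<in>I. w i) * (\<Sum>i\<in>I. (x i)\<^sup>2 / w i)"
    using assms by (intro arg_cong2[where f = times] sum.cong) (auto simp: power_divide less_imp_le)
  finally show ?thesis .
qed

text \<open>With weights p i Cauchy-Schwarz turns the single bounds B p i q i into B times the
  product of the two sums, without the number of indices. Some p i may vanish, so the weights are
  shifted by \<epsilon> and the excess is absorbed by \<open>e\<close>.\<close>

lemma nn_integral_sum_sq_le:
  fixes F :: "'i \<Rightarrow> 'z \<Rightarrow> complex" and p q :: "'i \<Rightarrow> real"
  assumes "finite I" and [measurable]: "W \<in> borel_measurable Z" "\<And>i. F i \<in> borel_measurable Z"
    and W: "\<And>z. 0 \<le> W z" and B: "0 \<le> B" and pq: "\<And>i. 0 \<le> p i" "\<And>i. 0 \<le> q i"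
    and bd: "\<And>i. i \<in> I \<Longrightarrow> (\<integral>\<^sup>+z. ennreal (W z * (cmod (F i z))\<^sup>2) \<partial>Z) \<le> ennreal (B * (p i * q i))"
  shows "(\<integral>\<^sup>+z. ennreal (W z * (cmod (\<Sum>i\<in>I. F i z))\<^sup>2) \<partial>Z) \<le> ennreal (B * ((\<Sum>i\<in>I. p i) * (\<Sum>i\<in>I. q i)))"
proof (rule ennreal_le_epsilon)
  fix e :: real assume e: "0 < e"
  define P where "P = (\<Sum>i\<in>I. p i)"
  define Q where "Q = (\<Sum>i\<in>I. q i)"
  define n where "n = real (card I)"
  have nn: "0 \<le> P" "0 \<le> Q" "0 \<le> n" using pq by (auto simp: P_def Q_def n_def sum_nonneg)
  \<comment> \<open>The shift produces an excess of n B Q \<epsilon>; the added 1 keeps the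
    denominator positive.\<close>
  define \<epsilon> where "\<epsilon> = e / (n * (B * Q) + 1)"
  have pos1: "0 < n * (B * Q) + 1" using nn B by (simp add: add_nonneg_pos)
  then have \<epsilon>: "0 < \<epsilon>" using e by (simp add: \<epsilon>_def)
  define w where "w i = p i + \<epsilon>" for i
  have w: "0 < w i" for i using pq(1)[of i] \<epsilon> by (simp add: w_def)
  define S where "S = (\<Sum>i\<in>I. w i)"
  have S: "S = P + n * \<epsilon>" by (simp add: S_def w_def sum.distrib P_def n_def)
  have S0: "0 \<le> S" using S nn \<epsilon> by simp
  have "(\<integral>\<^sup>+z. ennreal (W z * (cmod (\<Sum>i\<in>I. F i z))\<^sup>2) \<partial>Z) \<le> (\<integral>\<^sup>+z. (\<Sum>i\<in>I. ennreal (S / w i) * ennreal (W z * (cmod (F i z))\<^sup>2)) \<partial>Z)"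
  proof (rule nn_integral_mono)
    fix z
    have "(cmod (\<Sum>i\<in>I. F i z))\<^sup>2 \<le> (\<Sum>i\<in>I. cmod (F i z))\<^sup>2" by (intro power_mono norm_sum) auto
    also have "\<dots> \<le> S * (\<Sum>i\<in>I. (cmod (F i z))\<^sup>2 / w i)" unfolding S_def by (rule weighted_sum_sq_le) (rule w)
    finally have "W z * (cmod (\<Sum>i\<in>I. F i z))\<^sup>2 \<le> W z * (S * (\<Sum>i\<in>I. (cmod (F i z))\<^sup>2 / w i))"
      using W by (rule mult_left_mono)
    also have "\<dots> = (\<Sum>i\<in>I. S / w i * (W z * (cmod (F i z))\<^sup>2))"
      by (simp add: sum_distrib_left mult_ac)
    finally have "ennreal (W z * (cmod (\<Sum>i\<in>I. F i z))\<^sup>2) \<le> ennreal (\<Sum>i\<in>I. S / w i * (W z * (cmod (F i z))\<^sup>2))"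
      by (rule ennreal_leI)
    also have "\<dots> = (\<Sum>i\<in>I. ennreal (S / w i * (W z * (cmod (F i z))\<^sup>2)))"
      using S0 w W by (intro sum_ennreal[symmetric]) (auto simp: less_imp_le)
    also have "\<dots> = (\<Sum>i\<in>I. ennreal (S / w i) * ennreal (W z * (cmod (F i z))\<^sup>2))"
      using S0 w W by (intro sum.cong refl ennreal_mult) (auto simp: less_imp_le)
    finally show "ennreal (W z * (cmod (\<Sum>i\<in>I. F i z))\<^sup>2) \<le> \<dots>" .
  qed
  also have "\<dots> = (\<Sum>i\<in>I. ennreal (S / w i) * (\<integral>\<^sup>+z. ennreal (W z * (cmod (F i z))\<^sup>2) \<partial>Z))"
    by (subst nn_integral_sum) (auto simp: nn_integral_cmult)
  also have "\<dots> \<le> (\<Sum>i\<in>I. ennreal (S / w i) * ennreal (B * (p i * q i)))"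
    by (intro sum_mono mult_left_mono bd) auto
  also have "\<dots> \<le> (\<Sum>i\<in>I. ennreal (S * B * q i))"
  proof (rule sum_mono)
    fix i
    have "p i / w i \<le> 1" using w[of i] \<epsilon> by (simp add: w_def)
    then have "S * B * q i * (p i / w i) \<le> S * B * q i * 1" using S0 B pq by (intro mult_left_mono) auto
    moreover have "S / w i * (B * (p i * q i)) = S * B * q i * (p i / w i)" by simp
    ultimately have "S / w i * (B * (p i * q i)) \<le> S * B * q i" by linarith
    then show "ennreal (S / w i) * ennreal (B * (p i * q i)) \<le> ennreal (S * B * q i)"
      using S0 w[of i] B pq by (subst ennreal_mult[symmetric]) (auto intro!: ennreal_leI)
  qed
  also have "\<dots> = ennreal (\<Sum>i\<in>I. S * B * q i)" using S0 B pq by (intro sum_ennreal) auto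
  also have "(\<Sum>i\<in>I. S * B * q i) = B * (P * Q) + n * (B * Q) * \<epsilon>"
    unfolding sum_distrib_left[symmetric] Q_def[symmetric] S by (simp add: algebra_simps)
  also have "ennreal \<dots> \<le> ennreal (B * (P * Q) + e)"
  proof (intro ennreal_leI add_left_mono)
    have "n * (B * Q) * \<epsilon> \<le> (n * (B * Q) + 1) * \<epsilon>" using \<epsilon> by simp
    also have "\<dots> = e" using pos1 by (simp add: \<epsilon>_def)
    finally show "n * (B * Q) * \<epsilon> \<le> e" .
  qed
  also have "\<dots> = ennreal (B * (P * Q)) + ennreal e" using B nn e by (intro ennreal_plus) auto
  finally show "(\<integral>\<^sup>+z. ennreal (W z * (cmod (\<Sum>i\<in>I. F i z))\<^sup>2) \<partial>Z) \<le> ennreal (B * ((\<Sum>i\<in>I. p i) * (\<Sum>i\<in>I. q i))) + ennreal e"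
    unfolding P_def Q_def .
qed

section \<open>The angle condition and almost everywhere representatives\<close>

lemma cos_vec_angle: "cos (vec_angle u v) = u \<bullet> v / (norm u * norm v)"
proof -
  have "\<bar>u \<bullet> v\<bar> \<le> norm u * norm v" by (rule Cauchy_Schwarz_ineq2)
  then have "\<bar>u \<bullet> v / (norm u * norm v)\<bar> \<le> 1"
    by (cases "norm u * norm v = 0") (auto simp: divide_le_eq abs_mult)
  then have "- 1 \<le> u \<bullet> v / (norm u * norm v)" "u \<bullet> v / (norm u * norm v) \<le> 1" by linarith+
  then show ?thesis unfolding vec_angle_def by (rule cos_arccos)
qed

text \<open>The form without division is the one in \<open>interaction\<close>. For a zero vector
  both sides hold, since the quotient is then 0 by convention.\<close>

lemma abs_cos_vec_angle_le:
  assumes "0 < \<theta>"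
  shows "\<bar>cos (vec_angle u v)\<bar> \<le> \<theta> \<longleftrightarrow> \<bar>u \<bullet> v\<bar> \<le> \<theta> * (norm u * norm v)"
proof (cases "u = 0 \<or> v = 0")
  case False
  then have "0 < norm u * norm v" by simp
  then show ?thesis unfolding cos_vec_angle by (simp add: abs_divide abs_mult pos_divide_le_eq)
qed (use assms in \<open>auto simp: cos_vec_angle\<close>)

lemma dual_sector_measurable [measurable]: "Measurable.pred (freq l) (dual_sector \<theta> i)"
  unfolding dual_sector_def by (cases "snd i") (simp_all, measurable)

lemma AE_pair_fst:
  assumes "sigma_finite_measure M1" "sigma_finite_measure M2" "AE x in M1. P x" "Measurable.pred M1 P"
  shows "AE z in M1 \<Otimes>\<^sub>M M2. P (fst z)"
proof -
  interpret pair_sigma_finite M1 M2 using assms by (intro pair_sigma_finite.intro)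
  note [measurable] = assms(4)
  show ?thesis by (rule AE_pair_measure) (use assms(3) in auto)
qed

lemma AE_pair_snd:
  assumes "sigma_finite_measure M1" "sigma_finite_measure M2" "AE x in M2. P x" "Measurable.pred M2 P"
  shows "AE z in M1 \<Otimes>\<^sub>M M2. P (snd z)"
proof -
  interpret pair_sigma_finite M1 M2 using assms by (intro pair_sigma_finite.intro)
  note [measurable] = assms(4)
  show ?thesis by (rule AE_pair_measure) (use assms(3) in auto)
qed

text \<open>The frequency supports are given almost everywhere, whereas the Schur test uses supports
  pointwise. This permits passing to \<open>r1\<close> and \<open>r2\<close>, the profiles cut off
  to their annuli.\<close>

lemma bilin_eq_phase_integral:
  fixes g1 g2 r1 r2 :: "real \<times> real \<Rightarrow> complex"
  assumes l: "0 < l" and th: "0 < \<theta>"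
    and [measurable]: "g1 \<in> borel_measurable (freq l)" "g2 \<in> borel_measurable (freq l)"
      "r1 \<in> borel_measurable (freq l)" "r2 \<in> borel_measurable (freq l)"
    and AE: "AE \<xi> in freq l. g1 \<xi> = r1 \<xi>" "AE \<xi> in freq l. g2 \<xi> = r2 \<xi>"
  shows "bilin l K \<theta> g1 g2 t z = (\<integral>\<xi>. phase (t, z) \<xi> *
     (of_bool (K \<le> \<bar>fst (fst \<xi>) - fst (snd \<xi>)\<bar>) * of_bool (\<bar>fst \<xi> \<bullet> snd \<xi>\<bar> \<le> \<theta> * (norm (fst \<xi>) * norm (snd \<xi>)))
        * r1 (fst \<xi>) * r2 (snd \<xi>)) \<partial>(freq l \<Otimes>\<^sub>M freq l))"
proof -
  note F = sigma_finite_freq[OF l]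
  have ph: "(\<lambda>\<xi>. phase (t, z) \<xi>) \<in> borel_measurable (freq l \<Otimes>\<^sub>M freq l)"
    using phase_measurable[of "\<lambda>_. t" "freq l \<Otimes>\<^sub>M freq l" "\<lambda>_. z" fst snd] by simp
  have ae1: "AE \<xi> in freq l \<Otimes>\<^sub>M freq l. g1 (fst \<xi>) = r1 (fst \<xi>)"
    by (rule AE_pair_fst[OF F F AE(1)]) measurable
  have ae2: "AE \<xi> in freq l \<Otimes>\<^sub>M freq l. g2 (snd \<xi>) = r2 (snd \<xi>)"
    by (rule AE_pair_snd[OF F F AE(2)]) measurable
  have "bilin l K \<theta> g1 g2 t z = (\<integral>\<xi>. phase (t, z) \<xi> *
     (of_bool (K \<le> \<bar>fst (fst \<xi>) - fst (snd \<xi>)\<bar>) * of_bool (\<bar>fst \<xi> \<bullet> snd \<xi>\<bar> \<le> \<theta> * (norm (fst \<xi>) * norm (snd \<xi>)))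
        * g1 (fst \<xi>) * g2 (snd \<xi>)) \<partial>(freq l \<Otimes>\<^sub>M freq l))"
    unfolding bilin_def abs_cos_vec_angle_le[OF th] case_prod_unfold phase_def
    by (simp add: mult.assoc)
  also have "\<dots> = (\<integral>\<xi>. phase (t, z) \<xi> *
     (of_bool (K \<le> \<bar>fst (fst \<xi>) - fst (snd \<xi>)\<bar>) * of_bool (\<bar>fst \<xi> \<bullet> snd \<xi>\<bar> \<le> \<theta> * (norm (fst \<xi>) * norm (snd \<xi>)))
        * r1 (fst \<xi>) * r2 (snd \<xi>)) \<partial>(freq l \<Otimes>\<^sub>M freq l))"
  proof (rule integral_cong_AE)
    show "AE \<xi> in freq l \<Otimes>\<^sub>M freq l. phase (t, z) \<xi> *
       (of_bool (K \<le> \<bar>fst (fst \<xi>) - fst (snd \<xi>)\<bar>) * of_bool (\<bar>fst \<xi> \<bullet> snd \<xi>\<bar> \<le> \<theta> * (norm (fst \<xi>) * norm (snd \<xi>)))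
          * g1 (fst \<xi>) * g2 (snd \<xi>)) = phase (t, z) \<xi> *
       (of_bool (K \<le> \<bar>fst (fst \<xi>) - fst (snd \<xi>)\<bar>) * of_bool (\<bar>fst \<xi> \<bullet> snd \<xi>\<bar> \<le> \<theta> * (norm (fst \<xi>) * norm (snd \<xi>)))
          * r1 (fst \<xi>) * r2 (snd \<xi>))"
      using ae1 ae2 by eventually_elim simp
  qed (intro borel_measurable_times[OF ph]; measurable)+
  finally show ?thesis .
qed

text \<open>The constant 1216 is 4 times 8 times 38: the weights in t and x cost 2 each, 8 pi^3
  comes from the kernel of one sector, and 38 is the overlap of the dual sectors.\<close>

lemma bilin_L2_bound:
  fixes c1 c2 c3 l \<theta> M N1 N2 :: real
  defines "T \<equiv> restrict_space lborel {0..1 :: real}"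
  assumes c: "0 < c1" "0 < c2" "0 < c3" and l: "0 < l" and th: "0 < \<theta>" "\<theta> \<le> 1/10"
    and M: "0 < M" and N: "0 < N2" "N2 \<le> N1"
    and g: "in_L2 (freq l) g1" "in_L2 (freq l) g2"
    and supp: "AE \<xi> in freq l. g1 \<xi> \<noteq> 0 \<longrightarrow> c1 * N1 \<le> norm \<xi> \<and> norm \<xi> \<le> c2 * N1"
      "AE \<xi> in freq l. g2 \<xi> \<noteq> 0 \<longrightarrow> c1 * N2 \<le> norm \<xi> \<and> norm \<xi> \<le> c2 * N2"
  shows "in_L2 (T \<Otimes>\<^sub>M cyl l) (\<lambda>(t, z). bilin l (c3 * M) \<theta> g1 g2 t z)"
    and "(\<integral>w. (cmod (case w of (t, z) \<Rightarrow> bilin l (c3 * M) \<theta> g1 g2 t z))\<^sup>2 \<partial>(T \<Otimes>\<^sub>M cyl l)) \<le>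
      1216 * pi^3 * (2400 * c2\<^sup>2 / c1\<^sup>2 * \<theta> + 4 / (l * (c3 * M))) *
        ((\<integral>\<xi>. (cmod (g1 \<xi>))\<^sup>2 \<partial>freq l) * (\<integral>\<xi>. (cmod (g2 \<xi>))\<^sup>2 \<partial>freq l))"
proof -
  define K where "K = c3 * M"
  have K: "0 < K" using c M by (simp add: K_def)
  have N1: "0 < N1" using N by simp
  interpret F: sigma_finite_measure "freq l" by (rule sigma_finite_freq[OF l])
  interpret C: sigma_finite_measure "cyl l" by (rule sigma_finite_cyl)
  interpret FF: sigma_finite_measure "freq l \<Otimes>\<^sub>M freq l"
    by (intro sigma_finite_pair_measure F.sigma_finite_measure_axioms)
  define r1 where "r1 \<xi> = (if c1 * N1 \<le> norm \<xi> \<and> norm \<xi> \<le> c2 * N1 then g1 \<xi> else 0)" for \<xi>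
  define r2 where "r2 \<xi> = (if c1 * N2 \<le> norm \<xi> \<and> norm \<xi> \<le> c2 * N2 then g2 \<xi> else 0)" for \<xi>
  have gm [measurable]: "g1 \<in> borel_measurable (freq l)" "g2 \<in> borel_measurable (freq l)" 
    and gi: "integrable (freq l) (\<lambda>\<xi>. (cmod (g1 \<xi>))\<^sup>2)" "integrable (freq l) (\<lambda>\<xi>. (cmod (g2 \<xi>))\<^sup>2)"
    using g by (auto simp: in_L2_def)
  have rm [measurable]: "r1 \<in> borel_measurable (freq l)" "r2 \<in> borel_measurable (freq l)"
    unfolding r1_def r2_def by measurable
  have rg: "cmod (r1 \<xi>) \<le> cmod (g1 \<xi>)" "cmod (r2 \<xi>) \<le> cmod (g2 \<xi>)" for \<xi> by (auto simp: r1_def r2_def)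
  have bd: "integrable (freq l) (\<lambda>\<xi>. (cmod (r1 \<xi>))\<^sup>2 * of_bool (P \<xi>))" "integrable (freq l) (\<lambda>\<xi>. (cmod (r2 \<xi>))\<^sup>2 * of_bool (P \<xi>))"
    if [measurable]: "Measurable.pred (freq l) P" for P
    by (rule Bochner_Integration.integrable_bound[OF gi(1)]; use rg in \<open>auto simp: of_bool_def power_mono\<close>)
      (rule Bochner_Integration.integrable_bound[OF gi(2)]; use rg in \<open>auto simp: of_bool_def power_mono\<close>)
  have rI: "integrable (freq l) r1" "integrable (freq l) r2"
  proof -
    show "integrable (freq l) r1"
      by (rule integrable_freq_bounded_support[OF l, where r = "c2 * N1"])
        (use bd(1)[of "\<lambda>_. True"] in \<open>auto simp: in_L2_def r1_def split: if_splits\<close>)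
    show "integrable (freq l) r2"
      by (rule integrable_freq_bounded_support[OF l, where r = "c2 * N2"])
        (use bd(2)[of "\<lambda>_. True"] in \<open>auto simp: in_L2_def r2_def split: if_splits\<close>)
  qed
  define h where "h \<xi> = of_bool (K \<le> \<bar>fst (fst \<xi>) - fst (snd \<xi>)\<bar>) * of_bool (\<bar>fst \<xi> \<bullet> snd \<xi>\<bar> \<le> \<theta> * (norm (fst \<xi>) * norm (snd \<xi>)))
        * r1 (fst \<xi>) * r2 (snd \<xi>)" for \<xi>
  define hi where "hi i \<xi> = h \<xi> * of_bool (sector \<theta> (fst \<xi>) = i)" for i \<xi>
  define \<Phi> where "\<Phi> i z = (\<integral>\<xi>. phase z \<xi> * hi i \<xi> \<partial>(freq l \<Otimes>\<^sub>M freq l))" for i z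
  define I where "I = {-\<lceil>1 / \<theta>\<rceil>..\<lceil>1 / \<theta>\<rceil>} \<times> (UNIV :: bool set)"
  have finI: "finite I" by (simp add: I_def)
  have sm [measurable]: "Measurable.pred (freq l) (\<lambda>\<xi>. sector \<theta> \<xi> = i)" for i
    using measurable_compose[OF id_freq_measurable sector_measurable] by measurable
  have hm [measurable]: "h \<in> borel_measurable (freq l \<Otimes>\<^sub>M freq l)" unfolding h_def by measurable
  have him [measurable]: "hi i \<in> borel_measurable (freq l \<Otimes>\<^sub>M freq l)" for i unfolding hi_def by measurable
  have hle: "cmod (hi i \<xi>) \<le> cmod (r1 (fst \<xi>) * r2 (snd \<xi>))" for i \<xi>
    by (auto simp: hi_def h_def norm_mult of_bool_def)
  have hiI: "integrable (freq l \<Otimes>\<^sub>M freq l) (hi i)" for i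
    by (rule Bochner_Integration.integrable_bound[OF integral_product_pair(1)[OF F.sigma_finite_measure_axioms F.sigma_finite_measure_axioms rI]])
      (use hle in auto)
  have inter: "interaction c1 c2 N1 K \<theta> i (fst \<xi>) (snd \<xi>)" if "hi i \<xi> \<noteq> 0" for i \<xi>
  proof -
    \<comment> \<open>The scale in \<open>interaction\<close> is N1, so the second frequency is
      recorded only as lying in the ball of radius c2 N1.\<close>
    have "c2 * N2 \<le> c2 * N1" using N c by (intro mult_left_mono) auto
    then show ?thesis using that by (auto simp: hi_def h_def interaction_def r1_def r2_def split: if_splits)
  qed
  have phm [measurable]: "phase z \<in> borel_measurable (freq l \<Otimes>\<^sub>M freq l)" for z
    using phase_measurable[of "\<lambda>_. fst z" "freq l \<Otimes>\<^sub>M freq l" "\<lambda>_. snd z" fst snd] by simp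
  have phI: "integrable (freq l \<Otimes>\<^sub>M freq l) (\<lambda>\<xi>. phase z \<xi> * hi i \<xi>)" for z i
    by (rule Bochner_Integration.integrable_bound[OF hiI[of i]]) (auto simp: norm_mult norm_phase)
  have \<Phi>m: "\<Phi> i \<in> borel_measurable (S \<Otimes>\<^sub>M cyl l)" if "(\<lambda>t. t) \<in> borel_measurable S" for i S
  proof -
    note [measurable] = phase_joint_measurable[OF that]
    show ?thesis unfolding \<Phi>_def by measurable
  qed
  have Tm: "(\<lambda>t. t) \<in> borel_measurable T" unfolding T_def by (rule measurable_restrict_space1) simp
  have \<Phi>mL [measurable]: "\<Phi> i \<in> borel_measurable (lborel \<Otimes>\<^sub>M cyl l)" for i by (rule \<Phi>m) simp
  have \<Phi>mT [measurable]: "\<Phi> i \<in> borel_measurable (T \<Otimes>\<^sub>M cyl l)" for i by (rule \<Phi>m[OF Tm])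
  have bil: "(case w of (t, z) \<Rightarrow> bilin l K \<theta> g1 g2 t z) = (\<Sum>i\<in>I. \<Phi> i w)" for w
  proof -
    have ae1: "AE \<xi> in freq l. g1 \<xi> = r1 \<xi>" by (rule eventually_mono[OF supp(1)]) (auto simp: r1_def)
    have ae2: "AE \<xi> in freq l. g2 \<xi> = r2 \<xi>" by (rule eventually_mono[OF supp(2)]) (auto simp: r2_def)
    have hs: "h \<xi> = (\<Sum>i\<in>I. hi i \<xi>)" for \<xi>
    proof -
      have "(\<Sum>i\<in>I. hi i \<xi>) = (\<Sum>i\<in>I. if sector \<theta> (fst \<xi>) = i then h \<xi> else 0)"
        unfolding hi_def by (intro sum.cong) (auto simp: of_bool_def)
      also have "\<dots> = h \<xi>" using finI sector_index_range[OF th(1), of "fst \<xi>"] by (simp add: I_def)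
      finally show ?thesis by simp
    qed
    have "(case w of (t, z) \<Rightarrow> bilin l K \<theta> g1 g2 t z) = (\<integral>\<xi>. phase w \<xi> * h \<xi> \<partial>(freq l \<Otimes>\<^sub>M freq l))"
      unfolding h_def using bilin_eq_phase_integral[OF l th(1) gm rm ae1 ae2, of K "fst w" "snd w"] by (simp add: case_prod_unfold)
    also have "\<dots> = (\<Sum>i\<in>I. \<Phi> i w)"
      unfolding hs \<Phi>_def sum_distrib_left by (rule Bochner_Integration.integral_sum) (rule phI)
    finally show ?thesis .
  qed
  \<comment> \<open>\<open>p\<close> measures the first profile on the sectors, which are disjoint;
    \<open>q\<close> measures the second on the dual sectors, which overlap boundedly. The weighted
    norm of piece i is at most B p i q i.\<close>
  define p where "p i = (\<integral>\<xi>. (cmod (r1 \<xi>))\<^sup>2 * of_bool (sector \<theta> \<xi> = i) \<partial>freq l)" for i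
  define q where "q i = (\<integral>\<xi>. (cmod (r2 \<xi>))\<^sup>2 * of_bool (dual_sector \<theta> i \<xi>) \<partial>freq l)" for i
  define G1 where "G1 = (\<integral>\<xi>. (cmod (g1 \<xi>))\<^sup>2 \<partial>freq l)"
  define G2 where "G2 = (\<integral>\<xi>. (cmod (g2 \<xi>))\<^sup>2 \<partial>freq l)"
  have pq0: "0 \<le> p i" "0 \<le> q i" for i by (simp_all add: p_def q_def integral_nonneg)
  have G0: "0 \<le> G1" "0 \<le> G2" by (simp_all add: G1_def G2_def integral_nonneg)
  have sum_p: "(\<Sum>i\<in>I. p i) \<le> G1"
  proof -
    have "(\<Sum>i\<in>I. p i) = (\<integral>\<xi>. (\<Sum>i\<in>I. (cmod (r1 \<xi>))\<^sup>2 * of_bool (sector \<theta> \<xi> = i)) \<partial>freq l)"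
      unfolding p_def by (rule Bochner_Integration.integral_sum[symmetric]) (intro bd sm)
    also have "\<dots> \<le> G1" unfolding G1_def
    proof (rule integral_mono)
      fix \<xi>
      have "(\<Sum>i\<in>I. (cmod (r1 \<xi>))\<^sup>2 * of_bool (sector \<theta> \<xi> = i)) = (\<Sum>i\<in>I. if sector \<theta> \<xi> = i then (cmod (r1 \<xi>))\<^sup>2 else 0)"
        by (intro sum.cong) (auto simp: of_bool_def)
      also have "\<dots> \<le> (cmod (r1 \<xi>))\<^sup>2" using finI by simp
      also have "\<dots> \<le> (cmod (g1 \<xi>))\<^sup>2" using rg by (intro power_mono) auto
      finally show "(\<Sum>i\<in>I. (cmod (r1 \<xi>))\<^sup>2 * of_bool (sector \<theta> \<xi> = i)) \<le> (cmod (g1 \<xi>))\<^sup>2" .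
    qed (intro Bochner_Integration.integrable_sum bd sm gi)+
    finally show ?thesis .
  qed
  have sum_q: "(\<Sum>i\<in>I. q i) \<le> 38 * G2"
  proof -
    have "(\<Sum>i\<in>I. q i) = (\<integral>\<xi>. (\<Sum>i\<in>I. (cmod (r2 \<xi>))\<^sup>2 * of_bool (dual_sector \<theta> i \<xi>)) \<partial>freq l)"
      unfolding q_def by (rule Bochner_Integration.integral_sum[symmetric]) (intro bd dual_sector_measurable)
    also have "\<dots> \<le> (\<integral>\<xi>. 38 * (cmod (g2 \<xi>))\<^sup>2 \<partial>freq l)"
    proof (rule integral_mono)
      fix \<xi>
      show "(\<Sum>i\<in>I. (cmod (r2 \<xi>))\<^sup>2 * of_bool (dual_sector \<theta> i \<xi>)) \<le> 38 * (cmod (g2 \<xi>))\<^sup>2"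
      proof (cases "r2 \<xi> = 0")
        case False
        then have "\<xi> \<noteq> 0" using c N by (auto simp: r2_def mult_le_0_iff split: if_splits)
        then have "real (card {i\<in>I. dual_sector \<theta> i \<xi>}) \<le> 38" unfolding I_def by (rule dual_sector_overlap[OF th])
        moreover have "(\<Sum>i\<in>I. of_bool (dual_sector \<theta> i \<xi>)) = real (card {i\<in>I. dual_sector \<theta> i \<xi>})"
          using finI by (simp add: of_bool_def sum.If_cases Int_def)
        ultimately have "(\<Sum>i\<in>I. of_bool (dual_sector \<theta> i \<xi>)) * (cmod (r2 \<xi>))\<^sup>2 \<le> 38 * (cmod (g2 \<xi>))\<^sup>2"
          using rg by (intro mult_mono power_mono) auto
        then show ?thesis unfolding sum_distrib_left[symmetric] by (simp only: mult.commute)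
      qed simp
    qed (intro Bochner_Integration.integrable_sum Bochner_Integration.integrable_mult_right bd dual_sector_measurable gi)+
    finally show ?thesis by (simp add: G2_def)
  qed
  define B where "B = 8 * pi^3 * (2400 * c2\<^sup>2 / c1\<^sup>2 * \<theta> + 4 / (l * K))"
  have B: "0 \<le> B" using c th l K by (simp add: B_def)
  define Y where "Y = B * (G1 * (38 * G2))"
  have Y: "0 \<le> Y" using B G0 by (simp add: Y_def)
  \<comment> \<open>Uniformity in \<open>A\<close> allows the width to be tied to the cutoff in x
    below.\<close>
  have weighted: "(\<integral>\<^sup>+z. ennreal (gauss 1 (fst z) * gauss A (fst (snd z)) * (cmod (\<Sum>i\<in>I. \<Phi> i z))\<^sup>2) \<partial>(lborel \<Otimes>\<^sub>M cyl l)) \<le> ennreal Y"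
    if A: "0 < A" for A
  proof -
    have "(\<integral>\<^sup>+z. ennreal (gauss 1 (fst z) * gauss A (fst (snd z)) * (cmod (\<Sum>i\<in>I. \<Phi> i z))\<^sup>2) \<partial>(lborel \<Otimes>\<^sub>M cyl l))
      \<le> ennreal (B * ((\<Sum>i\<in>I. p i) * (\<Sum>i\<in>I. q i)))"
    proof (rule nn_integral_sum_sq_le)
      show "(\<lambda>z. gauss 1 (fst z) * gauss A (fst (snd z))) \<in> borel_measurable (lborel \<Otimes>\<^sub>M cyl l)"
        using borel_measurable_integrable[OF integrable_weight[OF A]] .
      show "0 \<le> gauss 1 (fst z) * gauss A (fst (snd z))" for z :: "real \<times> (real \<times> real)"
        using gauss_pos[of 1 "fst z"] gauss_pos[of A "fst (snd z)"] by simp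
      fix i
      have "(\<integral>\<^sup>+\<xi>. ennreal ((cmod (hi i \<xi>))\<^sup>2) \<partial>(freq l \<Otimes>\<^sub>M freq l)) \<le> 
         (\<integral>\<^sup>+\<xi>. ennreal ((cmod (r1 (fst \<xi>)))\<^sup>2 * of_bool (sector \<theta> (fst \<xi>) = i)) * ennreal ((cmod (r2 (snd \<xi>)))\<^sup>2 * of_bool (dual_sector \<theta> i (snd \<xi>))) \<partial>(freq l \<Otimes>\<^sub>M freq l))"
      proof (rule nn_integral_mono)
        fix \<xi>
        show "ennreal ((cmod (hi i \<xi>))\<^sup>2) \<le> ennreal ((cmod (r1 (fst \<xi>)))\<^sup>2 * of_bool (sector \<theta> (fst \<xi>) = i)) * ennreal ((cmod (r2 (snd \<xi>)))\<^sup>2 * of_bool (dual_sector \<theta> i (snd \<xi>)))"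
        proof (cases "hi i \<xi> = 0")
          case False
          have "dual_sector \<theta> i (snd \<xi>)"
            by (rule interaction_dual_sector[OF _ th(1) inter[OF False]]) (use c N1 in simp)
          moreover have "sector \<theta> (fst \<xi>) = i" using False by (auto simp: hi_def)
          moreover have "(cmod (hi i \<xi>))\<^sup>2 \<le> (cmod (r1 (fst \<xi>) * r2 (snd \<xi>)))\<^sup>2" using hle by (intro power_mono) auto
          ultimately show ?thesis
            by (simp add: ennreal_mult[symmetric] norm_mult power_mult_distrib ennreal_leI)
        qed simp
      qed
      also have "\<dots> = (\<integral>\<^sup>+a. \<integral>\<^sup>+b. ennreal ((cmod (r1 a))\<^sup>2 * of_bool (sector \<theta> a = i)) * ennreal ((cmod (r2 b))\<^sup>2 * of_bool (dual_sector \<theta> i b)) \<partial>freq l \<partial>freq l)"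
        by (subst F.nn_integral_fst[symmetric]) auto
      also have "\<dots> = (\<integral>\<^sup>+a. ennreal ((cmod (r1 a))\<^sup>2 * of_bool (sector \<theta> a = i)) \<partial>freq l) * (\<integral>\<^sup>+b. ennreal ((cmod (r2 b))\<^sup>2 * of_bool (dual_sector \<theta> i b)) \<partial>freq l)"
        by (simp add: nn_integral_cmult nn_integral_multc)
      also have "\<dots> = ennreal (p i) * ennreal (q i)"
        unfolding p_def q_def by (intro arg_cong2[where f = times] nn_integral_eq_integral bd sm dual_sector_measurable) auto
      finally have hpq: "(\<integral>\<^sup>+\<xi>. ennreal ((cmod (hi i \<xi>))\<^sup>2) \<partial>(freq l \<Otimes>\<^sub>M freq l)) \<le> ennreal (p i * q i)"
        using pq0 by (simp add: ennreal_mult)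
      have "(\<integral>\<^sup>+z. ennreal (gauss 1 (fst z) * gauss A (fst (snd z)) * (cmod (\<Phi> i z))\<^sup>2) \<partial>(lborel \<Otimes>\<^sub>M cyl l)) 
        \<le> ennreal B * (\<integral>\<^sup>+\<xi>. ennreal ((cmod (hi i \<xi>))\<^sup>2) \<partial>(freq l \<Otimes>\<^sub>M freq l))"
        unfolding \<Phi>_def B_def by (rule interaction_phase_bound[OF c(1,2) N1 th l K A hiI inter])
      also have "\<dots> \<le> ennreal B * ennreal (p i * q i)" by (intro mult_left_mono hpq) simp
      also have "\<dots> = ennreal (B * (p i * q i))" using B pq0 by (simp add: ennreal_mult)
      finally show "(\<integral>\<^sup>+z. ennreal (gauss 1 (fst z) * gauss A (fst (snd z)) * (cmod (\<Phi> i z))\<^sup>2) \<partial>(lborel \<Otimes>\<^sub>M cyl l)) \<le> ennreal (B * (p i * q i))" .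
    qed (use finI B pq0 in auto)
    also have "\<dots> \<le> ennreal Y" unfolding Y_def
      using sum_p sum_q B pq0 G0 by (intro ennreal_leI mult_left_mono mult_mono sum_nonneg) auto
    finally show ?thesis .
  qed
  define U where "U w = (\<Sum>i\<in>I. \<Phi> i w)" for w
  have Um [measurable]: "U \<in> borel_measurable (T \<Otimes>\<^sub>M cyl l)" "U \<in> borel_measurable (lborel \<Otimes>\<^sub>M cyl l)"
    unfolding U_def by measurable
  \<comment> \<open>On |x| <= n the Gaussian of width n is at least 1/2, and so is the unit Gaussian
    on [0, 1]; this bounds the cutoff norm by 4 times the weighted one.\<close>
  define S where "S n w = ennreal ((cmod (U w))\<^sup>2) * of_bool (\<bar>fst (snd w)\<bar> \<le> real n)" for n and w :: "real \<times> (real \<times> real)"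
  have Sm [measurable]: "S n \<in> borel_measurable (T \<Otimes>\<^sub>M cyl l)" "S n \<in> borel_measurable (lborel \<Otimes>\<^sub>M cyl l)" for n
    unfolding S_def by measurable
  have Sbound: "(\<integral>\<^sup>+w. S n w \<partial>(T \<Otimes>\<^sub>M cyl l)) \<le> ennreal (4 * Y)" if n: "0 < n" for n
  proof -
    have "(\<integral>\<^sup>+w. S n w \<partial>(T \<Otimes>\<^sub>M cyl l)) = (\<integral>\<^sup>+t. \<integral>\<^sup>+z. S n (t, z) \<partial>cyl l \<partial>T)"
      by (rule C.nn_integral_fst[symmetric]) measurable
    also have "\<dots> = (\<integral>\<^sup>+t. (\<integral>\<^sup>+z. S n (t, z) \<partial>cyl l) * indicator {0..1} t \<partial>lborel)"
      unfolding T_def by (rule nn_integral_restrict_space) simp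
    also have "\<dots> \<le> (\<integral>\<^sup>+t. \<integral>\<^sup>+z. ennreal 4 * ennreal (gauss 1 t * gauss (real n) (fst z) * (cmod (U (t, z)))\<^sup>2) \<partial>cyl l \<partial>lborel)"
    proof (rule nn_integral_mono)
      fix t :: real
      show "(\<integral>\<^sup>+z. S n (t, z) \<partial>cyl l) * indicator {0..1} t \<le> (\<integral>\<^sup>+z. ennreal 4 * ennreal (gauss 1 t * gauss (real n) (fst z) * (cmod (U (t, z)))\<^sup>2) \<partial>cyl l)"
      proof (cases "t \<in> {0..1}")
        case True
        have "S n (t, z) \<le> ennreal 4 * ennreal (gauss 1 t * gauss (real n) (fst z) * (cmod (U (t, z)))\<^sup>2)" for z
        proof (cases "\<bar>fst z\<bar> \<le> real n")
          case z: True
          have "1 / 2 * (1 / 2) \<le> gauss 1 t * gauss (real n) (fst z)"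
            using True z n by (intro mult_mono gauss_ge) (auto simp: less_imp_le[OF gauss_pos])
          then have "1 / 4 * (cmod (U (t, z)))\<^sup>2 \<le> gauss 1 t * gauss (real n) (fst z) * (cmod (U (t, z)))\<^sup>2"
            by (intro mult_right_mono) auto
          then have "(cmod (U (t, z)))\<^sup>2 \<le> 4 * (gauss 1 t * gauss (real n) (fst z) * (cmod (U (t, z)))\<^sup>2)" by simp
          from ennreal_leI[OF this] show ?thesis using z by (simp add: S_def ennreal_mult')
        qed (simp add: S_def)
        then show ?thesis using True by (simp add: nn_integral_mono)
      qed simp
    qed
    also have "\<dots> = (\<integral>\<^sup>+w. ennreal 4 * ennreal (gauss 1 (fst w) * gauss (real n) (fst (snd w)) * (cmod (U w))\<^sup>2) \<partial>(lborel \<Otimes>\<^sub>M cyl l))"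
      by (subst C.nn_integral_fst[symmetric]) auto
    also have "\<dots> = ennreal 4 * (\<integral>\<^sup>+w. ennreal (gauss 1 (fst w) * gauss (real n) (fst (snd w)) * (cmod (U w))\<^sup>2) \<partial>(lborel \<Otimes>\<^sub>M cyl l))"
      by (rule nn_integral_cmult) measurable
    also have "\<dots> \<le> ennreal 4 * ennreal Y"
      unfolding U_def using n by (intro mult_left_mono weighted) auto
    also have "\<dots> = ennreal (4 * Y)" using Y by (simp add: ennreal_mult)
    finally show ?thesis .
  qed
  have inc: "incseq S"
    unfolding incseq_def le_fun_def S_def by (auto simp: of_bool_def intro: order_trans)
  have sup: "(SUP n. S n w) = ennreal ((cmod (U w))\<^sup>2)" for w
  proof (rule antisym)
    show "(SUP n. S n w) \<le> ennreal ((cmod (U w))\<^sup>2)"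
      by (intro SUP_least) (auto simp: S_def of_bool_def)
    obtain n :: nat where "\<bar>fst (snd w)\<bar> \<le> real n" using real_arch_simple by blast
    then have "S n w = ennreal ((cmod (U w))\<^sup>2)" by (simp add: S_def)
    then show "ennreal ((cmod (U w))\<^sup>2) \<le> (SUP n. S n w)" by (metis SUP_upper UNIV_I)
  qed
  have "(\<integral>\<^sup>+w. ennreal ((cmod (U w))\<^sup>2) \<partial>(T \<Otimes>\<^sub>M cyl l)) = (SUP n. \<integral>\<^sup>+w. S n w \<partial>(T \<Otimes>\<^sub>M cyl l))"
    unfolding sup[symmetric] by (rule nn_integral_monotone_convergence_SUP[OF inc]) simp
  also have "\<dots> \<le> ennreal (4 * Y)"
  proof (rule SUP_least)
    fix n
    have "(\<integral>\<^sup>+w. S n w \<partial>(T \<Otimes>\<^sub>M cyl l)) \<le> (\<integral>\<^sup>+w. S (Suc n) w \<partial>(T \<Otimes>\<^sub>M cyl l))"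
      using inc by (intro nn_integral_mono) (auto simp: incseq_Suc_iff le_fun_def)
    also have "\<dots> \<le> ennreal (4 * Y)" by (rule Sbound) simp
    finally show "(\<integral>\<^sup>+w. S n w \<partial>(T \<Otimes>\<^sub>M cyl l)) \<le> ennreal (4 * Y)" .
  qed
  finally have nn: "(\<integral>\<^sup>+w. ennreal ((cmod (U w))\<^sup>2) \<partial>(T \<Otimes>\<^sub>M cyl l)) \<le> ennreal (4 * Y)" .
  \<comment> \<open>Square-integrability comes out of the bound itself, so the integral in
    \<open>L2_norm\<close> is not a default value.\<close>
  have UI: "integrable (T \<Otimes>\<^sub>M cyl l) (\<lambda>w. (cmod (U w))\<^sup>2)"
    by (rule integrableI_bounded) (auto intro: le_less_trans[OF nn])
  have bU': "(case w of (t, z) \<Rightarrow> bilin l (c3 * M) \<theta> g1 g2 t z) = U w" for w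
    using bil by (simp only: U_def K_def)
  then have bU: "(\<lambda>(t, z). bilin l (c3 * M) \<theta> g1 g2 t z) = U" by (rule ext)
  show "in_L2 (T \<Otimes>\<^sub>M cyl l) (\<lambda>(t, z). bilin l (c3 * M) \<theta> g1 g2 t z)"
    unfolding bU in_L2_def using UI by simp
  have "ennreal (\<integral>w. (cmod (U w))\<^sup>2 \<partial>(T \<Otimes>\<^sub>M cyl l)) \<le> ennreal (4 * Y)"
    using nn by (subst nn_integral_eq_integral[OF UI, symmetric]) auto
  then have "(\<integral>w. (cmod (U w))\<^sup>2 \<partial>(T \<Otimes>\<^sub>M cyl l)) \<le> 4 * Y" using Y by (simp add: ennreal_le_iff)
  also have "4 * Y = 1216 * pi^3 * (2400 * c2\<^sup>2 / c1\<^sup>2 * \<theta> + 4 / (l * (c3 * M))) * (G1 * G2)"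
    unfolding Y_def B_def K_def by simp
  finally show "(\<integral>w. (cmod (case w of (t, z) \<Rightarrow> bilin l (c3 * M) \<theta> g1 g2 t z))\<^sup>2 \<partial>(T \<Otimes>\<^sub>M cyl l)) \<le>
      1216 * pi^3 * (2400 * c2\<^sup>2 / c1\<^sup>2 * \<theta> + 4 / (l * (c3 * M))) *
        ((\<integral>\<xi>. (cmod (g1 \<xi>))\<^sup>2 \<partial>freq l) * (\<integral>\<xi>. (cmod (g2 \<xi>))\<^sup>2 \<partial>freq l))"
    unfolding bU' G1_def G2_def .
qed

text \<open>The coefficients 2400 c2^2 / c1^2 of \<theta> and 4 / c3 of 1 / (l M) are both replaced
  by their sum. \<open>144\<close> is 12 times 12, from \<open>has_fourier_L2_bound\<close> applied
  to each profile.\<close>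

lemma bilin_estimate:
  fixes c1 c2 c3 l \<theta> M N1 N2 :: real
  defines "C0 \<equiv> 1216 * pi^3 * (2400 * c2\<^sup>2 / c1\<^sup>2 + 4 / c3) * 144"
  assumes c: "0 < c1" "0 < c2" "0 < c3"
    and l: "1 \<le> l" and th: "0 < \<theta>" "\<theta> \<le> 1/10" and M: "1 < M" and N: "1 < N2" "N2 \<le> N1"
    and \<phi>: "L2_cyl l \<phi>1" "L2_cyl l \<phi>2" and g: "has_fourier_L2 l \<phi>1 g1" "has_fourier_L2 l \<phi>2 g2"
    and supp: "AE \<xi> in freq l. g1 \<xi> \<noteq> 0 \<longrightarrow> c1 * N1 \<le> norm \<xi> \<and> norm \<xi> \<le> c2 * N1"
      "AE \<xi> in freq l. g2 \<xi> \<noteq> 0 \<longrightarrow> c1 * N2 \<le> norm \<xi> \<and> norm \<xi> \<le> c2 * N2"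
  shows "in_L2 (restrict_space lborel {0..1} \<Otimes>\<^sub>M cyl l) (\<lambda>(t, z). bilin l (c3 * M) \<theta> g1 g2 t z) \<and>
     L2_norm (restrict_space lborel {0..1} \<Otimes>\<^sub>M cyl l) (\<lambda>(t, z). bilin l (c3 * M) \<theta> g1 g2 t z)
       \<le> sqrt C0 * sqrt (1 / (l * M) + \<theta>) * L2_norm (cyl l) \<phi>1 * L2_norm (cyl l) \<phi>2"
proof -
  have l0: "0 < l" and M0: "0 < M" and N0: "0 < N2" using l M N by auto
  have gL: "in_L2 (freq l) g1" "in_L2 (freq l) g2" using g by (simp_all add: has_fourier_L2_def)
  have \<phi>L: "in_L2 (cyl l) \<phi>1" "in_L2 (cyl l) \<phi>2" using \<phi> by (simp_all add: L2_cyl_def)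
  define P1 where "P1 = (\<integral>z. (cmod (\<phi>1 z))\<^sup>2 \<partial>cyl l)"
  define P2 where "P2 = (\<integral>z. (cmod (\<phi>2 z))\<^sup>2 \<partial>cyl l)"
  define E where "E = 2400 * c2\<^sup>2 / c1\<^sup>2 * \<theta> + 4 / (l * (c3 * M))"
  define s where "s = 1 / (l * M) + \<theta>"
  have P: "0 \<le> P1" "0 \<le> P2" by (simp_all add: P1_def P2_def integral_nonneg)
  have s: "0 \<le> s" using l0 M0 th by (simp add: s_def)
  have "E \<le> (2400 * c2\<^sup>2 / c1\<^sup>2 + 4 / c3) * s"
  proof -
    have "(2400 * c2\<^sup>2 / c1\<^sup>2 + 4 / c3) * s = E + (2400 * c2\<^sup>2 / c1\<^sup>2 * (1 / (l * M)) + 4 / c3 * \<theta>)"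
      using c l0 M0 by (simp add: E_def s_def field_simps)
    then show ?thesis using c l0 M0 th by simp
  qed
  then have E: "1216 * pi^3 * E \<le> 1216 * pi^3 * ((2400 * c2\<^sup>2 / c1\<^sup>2 + 4 / c3) * s)" by (intro mult_left_mono) auto
  have E0: "0 \<le> E" using c l0 M0 th by (simp add: E_def)
  note b = bilin_L2_bound[OF c l0 th M0 N0 N(2) gL supp]
  show ?thesis
  proof
    show "in_L2 (restrict_space lborel {0..1} \<Otimes>\<^sub>M cyl l) (\<lambda>(t, z). bilin l (c3 * M) \<theta> g1 g2 t z)"
      by (rule b(1))
    have "(\<integral>w. (cmod (case w of (t, z) \<Rightarrow> bilin l (c3 * M) \<theta> g1 g2 t z))\<^sup>2 \<partial>(restrict_space lborel {0..1} \<Otimes>\<^sub>M cyl l))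
      \<le> 1216 * pi^3 * E * ((\<integral>\<xi>. (cmod (g1 \<xi>))\<^sup>2 \<partial>freq l) * (\<integral>\<xi>. (cmod (g2 \<xi>))\<^sup>2 \<partial>freq l))"
      unfolding E_def by (rule b(2))
    also have "\<dots> \<le> 1216 * pi^3 * ((2400 * c2\<^sup>2 / c1\<^sup>2 + 4 / c3) * s) * ((12 * P1) * (12 * P2))"
    proof (intro mult_mono)
      show "(\<integral>\<xi>. (cmod (g1 \<xi>))\<^sup>2 \<partial>freq l) \<le> 12 * P1" "(\<integral>\<xi>. (cmod (g2 \<xi>))\<^sup>2 \<partial>freq l) \<le> 12 * P2"
        unfolding P1_def P2_def using has_fourier_L2_bound[OF l0] \<phi>L g by blast+
    qed (use E E0 P s c in \<open>auto simp: integral_nonneg\<close>)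
    also have "\<dots> = C0 * s * P1 * P2" by (simp add: C0_def)
    finally have "sqrt (\<integral>w. (cmod (case w of (t, z) \<Rightarrow> bilin l (c3 * M) \<theta> g1 g2 t z))\<^sup>2 \<partial>(restrict_space lborel {0..1} \<Otimes>\<^sub>M cyl l))
      \<le> sqrt (C0 * s * P1 * P2)" by (rule real_sqrt_le_mono)
    then show "L2_norm (restrict_space lborel {0..1} \<Otimes>\<^sub>M cyl l) (\<lambda>(t, z). bilin l (c3 * M) \<theta> g1 g2 t z)
       \<le> sqrt C0 * sqrt (1 / (l * M) + \<theta>) * L2_norm (cyl l) \<phi>1 * L2_norm (cyl l) \<phi>2"
      unfolding L2_norm_def P1_def P2_def s_def real_sqrt_mult .
  qed
qed

theorem theorem1p7:
  "\<exists>c4>0. \<forall>c1>0. \<forall>c2>0. \<forall>c3>0. \<exists>C::real.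
     \<forall>(l::real) (\<theta>::real) (M::real) (N1::real) (N2::real) \<phi>1 \<phi>2 g1 g2.
       l \<ge> 1 \<longrightarrow> 0 < \<theta> \<longrightarrow> \<theta> \<le> c4 \<longrightarrow> 1 < M \<longrightarrow> 1 < N2 \<longrightarrow> N2 \<le> N1 \<longrightarrow>
       L2_cyl l \<phi>1 \<longrightarrow> L2_cyl l \<phi>2 \<longrightarrow>
       has_fourier_L2 l \<phi>1 g1 \<longrightarrow> has_fourier_L2 l \<phi>2 g2 \<longrightarrow>
       (AE \<xi> in freq l. g1 \<xi> \<noteq> 0 \<longrightarrow> c1 * N1 \<le> norm \<xi> \<and> norm \<xi> \<le> c2 * N1) \<longrightarrow>
       (AE \<xi> in freq l. g2 \<xi> \<noteq> 0 \<longrightarrow> c1 * N2 \<le> norm \<xi> \<and> norm \<xi> \<le> c2 * N2) \<longrightarrow>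
       in_L2 (restrict_space lborel {0..1} \<Otimes>\<^sub>M cyl l)
         (\<lambda>(t, z). bilin l (c3 * M) \<theta> g1 g2 t z) \<and>
       L2_norm (restrict_space lborel {0..1} \<Otimes>\<^sub>M cyl l)
         (\<lambda>(t, z). bilin l (c3 * M) \<theta> g1 g2 t z)
         \<le> C * sqrt (1 / (l * M) + \<theta>) * L2_norm (cyl l) \<phi>1 * L2_norm (cyl l) \<phi>2"
  \<comment> \<open>\<open>1/10\<close> is chosen ahead of c1, c2, c3. The constant is left
    schematic and read off by unification from the conclusion of \<open>bilin_estimate\<close>,
    where it depends on c1, c2, c3 only.\<close>
  by (rule exI[of _ "1/10"], intro conjI allI impI, simp, rule exI, intro allI impI, rule bilin_estimate)

end
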